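(* Let $n\ge2$, $s\in(0,1)$, let $B_r(x_0)\subset\mathbb R^n$ be a ball with center $x_0$ and radius $r>0$, and let $c\in L^\infty(B_r(x_0))$. Assume $u\in\mathcal L^{2s}(\mathbb R^n)$, $u\ge0$ a.e. in $\mathbb R^n$, and $$\mathscr{L}_su+cu\ge0\qquad\text{in }\mathcal D'(B_r(x_0)\setminus\{x_0\}).$$ If, for some constant $m$, $$u\ge m>0\qquad\text{a.e. in }B_r(x_0)\setminus B_{r/2}(x_0),$$ then $$u\ge\alpha m\qquad\text{a.e. in }B_r(x_0)\setminus\{x_0\},$$ where $\alpha=\alpha\left(n,s,r^{2s}\|c^+\|_{L^\infty(B_r(x_0))}\right)>0$ is a constant depending only on $n$, $s$ and $r^{2s}\|c^+\|_{L^\infty(B_r(x_0))}$, and $c^+=\max\{c,0\}$. In particular, if $0<r\le1$, then $\alpha$ may be chosen to depend only on $n$, $s$ and $\|c^+\|_{L^\infty(B_r(x_0))}$. If $c\le0$, then $\alpha$ may be chosen independently of both $r$ and $c$.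
   Context: $\mathscr{L}_s=-\Delta+(-\Delta)^s$, where the fractional Laplacian is normalized by $(-\Delta)^s\phi(x)=C_{n,s}\,\mathrm{PV}\int_{\mathbb R^n}\frac{\phi(x)-\phi(y)}{|x-y|^{n+2s}}\,dy$ with $C_{n,s}=\frac{2^{2s}\Gamma(s+n/2)}{\pi^{n/2}|\Gamma(-s)|}$. Define $$\mathcal L^{2s}(\mathbb R^n)=\left\{u\in L^1_{\mathrm{loc}}(\mathbb R^n)\ \middle|\ \int_{\mathbb R^n}\frac{|u(x)|}{1+|x|^{n+2s}}\,dx<\infty\right\}$$ (real-valued functions). For $\Omega\subset\mathbb R^n$ open and $u\in\mathcal L^{2s}(\mathbb R^n)$, the distribution $\mathscr{L}_su$ in $\Omega$ is defined by $\langle\mathscr{L}_su,\phi\rangle=\int_{\mathbb R^n}u(x)\,\mathscr{L}_s\phi(x)\,dx$ for $\phi\in C_c^\infty(\Omega)$. An inequality $T\ge0$ in $\mathcal D'(\Omega)$ means $\langle T,\phi\rangle\ge0$ for all $0\le\phi\in C_c^\infty(\Omega)$. *)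

theory Defs
  imports "HOL-Analysis.Analysis" "HOL-Probability.Essential_Supremum"
begin

text \<open>The space \<open>\<real>\<^sup>n\<close> is a type \<open>'a\<close> of class \<open>euclidean_space\<close>, with \<open>n = DIM('a)\<close>.
  Almost everywhere defined functions are represented by total functions on \<open>'a\<close>; values of \<open>c\<close>
  outside the ball, and of \<open>u\<close> on null sets, are irrelevant.\<close>

fun cont_diff :: "nat \<Rightarrow> ('a::euclidean_space \<Rightarrow> real) \<Rightarrow> bool" where
  "cont_diff 0 f \<longleftrightarrow> continuous_on UNIV f"
| "cont_diff (Suc k) f \<longleftrightarrow>
     (\<forall>x. f differentiable (at x)) \<and> (\<forall>v. cont_diff k (\<lambda>x. frechet_derivative f (at x) v))"

definition test_functions :: "'a::euclidean_space set \<Rightarrow> ('a \<Rightarrow> real) set" where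
  "test_functions \<Omega> =
     {\<phi>. (\<forall>k. cont_diff k \<phi>) \<and> compact (closure {x. \<phi> x \<noteq> 0}) \<and> closure {x. \<phi> x \<noteq> 0} \<subseteq> \<Omega>}"

definition laplacian :: "('a::euclidean_space \<Rightarrow> real) \<Rightarrow> 'a \<Rightarrow> real" where
  "laplacian \<phi> x =
     (\<Sum>i\<in>Basis. frechet_derivative (\<lambda>y. frechet_derivative \<phi> (at y) i) (at x) i)"

definition frac_const :: "nat \<Rightarrow> real \<Rightarrow> real" where
  "frac_const n s =
     2 powr (2 * s) * Gamma (s + real n / 2) / (pi powr (real n / 2) * \<bar>Gamma (- s)\<bar>)"

text \<open>The principal value is the limit, as \<open>\<epsilon>\<close> decreases to \<open>0\<close>, of the integrals over the complement of
  the ball of radius \<open>\<epsilon>\<close> around \<open>x\<close>. \<open>Lim\<close> is only meaningful when the limit exists, which is the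
  case for test functions and \<open>0 < s < 1\<close>.\<close>

definition frac_laplacian :: "real \<Rightarrow> ('a::euclidean_space \<Rightarrow> real) \<Rightarrow> 'a \<Rightarrow> real" where
  "frac_laplacian s \<phi> x = frac_const DIM('a) s *
     Lim (at_right 0) (\<lambda>\<epsilon>. LINT y:{y. \<epsilon> < norm (x - y)}|lebesgue.
       (\<phi> x - \<phi> y) / norm (x - y) powr (real DIM('a) + 2 * s))"

definition mixed_op :: "real \<Rightarrow> ('a::euclidean_space \<Rightarrow> real) \<Rightarrow> 'a \<Rightarrow> real" where
  "mixed_op s \<phi> x = - laplacian \<phi> x + frac_laplacian s \<phi> x"

definition weighted_L1 :: "real \<Rightarrow> ('a::euclidean_space \<Rightarrow> real) set" where
  "weighted_L1 s =
     {u. (\<forall>K. compact K \<longrightarrow> set_integrable lebesgue K u) \<and>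
         integrable lebesgue (\<lambda>x. \<bar>u x\<bar> / (1 + norm x powr (real DIM('a) + 2 * s)))}"

definition mixed_op_distr ::
    "real \<Rightarrow> ('a::euclidean_space \<Rightarrow> real) \<Rightarrow> ('a \<Rightarrow> real) \<Rightarrow> real" where
  "mixed_op_distr s u \<phi> = (LINT x|lebesgue. u x * mixed_op s \<phi> x)"

definition regular_distr ::
    "'a::euclidean_space set \<Rightarrow> ('a \<Rightarrow> real) \<Rightarrow> ('a \<Rightarrow> real) \<Rightarrow> real" where
  "regular_distr \<Omega> f \<phi> = (LINT x:\<Omega>|lebesgue. f x * \<phi> x)"

definition distr_nonneg ::
    "'a::euclidean_space set \<Rightarrow> (('a \<Rightarrow> real) \<Rightarrow> real) \<Rightarrow> bool" where
  "distr_nonneg \<Omega> T \<longleftrightarrow> (\<forall>\<phi>\<in>test_functions \<Omega>. (\<forall>x. 0 \<le> \<phi> x) \<longrightarrow> 0 \<le> T \<phi>)"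

definition Linfty :: "'a::euclidean_space set \<Rightarrow> ('a \<Rightarrow> real) set" where
  "Linfty \<Omega> = {f. f \<in> borel_measurable (lebesgue_on \<Omega>) \<and>
                  esssup (lebesgue_on \<Omega>) (\<lambda>x. ereal \<bar>f x\<bar>) < \<infinity>}"

definition Linfty_norm :: "'a::euclidean_space set \<Rightarrow> ('a \<Rightarrow> real) \<Rightarrow> real" where
  "Linfty_norm \<Omega> f = real_of_ereal (esssup (lebesgue_on \<Omega>) (\<lambda>x. ereal \<bar>f x\<bar>))"

end

theory Submission
  imports Defs
begin

text \<open>
  Write \<open>K\<close> for the essential supremum of \<open>max c 0\<close> on the ball. As \<open>u \<ge> 0\<close>, the function \<open>u\<close> is a weak
  supersolution of \<open>L u + K u \<ge> 0\<close> in the punctured ball, and the bound is a minimum principle in which the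
  nonlocal term does all the work. Suppose \<open>u\<close> were smooth with an interior minimum of value \<open>t < m\<close> at \<open>x\<close>. There
  \<open>- \<Delta>u\<close> is not positive; in the fractional Laplacian the annulus, where \<open>u \<ge> m\<close>, contributes at most
  \<open>- a (m - t) r powr (- 2 s)\<close>, and the exterior of the ball, where only \<open>u \<ge> 0\<close> is known, at most
  \<open>b t r powr (- 2 s)\<close>. So \<open>a (m - t) - b t \<le> r powr (2 s) K t\<close>, that is,
  \<open>t \<ge> a m / (a + b + r powr (2 s) K)\<close>. The Laplacian enters through its sign only, so the missing scale
  invariance of the operator does not harm the constant; half of this value is kept to absorb errors.

  Two things stand between this argument and the claim. First, \<open>u\<close> is merely locally integrable. Testing with
  translates of a mollifier turns the weak inequality into a pointwise one for the mollification \<open>U\<close>. By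
  \<open>mixed_op_distr_second_diff\<close> all differences can be moved from the test function to \<open>U\<close>; the operator then
  appears as a limit of second difference quotients of \<open>U\<close> plus an integral of second differences, and both
  have a sign at a minimum without any derivative of \<open>U\<close>.

  Second, nothing is known at the centre, where the minimum could sit. There the barrier
  \<open>\<Phi>(y) = ln (r / \<bar>y\<bar>) + 1 - (\<bar>y\<bar> / r) powr (1 - s)\<close> is added with a small factor \<open>\<epsilon>\<close>. The logarithm is superharmonic
  in dimension at least two, and the power makes \<open>- \<Delta>\<Phi>\<close> at least a multiple of \<open>\<bar>y\<bar> powr (- 1 - s)\<close>
  (\<open>barrier_laplacian\<close>); this beats the fractional Laplacian of \<open>\<Phi>\<close>, whose negative part is only of order
  \<open>\<bar>y\<bar> powr (- 2 s)\<close> (\<open>barrier_levy_bound\<close>). If \<open>\<delta>\<close> is the radius of mollification and \<open>\<epsilon> \<Phi> = \<theta>\<close> at distance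
  \<open>2 \<delta>\<close>, a value of \<open>U + \<epsilon> \<Phi>\<close> below \<open>\<theta>\<close> can only be attained away from the puncture. As \<open>\<delta> \<rightarrow> 0\<close> also \<open>\<epsilon> \<rightarrow> 0\<close>, the
  error caused by the barrier disappears (\<open>mollified_lower_bound\<close>), and averages over small boxes carry the bound
  from \<open>U\<close> to \<open>u\<close> at almost every point (\<open>mollified_lower_bound_imp_AE\<close>).
\<close>

section \<open>Integrals of powers of the norm\<close>

lemma borel_ball [measurable]: "ball (c :: 'a::metric_space) r \<in> sets borel" "cball c r \<in> sets borel"
  by auto

lemma lborel_distr_reflect:
  fixes a :: "'a::euclidean_space"
  shows "distr lborel borel (\<lambda>x. a - x) = lborel"
  using lborel_affine[of "-1" a] by (simp add: density_1)

lemma lborel_distr_translate: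
  fixes a :: "'a::euclidean_space"
  shows "distr lborel borel (\<lambda>x. a + x) = lborel"
  using lborel_affine[of 1 a] by (simp add: density_1)

lemma nn_integral_reflect:
  fixes a :: "'a::euclidean_space" and f :: "'a \<Rightarrow> ennreal"
  assumes [measurable]: "f \<in> borel_measurable borel"
  shows "(\<integral>\<^sup>+x. f (a - x) \<partial>lborel) = (\<integral>\<^sup>+x. f x \<partial>lborel)"
  by (subst (2) lborel_distr_reflect[of a, symmetric], simp add: nn_integral_distr)

lemma
  fixes a :: "'a::euclidean_space" and f :: "'a \<Rightarrow> real"
  assumes [measurable]: "f \<in> borel_measurable borel"
  shows integral_translate: "(\<integral>x. f (a + x) \<partial>lborel) = (\<integral>x. f x \<partial>lborel)"
    and integral_reflect: "(\<integral>x. f (a - x) \<partial>lborel) = (\<integral>x. f x \<partial>lborel)"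
    and integrable_translate_iff: "integrable lborel (\<lambda>x. f (a + x)) \<longleftrightarrow> integrable lborel f"
    and integrable_reflect_iff: "integrable lborel (\<lambda>x. f (a - x)) \<longleftrightarrow> integrable lborel f"
  subgoal by (subst (2) lborel_distr_translate[of a, symmetric], simp add: integral_distr)
  subgoal by (subst (2) lborel_distr_reflect[of a, symmetric], simp add: integral_distr)
  subgoal by (subst (2) lborel_distr_translate[of a, symmetric], simp add: integrable_distr_eq)
  subgoal by (subst (2) lborel_distr_reflect[of a, symmetric], simp add: integrable_distr_eq)
  done

lemma integrable_nonneg_bound:
  fixes f :: "'a \<Rightarrow> real"
  assumes [measurable]: "f \<in> borel_measurable M" and "\<And>x. 0 \<le> f x" "0 \<le> B"
    and le: "(\<integral>\<^sup>+x. ennreal (f x) \<partial>M) \<le> ennreal B"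
  shows "integrable M f" "(\<integral>x. f x \<partial>M) \<le> B"
proof -
  show "integrable M f"
    using le assms(2) by (intro integrableI_nonneg) (auto simp: less_top[symmetric] top_unique)
  show "(\<integral>x. f x \<partial>M) \<le> B"
    using le assms(2,3) by (simp add: integral_eq_nn_integral enn2real_leI)
qed

lemma emeasure_ball_power:
  fixes c :: "'a::euclidean_space"
  assumes "0 \<le> r"
  shows "emeasure lborel (ball c r) = ennreal (unit_ball_vol (real DIM('a)) * r ^ DIM('a))"
  using emeasure_ball[OF assms, of c] by simp

lemma ennreal_term_le_suminf: "f k \<le> (\<Sum>k. f k)" for f :: "nat \<Rightarrow> ennreal"
  using sum_le_suminf[OF summableI, of "{k}" f] by simp

text \<open>A function that is dominated, at each point, by one of countably many constants on concentric balls
  is dominated by their sum; so dyadic shells reduce integrals of powers to a geometric series.\<close>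

lemma integral_le_geometric_series:
  fixes f :: "'a::euclidean_space \<Rightarrow> real" and a R :: "nat \<Rightarrow> real"
  assumes meas: "f \<in> borel_measurable lborel" and f0: "\<And>z. 0 \<le> f z"
    and cover: "\<And>z. f z \<noteq> 0 \<Longrightarrow> \<exists>k. f z \<le> a k \<and> norm z < R k"
    and a0: "\<And>k. 0 \<le> a k" and R0: "\<And>k. 0 \<le> R k"
    and geo: "\<And>k. a k * (unit_ball_vol (real DIM('a)) * R k ^ DIM('a)) = G * q ^ k"
    and q: "0 < q" "q < 1" and G: "0 \<le> G"
  shows "integrable lborel f" "(\<integral>z. f z \<partial>lborel) \<le> G * (1 / (1 - q))"
proof -
  have pt: "ennreal (f z) \<le> (\<Sum>k. ennreal (a k) * indicator (ball 0 (R k)) z)" for z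
  proof (cases "f z = 0")
    case False
    then obtain k where k: "f z \<le> a k" "norm z < R k" using cover by blast
    then have "ennreal (f z) \<le> ennreal (a k) * indicator (ball 0 (R k)) z"
      by (simp add: ennreal_leI)
    also have "\<dots> \<le> (\<Sum>k. ennreal (a k) * indicator (ball 0 (R k)) z)"
      by (rule ennreal_term_le_suminf)
    finally show ?thesis .
  qed simp
  have "(\<integral>\<^sup>+z. ennreal (f z) \<partial>lborel) \<le> (\<integral>\<^sup>+z. (\<Sum>k. ennreal (a k) * indicator (ball 0 (R k)) (z::'a)) \<partial>lborel)"
    by (intro nn_integral_mono pt)
  also have "\<dots> = (\<Sum>k. ennreal (G * q ^ k))"
  proof (subst nn_integral_suminf)
    show "(\<Sum>k. \<integral>\<^sup>+z. ennreal (a k) * indicator (ball 0 (R k)) (z::'a) \<partial>lborel) = (\<Sum>k. ennreal (G * q ^ k))"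
    proof (intro suminf_cong, subst nn_integral_cmult_indicator)
      fix k
      show "ennreal (a k) * emeasure lborel (ball (0::'a) (R k)) = ennreal (G * q ^ k)"
        unfolding emeasure_ball_power[OF R0] geo[symmetric] using a0 R0 by (simp add: ennreal_mult)
    qed simp
  qed (intro borel_measurable_times_ennreal borel_measurable_const borel_measurable_indicator, simp)
  also have "\<dots> = ennreal (\<Sum>k. G * q ^ k)"
    using q G by (intro suminf_ennreal2) (auto intro!: summable_mult summable_geometric)
  also have "(\<Sum>k. G * q ^ k) = G * (1 / (1 - q))"
    using q by (subst suminf_mult) (auto simp: suminf_geometric intro!: summable_geometric)
  finally have bound: "(\<integral>\<^sup>+z. ennreal (f z) \<partial>lborel) \<le> ennreal (G * (1 / (1 - q)))" .
  have "0 \<le> G * (1 / (1 - q))" using q G by simp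
  from integrable_nonneg_bound[OF meas f0 this bound]
  show "integrable lborel f" "(\<integral>z. f z \<partial>lborel) \<le> G * (1 / (1 - q))" .
qed

lemma powr_integral_near:
  fixes p :: real
  assumes p: "0 \<le> p" "p < real DIM('a::euclidean_space)"
  obtains C where "0 < C"
    "\<And>\<rho>. 0 < \<rho> \<Longrightarrow> integrable lborel (\<lambda>z::'a. indicator (ball 0 \<rho>) z * norm z powr (- p))"
    "\<And>\<rho>. 0 < \<rho> \<Longrightarrow> (\<integral>z. indicator (ball 0 \<rho>) (z::'a) * norm z powr (- p) \<partial>lborel)
        \<le> C * \<rho> powr (real DIM('a) - p)"
proof -
  define n where "n = DIM('a)"
  define V where "V = unit_ball_vol (real n)"
  define q :: real where "q = 2 powr (p - real n)"
  have q: "0 < q" "q < 1"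
    using p by (auto simp: q_def n_def powr_less_one)
  have V: "0 < V" by (simp add: V_def)
  define C where "C = V * 2 powr p * (1 / (1 - q))"
  have C: "0 < C" using q V by (simp add: C_def)
  have main: "integrable lborel (\<lambda>z::'a. indicator (ball 0 \<rho>) z * norm z powr (- p)) \<and>
      (\<integral>z. indicator (ball 0 \<rho>) (z::'a) * norm z powr (- p) \<partial>lborel) \<le> C * \<rho> powr (real n - p)"
    if \<rho>: "0 < \<rho>" for \<rho>
  proof -
    define a where "a k = (\<rho> / 2 ^ Suc k) powr (- p)" for k
    define R where "R k = \<rho> / 2 ^ k" for k
    define f where "f z = indicator (ball 0 \<rho>) z * norm z powr (- p)" for z :: 'a
    have cover: "\<exists>k. f z \<le> a k \<and> norm z < R k" if "f z \<noteq> 0" for z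
    proof -
      have z: "z \<noteq> 0" "norm z < \<rho>" using that by (auto simp: f_def indicator_def split: if_splits)
      then obtain j where j: "(1/2::real) ^ j < norm z / \<rho>"
        using real_arch_pow_inv[of "norm z / \<rho>" "1/2"] \<rho> by auto
      define k where "k = (LEAST j. \<rho> / 2 ^ Suc j \<le> norm z)"
      have ex: "\<exists>j. \<rho> / 2 ^ Suc j \<le> norm z"
      proof (intro exI[of _ j])
        have "\<rho> / 2 ^ Suc j \<le> \<rho> / 2 ^ j" using \<rho> by (simp add: field_simps)
        also have "\<dots> \<le> norm z" using j \<rho> by (simp add: field_simps power_one_over)
        finally show "\<rho> / 2 ^ Suc j \<le> norm z" .
      qed
      have k: "\<rho> / 2 ^ Suc k \<le> norm z" unfolding k_def by (rule LeastI_ex[OF ex])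
      have "norm z < R k"
      proof (cases k)
        case 0 then show ?thesis using z by (simp add: R_def)
      next
        case (Suc i)
        then have "\<not> \<rho> / 2 ^ Suc i \<le> norm z"
          using not_less_Least[of i "\<lambda>j. \<rho> / 2 ^ Suc j \<le> norm z"] by (simp add: k_def)
        then show ?thesis using Suc by (simp add: R_def)
      qed
      moreover have "norm z powr (- p) \<le> a k"
        unfolding a_def using k p \<rho> by (intro powr_mono2') auto
      ultimately show ?thesis using z by (auto simp: f_def)
    qed
    have geo: "a k * (unit_ball_vol (real DIM('a)) * R k ^ DIM('a)) = V * 2 powr p * \<rho> powr (real n - p) * q ^ k" for k
      using \<rho> unfolding a_def R_def q_def V_def n_def[symmetric]
      by (simp add: powr_realpow[symmetric] powr_divide powr_powr powr_mult powr_minus powr_diff field_simps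
          powr_add)
    have meas: "f \<in> borel_measurable lborel" unfolding f_def by measurable
    have "0 \<le> V * 2 powr p * \<rho> powr (real n - p)" using V by simp
    from integral_le_geometric_series[OF meas _ cover _ _ geo q this]
    have "integrable lborel f" "(\<integral>z. f z \<partial>lborel) \<le> V * 2 powr p * \<rho> powr (real n - p) * (1 / (1 - q))"
      using \<rho> by (auto simp: f_def[abs_def] a_def R_def)
    then show ?thesis by (simp add: f_def[abs_def] C_def)
  qed
  show thesis
    using main unfolding n_def by (intro that[OF C]) blast+
qed

lemma powr_integral_far:
  fixes p :: real
  assumes p: "real DIM('a::euclidean_space) < p"
  obtains C where "0 < C"
    "\<And>\<rho>. 0 < \<rho> \<Longrightarrow> integrable lborel (\<lambda>z::'a. indicator (- ball 0 \<rho>) z * norm z powr (- p))"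
    "\<And>\<rho>. 0 < \<rho> \<Longrightarrow> (\<integral>z. indicator (- ball 0 \<rho>) (z::'a) * norm z powr (- p) \<partial>lborel)
        \<le> C * \<rho> powr (real DIM('a) - p)"
proof -
  define n where "n = DIM('a)"
  define V where "V = unit_ball_vol (real n)"
  define q :: real where "q = 2 powr (real n - p)"
  have q: "0 < q" "q < 1"
    using p by (auto simp: q_def n_def powr_less_one)
  have V: "0 < V" by (simp add: V_def)
  define C where "C = V * 2 powr n * (1 / (1 - q))"
  have C: "0 < C" using q V by (simp add: C_def)
  have main: "integrable lborel (\<lambda>z::'a. indicator (- ball 0 \<rho>) z * norm z powr (- p)) \<and>
      (\<integral>z. indicator (- ball 0 \<rho>) (z::'a) * norm z powr (- p) \<partial>lborel) \<le> C * \<rho> powr (real n - p)"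
    if \<rho>: "0 < \<rho>" for \<rho>
  proof -
    define a where "a k = (\<rho> * 2 ^ k) powr (- p)" for k
    define R where "R k = \<rho> * 2 ^ Suc k" for k
    define f where "f z = indicator (- ball 0 \<rho>) z * norm z powr (- p)" for z :: 'a
    have cover: "\<exists>k. f z \<le> a k \<and> norm z < R k" if "f z \<noteq> 0" for z
    proof -
      have z: "\<rho> \<le> norm z" using that by (auto simp: f_def indicator_def split: if_splits)
      obtain j where j: "norm z / \<rho> < 2 ^ j"
        using real_arch_pow[of 2 "norm z / \<rho>"] by auto
      define k where "k = (LEAST j. norm z < R j)"
      have ex: "\<exists>j. norm z < R j"
      proof (intro exI[of _ j])
        have "norm z < \<rho> * 2 ^ j" using j \<rho> by (simp add: field_simps)
        also have "\<dots> \<le> R j" using \<rho> by (simp add: R_def)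
        finally show "norm z < R j" .
      qed
      have k: "norm z < R k" unfolding k_def by (rule LeastI_ex[OF ex])
      have "\<rho> * 2 ^ k \<le> norm z"
      proof (cases k)
        case 0 then show ?thesis using z by simp
      next
        case (Suc i)
        then have "\<not> norm z < R i"
          using not_less_Least[of i "\<lambda>j. norm z < R j"] by (simp add: k_def)
        then show ?thesis using Suc by (simp add: R_def)
      qed
      then have "norm z powr (- p) \<le> a k"
        unfolding a_def using p \<rho> by (intro powr_mono2') auto
      then show ?thesis using z k by (auto simp: f_def)
    qed
    have geo: "a k * (unit_ball_vol (real DIM('a)) * R k ^ DIM('a)) = V * 2 powr n * \<rho> powr (real n - p) * q ^ k" for k
      using \<rho> unfolding a_def R_def q_def V_def n_def[symmetric]
      by (simp add: powr_realpow[symmetric] powr_divide powr_powr powr_mult powr_minus powr_diff field_simps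
          powr_add)
    have meas: "f \<in> borel_measurable lborel" unfolding f_def by measurable
    have "0 \<le> V * 2 powr n * \<rho> powr (real n - p)" using V by simp
    from integral_le_geometric_series[OF meas _ cover _ _ geo q this]
    have "integrable lborel f" "(\<integral>z. f z \<partial>lborel) \<le> V * 2 powr n * \<rho> powr (real n - p) * (1 / (1 - q))"
      using \<rho> by (auto simp: f_def[abs_def] a_def R_def)
    then show ?thesis by (simp add: f_def[abs_def] C_def)
  qed
  show thesis
    using main unfolding n_def by (intro that[OF C]) blast+
qed

section \<open>Smooth functions and second differences\<close>

definition dirderiv :: "('a::euclidean_space \<Rightarrow> real) \<Rightarrow> 'a \<Rightarrow> 'a \<Rightarrow> real" where
  "dirderiv f v = (\<lambda>x. frechet_derivative f (at x) v)"

definition smooth :: "('a::euclidean_space \<Rightarrow> real) \<Rightarrow> bool" where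
  "smooth f \<longleftrightarrow> (\<forall>k. cont_diff k f)"

lemma cont_diff_SucD: "cont_diff (Suc k) f \<Longrightarrow> cont_diff k f"
proof (induction k arbitrary: f)
  case 0
  then show ?case
    by (auto simp: continuous_on_eq_continuous_at differentiable_imp_continuous_within)
next
  case (Suc k)
  have "f differentiable (at x)" for x using Suc.prems by simp
  moreover have "cont_diff k (\<lambda>x. frechet_derivative f (at x) v)" for v
    using Suc.prems by (intro Suc.IH) simp
  ultimately show ?case by simp
qed

lemma smooth_dirderiv: "smooth f \<Longrightarrow> smooth (dirderiv f v)"
  unfolding smooth_def dirderiv_def by (metis cont_diff.simps(2))

lemma smooth_continuous: "smooth f \<Longrightarrow> continuous_on A f"
  unfolding smooth_def by (metis cont_diff.simps(1) continuous_on_subset subset_UNIV)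

lemma smooth_has_derivative:
  assumes "smooth f"
  shows "(f has_derivative (\<lambda>v. dirderiv f v x)) (at x)"
proof -
  have "cont_diff (Suc 0) f" using assms unfolding smooth_def by blast
  then have "f differentiable (at x)" by simp
  then show ?thesis by (simp add: frechet_derivative_works dirderiv_def)
qed

lemma dirderiv_eqI: "(f has_derivative f') (at x) \<Longrightarrow> dirderiv f v x = f' v"
  unfolding dirderiv_def by (metis frechet_derivative_at)

lemma smooth_line_DERIV:
  assumes "smooth f"
  shows "((\<lambda>t. f (x + t *\<^sub>R z)) has_real_derivative dirderiv f z (x + t *\<^sub>R z)) (at t)"
proof -
  have "((\<lambda>t. x + t *\<^sub>R z) has_vector_derivative z) (at t)"
    by (auto intro!: derivative_eq_intros)
  moreover have "(f has_derivative (\<lambda>v. dirderiv f v (x + t *\<^sub>R z))) (at (x + t *\<^sub>R z))"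
    by (rule smooth_has_derivative[OF assms])
  ultimately have "((f \<circ> (\<lambda>t. x + t *\<^sub>R z)) has_vector_derivative dirderiv f z (x + t *\<^sub>R z)) (at t)"
    by (rule vector_derivative_diff_chain_within[OF _ has_derivative_at_withinI])
  then show ?thesis
    by (simp add: o_def has_real_derivative_iff_has_vector_derivative)
qed

lemma dirderiv_linear:
  assumes "smooth f"
  shows "dirderiv f z x = (\<Sum>i\<in>Basis. (z \<bullet> i) * dirderiv f i x)"
proof -
  have lin: "linear (\<lambda>v. dirderiv f v x)"
    using smooth_has_derivative[OF assms] by (rule has_derivative_linear)
  have "dirderiv f z x = dirderiv f (\<Sum>i\<in>Basis. (z \<bullet> i) *\<^sub>R i) x"
    by (simp add: euclidean_representation)
  also have "\<dots> = (\<Sum>i\<in>Basis. (z \<bullet> i) * dirderiv f i x)"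
    by (subst linear_sum[OF lin]) (simp add: linear_scale[OF lin])
  finally show ?thesis .
qed

text \<open>Expanding in coordinates leaves finitely many functions, independent of the direction, to be bounded.\<close>

lemma dirderiv_dirderiv_linear:
  assumes "smooth f"
  shows "dirderiv (dirderiv f z) z x
    = (\<Sum>i\<in>Basis. \<Sum>j\<in>Basis. (z \<bullet> i) * (z \<bullet> j) * dirderiv (dirderiv f i) j x)"
proof -
  have "dirderiv f z = (\<lambda>x. \<Sum>i\<in>Basis. (z \<bullet> i) * dirderiv f i x)"
    by (rule ext) (rule dirderiv_linear[OF assms])
  moreover have "((\<lambda>x. \<Sum>i\<in>Basis. (z \<bullet> i) * dirderiv f i x) has_derivative
      (\<lambda>v. \<Sum>i\<in>Basis. (z \<bullet> i) * dirderiv (dirderiv f i) v x)) (at x)"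
    by (intro has_derivative_sum has_derivative_mult_right smooth_has_derivative smooth_dirderiv assms)
  ultimately have "dirderiv (dirderiv f z) z x = (\<Sum>i\<in>Basis. (z \<bullet> i) * dirderiv (dirderiv f i) z x)"
    by (simp add: dirderiv_eqI)
  also have "\<dots> = (\<Sum>i\<in>Basis. (z \<bullet> i) * (\<Sum>j\<in>Basis. (z \<bullet> j) * dirderiv (dirderiv f i) j x))"
    by (intro sum.cong refl arg_cong2[where f="(*)"] dirderiv_linear smooth_dirderiv assms)
  finally show ?thesis by (simp add: sum_distrib_left mult.assoc)
qed

definition second_diff :: "('a::euclidean_space \<Rightarrow> real) \<Rightarrow> 'a \<Rightarrow> 'a \<Rightarrow> real" where
  "second_diff f x z = f (x + z) + f (x - z) - 2 * f x"

abbreviation discrete_laplacian :: "('a::euclidean_space \<Rightarrow> real) \<Rightarrow> 'a \<Rightarrow> nat \<Rightarrow> real" where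
  "discrete_laplacian f x \<equiv>
     (\<lambda>k. \<Sum>i\<in>Basis. second_diff f x ((1 / real (Suc k)) *\<^sub>R i) * (real (Suc k))\<^sup>2)"

text \<open>Taylor's formula for the even function \<open>t \<mapsto> g t + g (- t)\<close>, whose first derivative vanishes at \<open>0\<close>.\<close>

lemma second_diff_mvt_1d:
  fixes g g1 g2 :: "real \<Rightarrow> real"
  assumes h: "0 < h"
    and D: "\<And>t. \<bar>t\<bar> \<le> h \<Longrightarrow> (g has_real_derivative g1 t) (at t)"
      "\<And>t. \<bar>t\<bar> \<le> h \<Longrightarrow> (g1 has_real_derivative g2 t) (at t)"
  obtains t where "0 < t" "t < h" "g h + g (- h) - 2 * g 0 = h\<^sup>2 * ((g2 t + g2 (- t)) / 2)"
proof -
  define diff where "diff m t = (if m = 0 then g t + g (- t) else if m = 1 then g1 t - g1 (- t)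
      else g2 t + g2 (- t))" for m :: nat and t
  have "\<forall>m t. m < 2 \<and> 0 \<le> t \<and> t \<le> h \<longrightarrow> (diff m has_real_derivative diff (Suc m) t) (at t)"
  proof (intro allI impI)
    fix m :: nat and t :: real assume t: "m < 2 \<and> 0 \<le> t \<and> t \<le> h"
    then have t': "\<bar>t\<bar> \<le> h" "\<bar>- t\<bar> \<le> h" by auto
    from t consider "m = 0" | "m = 1" by linarith
    then show "(diff m has_real_derivative diff (Suc m) t) (at t)"
      by cases (auto simp: diff_def[abs_def] intro!: derivative_eq_intros
          DERIV_chain'[OF _ D(1)] DERIV_chain'[OF _ D(2)] D t')
  qed
  from Maclaurin[of h 2 diff "diff 0", OF h _ refl this]
  obtain t where "0 < t" "t < h" "diff 0 h = (\<Sum>m<2. diff m 0 / fact m * h ^ m) + diff 2 t / fact 2 * h ^ 2"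
    by auto
  then show thesis
    by (intro that[of t]) (simp_all add: diff_def numeral_2_eq_2 field_simps)
qed

lemma second_diff_limit_1d:
  fixes g g1 g2 :: "real \<Rightarrow> real"
  assumes \<delta>: "0 < \<delta>"
    and D: "\<And>t. \<bar>t\<bar> < \<delta> \<Longrightarrow> (g has_real_derivative g1 t) (at t)"
      "\<And>t. \<bar>t\<bar> < \<delta> \<Longrightarrow> (g1 has_real_derivative g2 t) (at t)"
    and cont: "isCont g2 0"
  shows "(\<lambda>k. (g (1 / real (Suc k)) + g (- (1 / real (Suc k))) - 2 * g 0) * (real (Suc k))\<^sup>2) \<longlonglongrightarrow> g2 0"
proof (rule tendstoI)
  fix e :: real assume "0 < e"
  then obtain d where d: "0 < d" "\<And>t. \<bar>t\<bar> < d \<Longrightarrow> \<bar>g2 t - g2 0\<bar> < e"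
    using cont unfolding continuous_at_eps_delta by (auto simp: dist_real_def)
  have "\<forall>\<^sub>F k in sequentially. inverse (real (Suc k)) < min \<delta> d"
    using LIMSEQ_inverse_real_of_nat \<delta> d(1) by (intro order_tendstoD) auto
  then show "\<forall>\<^sub>F k in sequentially. dist ((g (1 / real (Suc k)) + g (- (1 / real (Suc k))) - 2 * g 0) * (real (Suc k))\<^sup>2) (g2 0) < e"
  proof eventually_elim
    case (elim k)
    define h where "h = 1 / real (Suc k)"
    have h: "0 < h" "h < \<delta>" "h < d" using elim by (simp_all add: h_def inverse_eq_divide)
    obtain t where t: "0 < t" "t < h" "g h + g (- h) - 2 * g 0 = h\<^sup>2 * ((g2 t + g2 (- t)) / 2)"
      by (rule second_diff_mvt_1d[OF h(1), of g g1 g2]) (use D h in auto)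
    have "(g h + g (- h) - 2 * g 0) * (real (Suc k))\<^sup>2 = (g2 t + g2 (- t)) / 2"
      unfolding t(3) by (simp add: h_def power_divide)
    moreover have "\<bar>g2 t - g2 0\<bar> < e" "\<bar>g2 (- t) - g2 0\<bar> < e"
      using t h by (auto intro!: d(2))
    ultimately show ?case unfolding h_def[symmetric] dist_real_def
      by (simp add: abs_less_iff field_simps)
  qed
qed

lemma second_diff_mvt:
  assumes "smooth f"
  obtains t where "0 < t" "t < 1"
    "second_diff f x z = (dirderiv (dirderiv f z) z (x + t *\<^sub>R z)
        + dirderiv (dirderiv f z) z (x + (- t) *\<^sub>R z)) / 2"
proof -
  obtain t where "0 < t" "t < 1" "f (x + 1 *\<^sub>R z) + f (x + (- 1) *\<^sub>R z) - 2 * f (x + 0 *\<^sub>R z)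
      = 1\<^sup>2 * ((dirderiv (dirderiv f z) z (x + t *\<^sub>R z) + dirderiv (dirderiv f z) z (x + (- t) *\<^sub>R z)) / 2)"
    using second_diff_mvt_1d[OF zero_less_one smooth_line_DERIV[OF assms, of x z]
        smooth_line_DERIV[OF smooth_dirderiv[OF assms], of z x z]] by blast
  then show thesis by (intro that[of t]) (simp_all add: second_diff_def)
qed

lemma dirderiv_zero_outside:
  assumes "closed S" "\<And>x. x \<notin> S \<Longrightarrow> f x = 0" "x \<notin> S"
  shows "dirderiv f v x = 0"
proof -
  have "(f has_derivative (\<lambda>_. 0)) (at x)"
    by (rule has_derivative_transform_within_open[OF has_derivative_const, of "- S"])
      (use assms in auto)
  then show ?thesis by (simp add: dirderiv_eqI)
qed

lemma smooth_second_diff_limit: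
  assumes "smooth f"
  shows "discrete_laplacian f x
    \<longlonglongrightarrow> laplacian f x"
proof -
  have lap: "laplacian f x = (\<Sum>i\<in>Basis. dirderiv (dirderiv f i) i x)"
    by (simp add: laplacian_def dirderiv_def)
  show ?thesis unfolding lap
  proof (intro tendsto_sum)
    fix i :: 'a
    have "continuous_on UNIV (dirderiv (dirderiv f i) i)"
      by (intro smooth_continuous smooth_dirderiv assms)
    then have "continuous_on UNIV (\<lambda>t. dirderiv (dirderiv f i) i (x + t *\<^sub>R i))"
      by (rule continuous_on_compose2) (auto intro!: continuous_intros)
    then have "isCont (\<lambda>t. dirderiv (dirderiv f i) i (x + t *\<^sub>R i)) 0"
      by (simp add: continuous_on_eq_continuous_at)
    from second_diff_limit_1d[OF zero_less_one smooth_line_DERIV[OF assms]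
        smooth_line_DERIV[OF smooth_dirderiv[OF assms]] this]
    show "(\<lambda>n. second_diff f x ((1 / real (Suc n)) *\<^sub>R i) * (real (Suc n))\<^sup>2) \<longlonglongrightarrow> dirderiv (dirderiv f i) i x"
      by (simp add: second_diff_def)
  qed
qed

text \<open>Uniformity in the base point provides an integrable majorant, near the origin, for the integrals of
  second differences against the kernel of the fractional Laplacian.\<close>

lemma smooth_second_diff_bound:
  fixes f :: "'a::euclidean_space \<Rightarrow> real"
  assumes f: "smooth f" and S: "compact S" "\<And>x. x \<notin> S \<Longrightarrow> f x = 0"
  obtains M where "0 \<le> M" "\<And>x z. \<bar>second_diff f x z\<bar> \<le> M * (norm z)\<^sup>2"
proof -
  have "\<exists>B\<ge>0. \<forall>x. \<bar>dirderiv (dirderiv f i) j x\<bar> \<le> B" for i j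
  proof -
    let ?D = "dirderiv (dirderiv f i) j"
    have "compact (?D ` S)"
      by (intro compact_continuous_image smooth_continuous smooth_dirderiv f S)
    then obtain B where B: "\<And>x. x \<in> S \<Longrightarrow> \<bar>?D x\<bar> \<le> B"
      using compact_imp_bounded bounded_iff by (metis imageI real_norm_def)
    have "?D x = 0" if "x \<notin> S" for x
      by (rule dirderiv_zero_outside[of S], use S that compact_imp_closed in auto)
         (rule dirderiv_zero_outside[of S], use S that compact_imp_closed in auto)
    then have "\<bar>?D x\<bar> \<le> max B 0" for x
      using B[of x] by (cases "x \<in> S") auto
    then show ?thesis by (intro exI[of _ "max B 0"]) auto
  qed
  then obtain B where B: "\<And>i j. 0 \<le> B i j" "\<And>i j x. \<bar>dirderiv (dirderiv f i) j x\<bar> \<le> B i j"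
    by metis
  define M where "M = (\<Sum>i\<in>Basis. \<Sum>j\<in>Basis. B i (j::'a))"
  have M: "0 \<le> M" unfolding M_def by (intro sum_nonneg B)
  have D: "\<bar>dirderiv (dirderiv f z) z x\<bar> \<le> M * (norm z)\<^sup>2" for x z
  proof -
    have "\<bar>dirderiv (dirderiv f z) z x\<bar>
      \<le> (\<Sum>i\<in>Basis. \<Sum>j\<in>Basis. \<bar>(z \<bullet> i) * (z \<bullet> j) * dirderiv (dirderiv f i) j x\<bar>)"
      unfolding dirderiv_dirderiv_linear[OF f]
      by (intro order_trans[OF sum_abs] sum_mono order_refl)
    also have "\<dots> \<le> (\<Sum>i\<in>Basis. \<Sum>j\<in>Basis. (norm z * norm z) * B i j)"
      by (intro sum_mono) (auto simp: abs_mult intro!: mult_mono Basis_le_norm B)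
    also have "\<dots> = M * (norm z)\<^sup>2"
      by (simp add: M_def sum_distrib_left[symmetric] power2_eq_square)
    finally show ?thesis .
  qed
  have "\<bar>second_diff f x z\<bar> \<le> M * (norm z)\<^sup>2" for x z
  proof -
    obtain t where "second_diff f x z = (dirderiv (dirderiv f z) z (x + t *\<^sub>R z)
        + dirderiv (dirderiv f z) z (x + (- t) *\<^sub>R z)) / 2"
      by (rule second_diff_mvt[OF f])
    moreover have "\<bar>(a + b) / 2\<bar> \<le> K" if "\<bar>a\<bar> \<le> K" "\<bar>b\<bar> \<le> K" for a b K :: real
      using that by (simp add: abs_le_iff)
    ultimately show ?thesis using D by metis
  qed
  with M show thesis by (rule that)
qed

lemma test_function_smooth: "\<phi> \<in> test_functions \<Omega> \<Longrightarrow> smooth \<phi>"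
  by (simp add: test_functions_def smooth_def)

lemma test_function_support:
  assumes "\<phi> \<in> test_functions \<Omega>"
  obtains R where "0 < R" "\<And>x. R \<le> norm x \<Longrightarrow> \<phi> x = 0"
proof -
  have "bounded (closure {x. \<phi> x \<noteq> 0})"
    using assms by (auto simp: test_functions_def compact_imp_bounded)
  then obtain R where "0 < R" "\<And>x. x \<in> closure {x. \<phi> x \<noteq> 0} \<Longrightarrow> norm x < R"
    by (metis bounded_pos_less)
  then show thesis
    using closure_subset[of "{x. \<phi> x \<noteq> 0}"] by (intro that[of R]) force+
qed

lemma compact_support_bounded:
  fixes f :: "'a::euclidean_space \<Rightarrow> real"
  assumes "continuous_on UNIV f" "\<And>x. R \<le> norm x \<Longrightarrow> f x = 0"
  obtains B where "0 \<le> B" "\<And>x. \<bar>f x\<bar> \<le> B"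
proof -
  have "compact (f ` cball 0 R)"
    by (intro compact_continuous_image compact_cball continuous_on_subset[OF assms(1)]) auto
  then obtain B where "\<And>x. x \<in> cball 0 R \<Longrightarrow> \<bar>f x\<bar> \<le> B"
    using compact_imp_bounded bounded_iff by (metis imageI real_norm_def)
  then have "\<bar>f x\<bar> \<le> max B 0" for x
    using assms(2)[of x] by (cases "norm x \<le> R") (force simp: max_def)+
  then show thesis by (intro that[of "max B 0"]) auto
qed

lemma laplacian_smooth:
  assumes "smooth f"
  shows "continuous_on UNIV (laplacian f)"
    "\<And>S x. closed S \<Longrightarrow> (\<And>x. x \<notin> S \<Longrightarrow> f x = 0) \<Longrightarrow> x \<notin> S \<Longrightarrow> laplacian f x = 0"
proof -
  have lap: "laplacian f = (\<lambda>x. \<Sum>i\<in>Basis. dirderiv (dirderiv f i) i x)"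
    by (auto simp: laplacian_def dirderiv_def)
  show "continuous_on UNIV (laplacian f)"
    unfolding lap by (intro continuous_on_sum smooth_continuous smooth_dirderiv assms)
  show "laplacian f x = 0" if "closed S" "\<And>x. x \<notin> S \<Longrightarrow> f x = 0" "x \<notin> S" for S x
    unfolding lap using that by (intro sum.neutral ballI dirderiv_zero_outside[of S]) auto
qed

lemma integrable_times_compact_support:
  fixes u f :: "'a::euclidean_space \<Rightarrow> real"
  assumes [measurable]: "u \<in> borel_measurable borel"
    and u: "integrable lborel (\<lambda>x. indicator S x * u x)" and S: "compact S"
    and f: "continuous_on UNIV f" "\<And>x. x \<notin> S \<Longrightarrow> f x = 0"
  shows "integrable lborel (\<lambda>x. u x * f x)"
proof -
  have [measurable]: "f \<in> borel_measurable borel" using f(1) by (rule borel_measurable_continuous_onI)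
  have "compact (f ` S)" by (intro compact_continuous_image S continuous_on_subset[OF f(1)]) simp
  then obtain B where B: "\<And>x. x \<in> S \<Longrightarrow> \<bar>f x\<bar> \<le> B"
    using compact_imp_bounded bounded_iff by (metis imageI real_norm_def)
  have "\<bar>u x * f x\<bar> \<le> \<bar>B * (indicator S x * u x)\<bar>" for x
  proof (cases "x \<in> S")
    case True
    have "\<bar>f x\<bar> \<le> \<bar>B\<bar>" using B[OF True] by linarith
    from mult_right_mono[OF this, of "\<bar>u x\<bar>"] True show ?thesis by (simp add: abs_mult mult.commute)
  qed (simp add: f(2))
  then show ?thesis
    by (intro Bochner_Integration.integrable_bound[OF integrable_mult_right[OF u, of B]]) auto
qed

section \<open>The operator as an integral of second differences\<close>

text \<open>The kernel of the fractional Laplacian up to its normalisation. Its value at the origin is \<open>0\<close>, by the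
  convention for \<open>powr\<close>.\<close>

definition levy_kernel :: "real \<Rightarrow> 'a::euclidean_space \<Rightarrow> real" where
  "levy_kernel s z = norm z powr (- (real DIM('a) + 2 * s))"

lemma levy_kernel_nonneg [simp]: "0 \<le> levy_kernel s z"
  by (simp add: levy_kernel_def)

lemma levy_kernel_measurable [measurable]: "levy_kernel s \<in> borel_measurable borel"
  unfolding levy_kernel_def[abs_def] by measurable

lemma divide_norm_powr_eq_levy_kernel:
  "a / norm z powr (real DIM('a) + 2 * s) = a * levy_kernel s (z :: 'a::euclidean_space)"
  unfolding levy_kernel_def by (subst powr_minus_divide) simp

lemma levy_kernel_far:
  assumes "0 < s"
  obtains C where "0 < C"
    "\<And>\<rho>. 0 < \<rho> \<Longrightarrow> integrable lborel (\<lambda>z::'a::euclidean_space. indicator (- ball 0 \<rho>) z * levy_kernel s z)"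
    "\<And>\<rho>. 0 < \<rho> \<Longrightarrow> (\<integral>z. indicator (- ball 0 \<rho>) z * levy_kernel s (z::'a) \<partial>lborel) \<le> C * \<rho> powr (- 2 * s)"
  using powr_integral_far[where 'a='a, of "real DIM('a) + 2 * s"] assms
  unfolding levy_kernel_def by auto

text \<open>The dimension is at least two so that the exponent \<open>n + 2 s - 2\<close> of the integrand is not negative.\<close>

lemma levy_kernel_near:
  assumes "0 < s" "s < 1" and n: "2 \<le> DIM('a::euclidean_space)"
  obtains C where "0 < C"
    "\<And>\<rho>. 0 < \<rho> \<Longrightarrow> integrable lborel (\<lambda>z::'a. indicator (ball 0 \<rho>) z * ((norm z)\<^sup>2 * levy_kernel s z))"
    "\<And>\<rho>. 0 < \<rho> \<Longrightarrow> (\<integral>z. indicator (ball 0 \<rho>) z * ((norm z)\<^sup>2 * levy_kernel s (z::'a)) \<partial>lborel) \<le> C * \<rho> powr (2 - 2 * s)"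
proof -
  have eq: "(norm z)\<^sup>2 * levy_kernel s z = norm z powr (- (real DIM('a) + 2 * s - 2))" for z :: 'a
  proof (cases "z = 0")
    case False
    then have "(norm z)\<^sup>2 = norm z powr 2" by simp
    then show ?thesis by (simp add: levy_kernel_def powr_add[symmetric] algebra_simps del: powr_numeral)
  qed simp
  have "0 \<le> real DIM('a) + 2 * s - 2" "real DIM('a) + 2 * s - 2 < real DIM('a)"
    using assms by auto
  from powr_integral_near[where 'a='a, OF this] show thesis
    unfolding eq[symmetric] using that by (auto simp: algebra_simps)
qed

text \<open>Averaging over \<open>z\<close> and \<open>- z\<close> turns the truncated integrals into integrals of second differences. These have an
  integrable majorant that does not depend on the truncation, so the principal value is an ordinary integral.\<close>

lemma frac_laplacian_second_diff:
  fixes \<phi> :: "'a::euclidean_space \<Rightarrow> real"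
  assumes s: "0 < s" "s < 1" and n: "2 \<le> DIM('a)"
    and \<phi>: "smooth \<phi>" "\<And>x. R \<le> norm x \<Longrightarrow> \<phi> x = 0"
  shows "integrable lborel (\<lambda>z. second_diff \<phi> x z * levy_kernel s z)"
    and "frac_laplacian s \<phi> x
      = - (frac_const DIM('a) s / 2) * (\<integral>z. second_diff \<phi> x z * levy_kernel s z \<partial>lborel)"
proof -
  let ?N = "levy_kernel s :: 'a \<Rightarrow> real"
  have cont: "continuous_on UNIV \<phi>" by (rule smooth_continuous[OF \<phi>(1)])
  have [measurable]: "\<phi> \<in> borel_measurable borel"
    using cont by (rule borel_measurable_continuous_onI)
  obtain B where B: "0 \<le> B" "\<And>x. \<bar>\<phi> x\<bar> \<le> B"
    using compact_support_bounded[OF cont \<phi>(2)] by metis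
  have \<phi>0: "\<phi> x = 0" if "x \<notin> cball 0 R" for x
    using that by (intro \<phi>(2)) simp
  obtain M where M: "0 \<le> M" "\<And>x z. \<bar>second_diff \<phi> x z\<bar> \<le> M * (norm z)\<^sup>2"
    using smooth_second_diff_bound[OF \<phi>(1) compact_cball \<phi>0] by metis
  obtain C1 where C1: "\<And>\<rho>. 0 < \<rho> \<Longrightarrow> integrable lborel (\<lambda>z::'a. indicator (- ball 0 \<rho>) z * ?N z)"
    using levy_kernel_far[OF s(1), where 'a='a] by metis
  obtain C2 where C2: "\<And>\<rho>. 0 < \<rho> \<Longrightarrow> integrable lborel (\<lambda>z::'a. indicator (ball 0 \<rho>) z * ((norm z)\<^sup>2 * ?N z))"
    using levy_kernel_near[OF s n] by metis
  have [measurable]: "(\<lambda>z. second_diff \<phi> x z) \<in> borel_measurable borel"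
    unfolding second_diff_def by measurable
  let ?H = "\<lambda>z. M * (indicator (ball 0 1) z * ((norm z)\<^sup>2 * ?N z)) + 4 * B * (indicator (- ball 0 1) z * ?N z)"
  have H: "integrable lborel ?H"
    by (intro Bochner_Integration.integrable_add integrable_mult_right C1 C2) auto
  have sd4: "\<bar>second_diff \<phi> x z\<bar> \<le> 4 * B" for z
    using B(2)[of "x + z"] B(2)[of "x - z"] B(2)[of x] unfolding second_diff_def by linarith
  have dom: "norm (second_diff \<phi> x z * ?N z) \<le> ?H z" for z
    using mult_right_mono[OF M(2)[of x z], of "?N z"] mult_right_mono[OF sd4[of z], of "?N z"]
    by (cases "norm z < 1") (auto simp: abs_mult indicator_def)
  show int: "integrable lborel (\<lambda>z. second_diff \<phi> x z * ?N z)"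
    by (rule Bochner_Integration.integrable_bound[OF H])
      (auto intro!: always_eventually order_trans[OF dom[unfolded real_norm_def]] abs_ge_self)
  define T where "T \<epsilon> = (LINT y:{y. \<epsilon> < norm (x - y)}|lebesgue.
       (\<phi> x - \<phi> y) / norm (x - y) powr (real DIM('a) + 2 * s))" for \<epsilon>
  define G where "G \<epsilon> z = indicator {z. \<epsilon> < norm z} z * (second_diff \<phi> x z * ?N z)" for \<epsilon> z
  have [measurable]: "G \<epsilon> \<in> borel_measurable borel" for \<epsilon>
    unfolding G_def[abs_def] by measurable
  have T: "T \<epsilon> = - (1/2) * (\<integral>z. G \<epsilon> z \<partial>lborel)" if \<epsilon>: "0 < \<epsilon>" for \<epsilon>
  proof -
    define g where "g y = indicator {y. \<epsilon> < norm (x - y)} y *\<^sub>R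
       ((\<phi> x - \<phi> y) / norm (x - y) powr (real DIM('a) + 2 * s))" for y
    have [measurable]: "g \<in> borel_measurable borel" unfolding g_def by measurable
    have T_g: "T \<epsilon> = (\<integral>y. g y \<partial>lborel)"
      unfolding T_def set_lebesgue_integral_def g_def[symmetric] by (rule integral_completion) simp
    have "\<bar>g (x - z)\<bar> \<le> 2 * B * (indicator (- ball 0 \<epsilon>) z * ?N z)" for z
    proof (cases "\<epsilon> < norm z")
      case True
      have "\<bar>\<phi> x - \<phi> (x - z)\<bar> \<le> 2 * B" using B(2)[of x] B(2)[of "x - z"] by linarith
      from mult_right_mono[OF this, of "?N z"] True show ?thesis
        by (simp add: g_def divide_norm_powr_eq_levy_kernel abs_mult)
    qed (use B(1) in \<open>simp add: g_def\<close>)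
    then have i2: "integrable lborel (\<lambda>z. g (x - z))"
      by (intro Bochner_Integration.integrable_bound[OF integrable_mult_right[OF C1[OF \<epsilon>]], of _ "2 * B"])
        (auto intro!: always_eventually order_trans[OF _ abs_ge_self])
    then have i1: "integrable lborel (\<lambda>z. g (x + z))"
      by (simp add: integrable_translate_iff integrable_reflect_iff)
    have "2 * T \<epsilon> = (\<integral>z. g (x + z) \<partial>lborel) + (\<integral>z. g (x - z) \<partial>lborel)"
      by (simp add: T_g integral_translate integral_reflect)
    also have "\<dots> = (\<integral>z. g (x + z) + g (x - z) \<partial>lborel)"
      using i1 i2 by simp
    also have "(\<lambda>z. g (x + z) + g (x - z)) = (\<lambda>z. - G \<epsilon> z)"
    proof
      fix z
      have "g (x + z) = indicator {z. \<epsilon> < norm z} z * ((\<phi> x - \<phi> (x + z)) * ?N z)"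
        "g (x - z) = indicator {z. \<epsilon> < norm z} z * ((\<phi> x - \<phi> (x - z)) * ?N z)"
        by (simp_all add: g_def divide_norm_powr_eq_levy_kernel indicator_def)
      then show "g (x + z) + g (x - z) = - G \<epsilon> z"
        by (simp add: G_def second_diff_def algebra_simps)
    qed
    finally show ?thesis by simp
  qed
  have "((\<lambda>\<epsilon>. \<integral>z. G \<epsilon> z \<partial>lborel) \<longlongrightarrow> (\<integral>z. second_diff \<phi> x z * ?N z \<partial>lborel)) (at_right 0)"
    unfolding tendsto_at_iff_sequentially
  proof (intro allI impI)
    fix X :: "nat \<Rightarrow> real" assume X: "\<forall>i. X i \<in> {0<..} - {0}" "X \<longlonglongrightarrow> 0"
    show "((\<lambda>\<epsilon>. \<integral>z. G \<epsilon> z \<partial>lborel) \<circ> X) \<longlonglongrightarrow> (\<integral>z. second_diff \<phi> x z * ?N z \<partial>lborel)"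
      unfolding o_def
    proof (rule integral_dominated_convergence[where w="?H"])
      show "AE z in lborel. (\<lambda>i. G (X i) z) \<longlonglongrightarrow> second_diff \<phi> x z * ?N z"
      proof (intro always_eventually allI)
        fix z :: 'a
        show "(\<lambda>i. G (X i) z) \<longlonglongrightarrow> second_diff \<phi> x z * ?N z"
        proof (cases "z = 0")
          case True then show ?thesis by (simp add: G_def levy_kernel_def)
        next
          case False
          then have "\<forall>\<^sub>F i in sequentially. X i < norm z"
            using X(2) by (intro order_tendstoD) auto
          then have "\<forall>\<^sub>F i in sequentially. G (X i) z = second_diff \<phi> x z * ?N z"
            by eventually_elim (simp add: G_def)
          then show ?thesis by (rule tendsto_eventually)
        qed
      qed
      show "AE z in lborel. norm (G (X i) z) \<le> ?H z" for i
        using dom B(1) M(1) by (intro always_eventually allI) (auto simp: G_def indicator_def split: if_splits)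
    qed (use H in auto)
  qed
  then have "((\<lambda>\<epsilon>. - (1/2) * (\<integral>z. G \<epsilon> z \<partial>lborel)) \<longlongrightarrow> - (1/2) * (\<integral>z. second_diff \<phi> x z * ?N z \<partial>lborel)) (at_right 0)"
    by (intro tendsto_intros)
  moreover have "\<forall>\<^sub>F \<epsilon> in at_right 0. - (1/2) * (\<integral>z. G \<epsilon> z \<partial>lborel) = T \<epsilon>"
    using eventually_at_right_less[of "0::real"] by eventually_elim (simp add: T)
  ultimately have "(T \<longlongrightarrow> - (1/2) * (\<integral>z. second_diff \<phi> x z * ?N z \<partial>lborel)) (at_right 0)"
    by (rule Lim_transform_eventually)
  then have "Lim (at_right 0) T = - (1/2) * (\<integral>z. second_diff \<phi> x z * ?N z \<partial>lborel)"
    by (intro tendsto_Lim) auto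
  then show "frac_laplacian s \<phi> x
      = - (frac_const DIM('a) s / 2) * (\<integral>z. second_diff \<phi> x z * levy_kernel s z \<partial>lborel)"
    unfolding frac_laplacian_def T_def[symmetric] by simp
qed

text \<open>Second differences are symmetric, so Fubini's theorem moves them from the test function to
  \<open>P z = \<integral> u(y) \<phi>(y + z) dy\<close>. When \<open>\<phi>\<close> is a translated mollifier, \<open>P\<close> is a reflected mollification of \<open>u\<close>, and a
  weak inequality for \<open>u\<close> becomes a pointwise one.\<close>

lemma mixed_op_distr_second_diff:
  fixes \<phi> u :: "'a::euclidean_space \<Rightarrow> real"
  assumes s: "0 < s" "s < 1" and n: "2 \<le> DIM('a)"
    and \<phi>: "smooth \<phi>" "0 < R" "\<And>x. R \<le> norm x \<Longrightarrow> \<phi> x = 0"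
    and u[measurable]: "u \<in> borel_measurable borel" and u0: "\<And>x. 0 \<le> u x"
    and uloc: "\<And>K. compact K \<Longrightarrow> integrable lborel (\<lambda>x. indicator K x * u x)"
    and uw: "integrable lborel (\<lambda>x. u x / (1 + norm x powr (real DIM('a) + 2 * s)))"
  defines "P \<equiv> \<lambda>z. \<integral>y. u y * \<phi> (y + z) \<partial>lborel"
  shows "integrable lborel (\<lambda>z. second_diff P 0 z * levy_kernel s z)"
    and "discrete_laplacian P 0
      \<longlonglongrightarrow> - mixed_op_distr s u \<phi> - (frac_const DIM('a) s / 2) *
          (\<integral>z. second_diff P 0 z * levy_kernel s z \<partial>lborel)"
proof -
  let ?N = "levy_kernel s :: 'a \<Rightarrow> real"
  define p where "p = real DIM('a) + 2 * s"
  define w where "w x = u x / (1 + norm x powr p)" for x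
  have p: "0 < p" using s by (simp add: p_def)
  have [measurable]: "w \<in> borel_measurable borel" unfolding w_def by measurable
  have w: "integrable lborel w" using uw by (simp add: w_def[abs_def] p_def)
  have w0: "0 \<le> w x" for x using u0 by (simp add: w_def add_nonneg_nonneg)
  have cont: "continuous_on UNIV \<phi>" by (rule smooth_continuous[OF \<phi>(1)])
  have [measurable]: "\<phi> \<in> borel_measurable borel"
    using cont by (rule borel_measurable_continuous_onI)
  obtain B where B: "0 \<le> B" "\<And>x. \<bar>\<phi> x\<bar> \<le> B"
    using compact_support_bounded[OF cont \<phi>(3)] by metis
  have \<phi>0: "\<phi> x = 0" if "x \<notin> cball 0 R" for x
    using that by (intro \<phi>(3)) simp
  obtain M where M: "0 \<le> M" "\<And>x z. \<bar>second_diff \<phi> x z\<bar> \<le> M * (norm z)\<^sup>2"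
    using smooth_second_diff_bound[OF \<phi>(1) compact_cball \<phi>0] by metis
  obtain C1 where C1: "\<And>\<rho>. 0 < \<rho> \<Longrightarrow> integrable lborel (\<lambda>z::'a. indicator (- ball 0 \<rho>) z * ?N z)"
    using levy_kernel_far[OF s(1), where 'a='a] by metis
  obtain C2 where C2: "\<And>\<rho>. 0 < \<rho> \<Longrightarrow> integrable lborel (\<lambda>z::'a. indicator (ball 0 \<rho>) z * ((norm z)\<^sup>2 * ?N z))"
    using levy_kernel_near[OF s n] by metis
  have u\<phi>: "integrable lborel (\<lambda>y. u y * \<phi> (y + z))" for z
  proof (rule integrable_times_compact_support[OF u uloc[OF compact_cball] compact_cball])
    show "continuous_on UNIV (\<lambda>y. \<phi> (y + z))"
      by (rule continuous_on_compose2[OF cont]) (auto intro!: continuous_intros)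
    show "\<phi> (y + z) = 0" if "y \<notin> cball (- z) R" for y
      using that by (intro \<phi>(3)) (simp add: dist_norm norm_minus_commute[of "- z"])
  qed
  have sdP: "(\<integral>y. u y * second_diff \<phi> y z \<partial>lborel) = second_diff P 0 z"
    and int_sd: "integrable lborel (\<lambda>y. u y * second_diff \<phi> y z)" for z
  proof -
    have eq: "(\<lambda>y. u y * second_diff \<phi> y z) = (\<lambda>y. u y * \<phi> (y + z) + u y * \<phi> (y + - z) - 2 * (u y * \<phi> (y + 0)))"
      by (auto simp: second_diff_def algebra_simps)
    have i: "integrable lborel (\<lambda>y. u y * \<phi> (y + z) + u y * \<phi> (y + - z))"
      "integrable lborel (\<lambda>y. 2 * (u y * \<phi> (y + 0)))"
      by (intro Bochner_Integration.integrable_add integrable_mult_right u\<phi>)+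
    show "(\<integral>y. u y * second_diff \<phi> y z \<partial>lborel) = second_diff P 0 z"
      unfolding eq Bochner_Integration.integral_diff[OF i] Bochner_Integration.integral_add[OF u\<phi> u\<phi>]
      by (simp add: second_diff_def P_def)
    show "integrable lborel (\<lambda>y. u y * second_diff \<phi> y z)"
      unfolding eq by (intro Bochner_Integration.integrable_diff i)
  qed

  \<comment> \<open>The Laplacian, by dominated convergence of second difference quotients.\<close>
  have lap_cont: "continuous_on UNIV (laplacian \<phi>)" by (rule laplacian_smooth[OF \<phi>(1)])
  then have lap_m[measurable]: "laplacian \<phi> \<in> borel_measurable borel" by (rule borel_measurable_continuous_onI)
  define Q where "Q k y = discrete_laplacian \<phi> y k" for k y
  let ?D = "\<lambda>y. (real DIM('a) * M) * (indicator (cball 0 (R + 1)) y * u y)"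
  have [measurable]: "(\<lambda>y. Q k y) \<in> borel_measurable borel" for k
    unfolding Q_def second_diff_def by measurable
  have Q_bd: "norm (u y * Q k y) \<le> ?D y" for k y
  proof (cases "norm y \<le> R + 1")
    case True
    have "\<bar>Q k y\<bar> \<le> (\<Sum>i\<in>(Basis::'a set). M)"
      unfolding Q_def
    proof (intro order_trans[OF sum_abs] sum_mono)
      fix i :: 'a assume i: "i \<in> Basis"
      have "\<bar>second_diff \<phi> y ((1 / real (Suc k)) *\<^sub>R i)\<bar> * (real (Suc k))\<^sup>2 \<le> (M * (norm ((1 / real (Suc k)) *\<^sub>R i))\<^sup>2) * (real (Suc k))\<^sup>2"
        by (intro mult_right_mono M) auto
      also have "\<dots> = M" using i by (simp add: power_divide)
      finally show "\<bar>second_diff \<phi> y ((1 / real (Suc k)) *\<^sub>R i) * (real (Suc k))\<^sup>2\<bar> \<le> M"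
        by (simp add: abs_mult)
    qed
    then have "\<bar>Q k y\<bar> \<le> real DIM('a) * M" by simp
    from mult_right_mono[OF this u0[of y]] True u0[of y] show ?thesis
      by (simp add: abs_mult mult.commute)
  next
    case False
    have "second_diff \<phi> y ((1 / real (Suc k)) *\<^sub>R i) = 0" if i: "i \<in> Basis" for i
    proof -
      have 1: "norm ((1 / real (Suc k)) *\<^sub>R i) \<le> 1" using i by simp
      have "R \<le> norm (y + (1 / real (Suc k)) *\<^sub>R i)"
        using norm_diff_ineq[of y "(1 / real (Suc k)) *\<^sub>R i"] False 1 by linarith
      moreover have "R \<le> norm (y - (1 / real (Suc k)) *\<^sub>R i)"
        using norm_triangle_ineq2[of y "(1 / real (Suc k)) *\<^sub>R i"] False 1 by linarith
      moreover have "R \<le> norm y" using False by simp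
      ultimately show ?thesis by (simp add: second_diff_def \<phi>(3))
    qed
    then show ?thesis using False by (simp add: Q_def)
  qed
  have D: "integrable lborel ?D" by (intro integrable_mult_right uloc compact_cball)
  have uQ: "(\<lambda>k. \<integral>y. u y * Q k y \<partial>lborel) \<longlonglongrightarrow> (\<integral>y. u y * laplacian \<phi> y \<partial>lborel)"
    and ulap: "integrable lborel (\<lambda>y. u y * laplacian \<phi> y)"
  proof -
    have c: "AE y in lborel. (\<lambda>k. u y * Q k y) \<longlonglongrightarrow> u y * laplacian \<phi> y"
      unfolding Q_def by (intro always_eventually allI tendsto_mult tendsto_const smooth_second_diff_limit \<phi>(1))
    show "(\<lambda>k. \<integral>y. u y * Q k y \<partial>lborel) \<longlonglongrightarrow> (\<integral>y. u y * laplacian \<phi> y \<partial>lborel)"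
      by (rule integral_dominated_convergence[OF _ _ D c]) (use Q_bd in auto)
    show "integrable lborel (\<lambda>y. u y * laplacian \<phi> y)"
      by (rule integrable_dominated_convergence[OF _ _ D c]) (use Q_bd in auto)
  qed
  have uQ_eq: "(\<integral>y. u y * Q k y \<partial>lborel)
      = discrete_laplacian P 0 k" for k
  proof -
    have "(\<integral>y. u y * Q k y \<partial>lborel)
      = (\<integral>y. (\<Sum>i\<in>Basis. (u y * second_diff \<phi> y ((1 / real (Suc k)) *\<^sub>R i)) * (real (Suc k))\<^sup>2) \<partial>lborel)"
      unfolding Q_def by (simp add: sum_distrib_left mult.assoc)
    also have "\<dots> = (\<Sum>i\<in>Basis. (\<integral>y. (u y * second_diff \<phi> y ((1 / real (Suc k)) *\<^sub>R i)) * (real (Suc k))\<^sup>2 \<partial>lborel))"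
      by (intro Bochner_Integration.integral_sum integrable_mult_left int_sd)
    finally show ?thesis by (simp add: sdP)
  qed

  \<comment> \<open>The nonlocal part, by Fubini's theorem. Small \<open>z\<close> are controlled by the quadratic bound on second
    differences of \<open>\<phi>\<close>, large \<open>z\<close> by the weight: the three terms of \<open>H\<close> below are
    products, up to translation, of integrable functions of one variable.\<close>
  define S where "S = R + 1"
  define J where "J = (\<integral>y. \<bar>\<phi> y\<bar> \<partial>lborel)"
  define F where "F y z = u y * (second_diff \<phi> y z * ?N z)" for y z
  define H where "H y z = M * (indicator (cball 0 S) y * u y) * (indicator (ball 0 1) z * ((norm z)\<^sup>2 * ?N z))
     + (1 + S powr p) * w y * (\<bar>\<phi> (y + z)\<bar> + \<bar>\<phi> (y - z)\<bar>)
     + 2 * (u y * \<bar>\<phi> y\<bar>) * (indicator (- ball 0 1) z * ?N z)" for y z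
  have [measurable]: "(\<lambda>(y, z). F y z) \<in> borel_measurable (lborel \<Otimes>\<^sub>M lborel)"
    unfolding F_def second_diff_def by measurable
  have Hm[measurable]: "(\<lambda>(y, z). H y z) \<in> borel_measurable (lborel \<Otimes>\<^sub>M lborel)"
    unfolding H_def by measurable
  have \<phi>_int: "integrable lborel (\<lambda>z. \<bar>\<phi> z\<bar>)"
  proof (rule Bochner_Integration.integrable_bound)
    show "integrable lborel (\<lambda>y::'a. B * indicator (cball 0 R) y)"
      using emeasure_lborel_cball_finite[of "0::'a" R] by (intro integrable_mult_right integrable_real_indicator) auto
    show "AE y in lborel. norm \<bar>\<phi> y\<bar> \<le> norm (B * indicator (cball 0 R) y)"
      using B \<phi>(3) by (intro always_eventually allI) (auto simp: indicator_def abs_mult)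
  qed simp
  have \<phi>_tr: "integrable lborel (\<lambda>z. \<bar>\<phi> (y + z)\<bar>)" "integrable lborel (\<lambda>z. \<bar>\<phi> (y - z)\<bar>)"
    "(\<integral>z. \<bar>\<phi> (y + z)\<bar> \<partial>lborel) = J" "(\<integral>z. \<bar>\<phi> (y - z)\<bar> \<partial>lborel) = J" for y
    using \<phi>_int integrable_translate_iff[of "\<lambda>z. \<bar>\<phi> z\<bar>" y] integrable_reflect_iff[of "\<lambda>z. \<bar>\<phi> z\<bar>" y]
      integral_translate[of "\<lambda>z. \<bar>\<phi> z\<bar>" y] integral_reflect[of "\<lambda>z. \<bar>\<phi> z\<bar>" y]
    by (simp_all add: J_def)
  have S: "0 < S" using \<phi>(2) by (simp add: S_def)
  have H0: "0 \<le> H y z" for y z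
    unfolding H_def using M(1) u0 w0 S by (intro add_nonneg_nonneg mult_nonneg_nonneg) auto
  have FH: "norm (F y z) \<le> H y z" for y z
  proof (cases "norm z < 1")
    case True
    show ?thesis
    proof (cases "norm y \<le> S")
      case in_S: True
      have "norm (F y z) = u y * (\<bar>second_diff \<phi> y z\<bar> * ?N z)"
        using u0[of y] by (simp add: F_def abs_mult)
      also have "\<dots> \<le> u y * ((M * (norm z)\<^sup>2) * ?N z)"
        by (intro mult_left_mono mult_right_mono M u0) simp
      also have "\<dots> \<le> H y z"
        unfolding H_def using True in_S w0 by (simp add: add_nonneg_nonneg)
      finally show ?thesis .
    next
      case False
      have "R \<le> norm (y + z)" "R \<le> norm (y - z)" "R \<le> norm y"
        using norm_diff_ineq[of y z] norm_triangle_ineq2[of y z] False True by (auto simp: S_def)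
      then have "F y z = 0" by (simp add: F_def second_diff_def \<phi>(3))
      then show ?thesis using H0 by simp
    qed
  next
    case False
    \<comment> \<open>If \<open>x = y + z\<close> or \<open>x = y - z\<close> lies in the support of \<open>\<phi>\<close> and \<open>\<bar>z\<bar> \<ge> 1\<close>, then \<open>\<bar>y\<bar> \<le> S \<bar>z\<bar>\<close>, so the kernel is at
      most a multiple of the weight at \<open>y\<close>.\<close>
    have key: "u y * (\<bar>\<phi> x\<bar> * ?N z) \<le> (1 + S powr p) * w y * \<bar>\<phi> x\<bar>" if x: "norm y \<le> norm x + norm z" for x
    proof (cases "R \<le> norm x")
      case R: False
      have "norm y \<le> R * 1 + norm z" using x R by simp
      also have "R * 1 \<le> R * norm z" using False \<phi>(2) by (intro mult_left_mono) auto
      finally have "norm y \<le> S * norm z" by (simp add: S_def algebra_simps)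
      then have "norm y powr p \<le> (S * norm z) powr p" using p by (intro powr_mono2) auto
      moreover have "1 powr p \<le> norm z powr p" using False p by (intro powr_mono2) auto
      ultimately have le: "1 + norm y powr p \<le> (1 + S powr p) * norm z powr p"
        using S by (simp add: powr_mult algebra_simps)
      have "0 < norm z powr p" "0 < 1 + norm y powr p"
        using False by (auto simp: add_pos_nonneg)
      with le have "?N z \<le> (1 + S powr p) * (1 / (1 + norm y powr p))"
        unfolding levy_kernel_def p_def[symmetric] powr_minus_divide
        by (simp add: pos_divide_le_eq pos_le_divide_eq)
      from mult_left_mono[OF this, of "u y * \<bar>\<phi> x\<bar>"] u0[of y]
      show ?thesis by (simp add: w_def mult_ac)
    qed (simp add: \<phi>(3))
    have "norm (F y z) = u y * (\<bar>second_diff \<phi> y z\<bar> * ?N z)"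
      using u0[of y] by (simp add: F_def abs_mult)
    also have "\<dots> \<le> u y * ((\<bar>\<phi> (y + z)\<bar> + \<bar>\<phi> (y - z)\<bar> + 2 * \<bar>\<phi> y\<bar>) * ?N z)"
      by (intro mult_left_mono mult_right_mono u0) (auto simp: second_diff_def)
    also have "\<dots> = u y * (\<bar>\<phi> (y + z)\<bar> * ?N z) + u y * (\<bar>\<phi> (y - z)\<bar> * ?N z) + 2 * (u y * \<bar>\<phi> y\<bar>) * ?N z"
      by (simp add: algebra_simps)
    also have "\<dots> \<le> (1 + S powr p) * w y * \<bar>\<phi> (y + z)\<bar> + (1 + S powr p) * w y * \<bar>\<phi> (y - z)\<bar> + 2 * (u y * \<bar>\<phi> y\<bar>) * ?N z"
      using norm_triangle_ineq[of "y - z" z] norm_triangle_ineq4[of "y + z" z]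
      by (intro add_mono key order_refl) auto
    also have "\<dots> \<le> H y z"
      unfolding H_def using False by (simp add: algebra_simps)
    finally show ?thesis .
  qed
  have H_int: "integrable (lborel \<Otimes>\<^sub>M lborel) (\<lambda>(y, z). H y z)"
  proof (rule lborel_pair.Fubini_integrable[OF Hm])
    define c1 where "c1 = (\<integral>z. indicator (ball 0 1) z * ((norm z)\<^sup>2 * ?N z) \<partial>lborel)"
    define c2 where "c2 = (\<integral>z. indicator (- ball 0 1) z * ?N z \<partial>lborel)"
    have i: "integrable lborel (\<lambda>z. M * (indicator (cball 0 S) y * u y) * (indicator (ball 0 1) z * ((norm z)\<^sup>2 * ?N z)))"
       "integrable lborel (\<lambda>z. (1 + S powr p) * w y * (\<bar>\<phi> (y + z)\<bar> + \<bar>\<phi> (y - z)\<bar>))"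
       "integrable lborel (\<lambda>z. 2 * (u y * \<bar>\<phi> y\<bar>) * (indicator (- ball 0 1) z * ?N z))" for y
      by (intro integrable_mult_right Bochner_Integration.integrable_add C1 C2 \<phi>_tr zero_less_one)+
    show "AE y in lborel. integrable lborel (\<lambda>z. case (y, z) of (y, z) \<Rightarrow> H y z)"
      unfolding H_def prod.case
      by (intro always_eventually allI Bochner_Integration.integrable_add i)
    have "(\<integral>z. H y z \<partial>lborel) = M * (indicator (cball 0 S) y * u y) * c1
      + (1 + S powr p) * w y * (J + J) + 2 * (u y * \<bar>\<phi> y\<bar>) * c2" for y
      unfolding H_def
      by (subst Bochner_Integration.integral_add Bochner_Integration.integral_add[OF i(1,2)],
            (intro Bochner_Integration.integrable_add i)+)+
         (simp add: c1_def c2_def \<phi>_tr)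
    moreover have "integrable lborel (\<lambda>y. M * (indicator (cball 0 S) y * u y) * c1
      + (1 + S powr p) * w y * (J + J) + 2 * (u y * \<bar>\<phi> y\<bar>) * c2)"
    proof (intro Bochner_Integration.integrable_add integrable_mult_left integrable_mult_right uloc compact_cball w)
      show "integrable lborel (\<lambda>y. u y * \<bar>\<phi> y\<bar>)"
        using integrable_norm[OF u\<phi>[of 0]] u0 by (simp add: abs_mult)
    qed
    ultimately show "integrable lborel (\<lambda>y. \<integral>z. norm (case (y, z) of (y, z) \<Rightarrow> H y z) \<partial>lborel)"
      using H0 by simp
  qed
  have F_int: "integrable (lborel \<Otimes>\<^sub>M lborel) (\<lambda>(y, z). F y z)"
    by (rule Bochner_Integration.integrable_bound[OF H_int])
      (use FH H0 in \<open>auto intro!: always_eventually\<close>)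
  have swap: "(\<integral>z. (\<integral>y. F y z \<partial>lborel) \<partial>lborel) = (\<integral>y. (\<integral>z. F y z \<partial>lborel) \<partial>lborel)"
    by (rule lborel_pair.Fubini_integral[OF F_int])
  have Fz: "(\<integral>y. F y z \<partial>lborel) = second_diff P 0 z * ?N z" for z
  proof -
    have "(\<integral>y. F y z \<partial>lborel) = (\<integral>y. (u y * second_diff \<phi> y z) * ?N z \<partial>lborel)"
      by (simp add: F_def mult.assoc)
    also have "\<dots> = second_diff P 0 z * ?N z" by (simp add: sdP)
    finally show ?thesis .
  qed
  show "integrable lborel (\<lambda>z. second_diff P 0 z * levy_kernel s z)"
    using lborel_pair.integrable_snd[OF F_int] by (simp add: Fz)
  have Fy_int: "integrable lborel (\<lambda>y. \<integral>z. F y z \<partial>lborel)"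
    using lborel_pair.integrable_fst[OF F_int] by simp
  have mixed: "u y * mixed_op s \<phi> y = - (u y * laplacian \<phi> y) + - (frac_const DIM('a) s / 2) * (\<integral>z. F y z \<partial>lborel)" for y
  proof -
    have "frac_laplacian s \<phi> y = - (frac_const DIM('a) s / 2) * (\<integral>z. second_diff \<phi> y z * ?N z \<partial>lborel)"
      using frac_laplacian_second_diff(2)[OF s n \<phi>(1,3)] by simp
    then show ?thesis by (simp add: mixed_op_def F_def algebra_simps)
  qed
  have "mixed_op_distr s u \<phi> = (\<integral>y. u y * mixed_op s \<phi> y \<partial>lborel)"
    unfolding mixed_op_distr_def
  proof (rule integral_completion)
    show "(\<lambda>y. u y * mixed_op s \<phi> y) \<in> borel_measurable lborel"
      unfolding mixed using ulap Fy_int by (intro borel_measurable_integrable Bochner_Integration.integrable_add integrable_mult_right Bochner_Integration.integrable_minus)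
  qed
  also have "\<dots> = - (\<integral>y. u y * laplacian \<phi> y \<partial>lborel)
      + - (frac_const DIM('a) s / 2) * (\<integral>y. (\<integral>z. F y z \<partial>lborel) \<partial>lborel)"
    unfolding mixed using ulap Fy_int
    by (subst Bochner_Integration.integral_add) (auto intro!: integrable_mult_right Bochner_Integration.integrable_minus)
  also have "(\<integral>y. (\<integral>z. F y z \<partial>lborel) \<partial>lborel) = (\<integral>z. second_diff P 0 z * ?N z \<partial>lborel)"
    unfolding swap[symmetric] Fz ..
  finally have "(\<integral>y. u y * laplacian \<phi> y \<partial>lborel) = - mixed_op_distr s u \<phi> - (frac_const DIM('a) s / 2) *
          (\<integral>z. second_diff P 0 z * ?N z \<partial>lborel)" by simp
  with uQ show "discrete_laplacian P 0
      \<longlonglongrightarrow> - mixed_op_distr s u \<phi> - (frac_const DIM('a) s / 2) *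
          (\<integral>z. second_diff P 0 z * levy_kernel s z \<partial>lborel)"
    unfolding uQ_eq by simp
qed

section \<open>Mollifiers\<close>

text \<open>The functions \<open>p(1/t) exp(- 1/t)\<close>, extended by zero to \<open>t \<le> 0\<close>, are closed under differentiation when \<open>p\<close> ranges
  over all polynomials. One induction on the order of differentiation then shows that they are smooth.\<close>

definition flat :: "real poly \<Rightarrow> real \<Rightarrow> real" where
  "flat p t = (if 0 < t then poly p (1 / t) * exp (- (1 / t)) else 0)"

lemma poly_times_exp_minus_tendsto_0: "((\<lambda>x. poly p x * exp (- x)) \<longlongrightarrow> 0) at_top" for p :: "real poly"
proof -
  have "((\<lambda>x. \<Sum>i\<le>degree p. coeff p i * (x ^ i / exp x)) \<longlongrightarrow> (\<Sum>i\<le>degree p. coeff p i * 0)) at_top"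
    by (intro tendsto_sum tendsto_mult tendsto_const tendsto_power_div_exp_0)
  then show ?thesis
    by (simp add: poly_altdef sum_distrib_right exp_minus divide_inverse mult.assoc)
qed

lemma flat_DERIV: "(flat p has_real_derivative flat ([:0, 0, 1:] * (p - pderiv p)) t) (at t)"
proof -
  consider "0 < t" | "t < 0" | "t = 0" by linarith
  then show ?thesis
  proof cases
    case 1
    have "((\<lambda>t. poly p (1 / t) * exp (- (1 / t))) has_real_derivative
        flat ([:0, 0, 1:] * (p - pderiv p)) t) (at t)"
      using 1 by (auto intro!: derivative_eq_intros DERIV_chain'[OF _ poly_DERIV]
          simp: flat_def power2_eq_square field_simps)
    then show ?thesis
      by (rule has_field_derivative_transform_within_open[where S="{0<..}"])
        (use 1 in \<open>auto simp: flat_def\<close>)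
  next
    case 2
    then have "flat ([:0, 0, 1:] * (p - pderiv p)) t = 0" by (simp add: flat_def)
    moreover have "(flat p has_real_derivative 0) (at t)"
      by (rule has_field_derivative_transform_within_open[OF DERIV_const, where S="{..<0}"])
        (use 2 in \<open>auto simp: flat_def\<close>)
    ultimately show ?thesis by simp
  next
    \<comment> \<open>After the substitution \<open>h = 1/x\<close> the difference quotient at \<open>0\<close> is a polynomial times \<open>exp(- x)\<close>.\<close>
    case 3
    have "((\<lambda>h. flat p h / h) \<longlongrightarrow> 0) (at 0)"
    proof (rule filterlim_split_at)
      show "((\<lambda>h. flat p h / h) \<longlongrightarrow> 0) (at_left 0)"
        by (rule tendsto_eventually)
          (use eventually_at_left_real[of "-1" 0] in \<open>auto elim!: eventually_mono simp: flat_def\<close>)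
      have "((\<lambda>x. poly ([:0, 1:] * p) x * exp (- x)) \<longlongrightarrow> 0) at_top"
        by (rule poly_times_exp_minus_tendsto_0)
      moreover have "\<forall>\<^sub>F x :: real in at_top. poly ([:0, 1:] * p) x * exp (- x) = flat p (inverse x) / inverse x"
        using eventually_gt_at_top[of "0::real"]
        by eventually_elim (simp add: flat_def field_simps)
      ultimately have "((\<lambda>x. flat p (inverse x) / inverse x) \<longlongrightarrow> 0) at_top"
        by (rule Lim_transform_eventually)
      then show "((\<lambda>h. flat p h / h) \<longlongrightarrow> 0) (at_right 0)"
        by (simp add: filterlim_at_right_to_top)
    qed
    then show ?thesis using 3 by (simp add: DERIV_def flat_def)
  qed
qed

lemma cont_diff_const: "cont_diff k (\<lambda>x. c)"
  by (induction k arbitrary: c) (auto simp: frechet_derivative_const)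

lemma cont_diff_add: "cont_diff k f \<Longrightarrow> cont_diff k g \<Longrightarrow> cont_diff k (\<lambda>x. f x + g x)"
proof (induction k arbitrary: f g)
  case 0 then show ?case by (simp add: continuous_on_add)
next
  case (Suc k)
  have "frechet_derivative (\<lambda>x. f x + g x) (at x) = (\<lambda>v. frechet_derivative f (at x) v + frechet_derivative g (at x) v)" for x
    using Suc.prems by (intro frechet_derivative_at[symmetric] has_derivative_add) (simp_all add: frechet_derivative_works[symmetric])
  then show ?case using Suc by (auto intro!: differentiable_add)
qed

lemma cont_diff_mult: "cont_diff k f \<Longrightarrow> cont_diff k g \<Longrightarrow> cont_diff k (\<lambda>x. f x * g x)"
proof (induction k arbitrary: f g)
  case 0 then show ?case by (simp add: continuous_on_mult)
next
  case (Suc k)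
  have D: "frechet_derivative (\<lambda>x. f x * g x) (at x)
      = (\<lambda>v. f x * frechet_derivative g (at x) v + frechet_derivative f (at x) v * g x)" for x
    using Suc.prems by (intro frechet_derivative_at[symmetric] has_derivative_mult) (simp_all add: frechet_derivative_works[symmetric])
  have "cont_diff k f" "cont_diff k g"
    using Suc.prems by (auto intro: cont_diff_SucD)
  then show ?case unfolding cont_diff.simps D
    using Suc by (auto intro!: differentiable_mult cont_diff_add)
qed

lemma cont_diff_affine: "cont_diff k (\<lambda>x. c * ((x - a) \<bullet> v))"
proof (cases k)
  case 0 then show ?thesis by (auto intro!: continuous_intros)
next
  case (Suc j)
  have D: "((\<lambda>x. c * ((x - a) \<bullet> v)) has_derivative (\<lambda>w. c * (w \<bullet> v))) (at x)" for x
    by (auto intro!: derivative_eq_intros)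
  have "frechet_derivative (\<lambda>x. c * ((x - a) \<bullet> v)) (at x) = (\<lambda>w. c * (w \<bullet> v))" for x
    by (rule frechet_derivative_at[symmetric]) (rule D)
  moreover have "(\<lambda>x. c * ((x - a) \<bullet> v)) differentiable (at x)" for x
    unfolding differentiable_def by (rule exI) (rule D)
  ultimately show ?thesis unfolding Suc cont_diff.simps by (auto intro: cont_diff_const)
qed

lemma cont_diff_bump: "cont_diff k (\<lambda>x. flat p (d - (x - a) \<bullet> (x - a)))"
proof (induction k arbitrary: p)
  case 0
  have "continuous_on UNIV (flat p)"
    using flat_DERIV[of p] by (intro DERIV_continuous_on) (auto intro: has_field_derivative_at_within)
  then show ?case
    by (auto intro!: continuous_intros continuous_on_compose2[of UNIV "flat p"])
next
  case (Suc k)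
  let ?q = "[:0, 0, 1:] * (p - pderiv p)"
  have D: "((\<lambda>x. flat p (d - (x - a) \<bullet> (x - a))) has_derivative
      (\<lambda>v. flat ?q (d - (x - a) \<bullet> (x - a)) * (- 2 * ((x - a) \<bullet> v)))) (at x)" for x
  proof -
    have "((\<lambda>x. d - (x - a) \<bullet> (x - a)) has_derivative (\<lambda>v. - 2 * ((x - a) \<bullet> v))) (at x)"
      by (auto intro!: derivative_eq_intros simp: inner_commute)
    from has_derivative_compose[OF this flat_DERIV[THEN has_field_derivative_imp_has_derivative]]
    show ?thesis .
  qed
  have "frechet_derivative (\<lambda>x. flat p (d - (x - a) \<bullet> (x - a))) (at x)
    = (\<lambda>v. flat ?q (d - (x - a) \<bullet> (x - a)) * (- 2 * ((x - a) \<bullet> v)))" for x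
    by (rule frechet_derivative_at[symmetric]) (rule D)
  moreover have "(\<lambda>x. flat p (d - (x - a) \<bullet> (x - a))) differentiable (at x)" for x
    unfolding differentiable_def by (rule exI) (rule D)
  ultimately show ?case unfolding cont_diff.simps
    by (simp only: cont_diff_mult Suc.IH cont_diff_affine simp_thms)
qed

text \<open>Only translates of \<open>k\<close> are ever used as test functions; the last clause states smoothness and support in this
  form.\<close>

definition mollifier :: "real \<Rightarrow> ('a::euclidean_space \<Rightarrow> real) \<Rightarrow> bool" where
  "mollifier d k \<longleftrightarrow> (\<forall>x. 0 \<le> k x) \<and> (\<forall>x. d \<le> norm x \<longrightarrow> k x = 0) \<and> (\<integral>x. k x \<partial>lborel) = 1 \<and>
     continuous_on UNIV k \<and> (\<forall>a \<Omega>. cball a d \<subseteq> \<Omega> \<longrightarrow> (\<lambda>y. k (y - a)) \<in> test_functions \<Omega>)"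

lemma mollifier_exists:
  assumes d: "0 < d"
  obtains k :: "'a::euclidean_space \<Rightarrow> real" where "mollifier d k"
proof -
  define b where "b x = flat 1 (d\<^sup>2 - x \<bullet> x)" for x :: 'a
  have lt: "x \<bullet> x < d\<^sup>2 \<longleftrightarrow> norm x < d" for x :: 'a
    using d by (metis dot_square_norm norm_ge_zero power2_less_imp_less power_strict_mono less_imp_le zero_less_numeral)
  have b_pos: "0 < b x" if "norm x < d" for x
    using that lt[of x] by (simp add: b_def flat_def)
  have b_zero: "b x = 0" if "d \<le> norm x" for x
    using that lt[of x] by (simp add: b_def flat_def)
  have b0: "0 \<le> b x" for x by (simp add: b_def flat_def)
  have "cont_diff 0 b"
    using cont_diff_bump[of 0 1 "d\<^sup>2" "0::'a"] by (simp only: b_def[abs_def] diff_0_right)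
  then have cont: "continuous_on UNIV b" by simp
  then have [measurable]: "b \<in> borel_measurable borel" by (rule borel_measurable_continuous_onI)
  obtain B where B: "0 \<le> B" "\<And>x. \<bar>b x\<bar> \<le> B" using compact_support_bounded[OF cont b_zero] by metis
  have int: "integrable lborel b"
  proof (rule Bochner_Integration.integrable_bound)
    show "integrable lborel (\<lambda>y::'a. B * indicator (cball 0 d) y)"
      using emeasure_lborel_cball_finite[of "0::'a" d] by (intro integrable_mult_right integrable_real_indicator) auto
    show "AE y in lborel. norm (b y) \<le> norm (B * indicator (cball 0 d) y)"
      using B b_zero by (intro always_eventually allI) (auto simp: indicator_def abs_mult)
  qed simp
  have "(\<integral>x. b x \<partial>lborel) \<noteq> 0"
  proof
    assume "(\<integral>x. b x \<partial>lborel) = 0"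
    then have "AE x in lborel. b x = 0"
      using integral_nonneg_eq_0_iff_AE[OF int] b0 by simp
    then have "AE x in lborel. x \<notin> ball (0::'a) d"
      by eventually_elim (use b_pos in force)
    then have "emeasure lborel (ball (0::'a) d) = 0"
      by (subst (asm) AE_iff_measurable[where N="ball (0::'a) d"]) auto
    then show False using d unit_ball_vol_pos[of "real DIM('a)"] by (simp add: emeasure_ball_power)
  qed
  moreover have "0 \<le> (\<integral>x. b x \<partial>lborel)"
    by (rule Bochner_Integration.integral_nonneg) (rule b0)
  ultimately have I: "0 < (\<integral>x. b x \<partial>lborel)" by linarith
  define c where "c = 1 / (\<integral>x. b x \<partial>lborel)"
  have c: "0 < c" using I by (simp add: c_def)
  have "mollifier d (\<lambda>x. c * b x)"
    unfolding mollifier_def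
  proof (intro conjI allI impI)
    show "0 \<le> c * b x" for x using c b0 by simp
    show "c * b x = 0" if "d \<le> norm x" for x using b_zero[OF that] by simp
    show "(\<integral>x. c * b x \<partial>lborel) = 1" using I by (simp add: c_def)
    show "continuous_on UNIV (\<lambda>x. c * b x)" by (intro continuous_intros cont)
    show "(\<lambda>y. c * b (y - a)) \<in> test_functions \<Omega>" if "cball a d \<subseteq> \<Omega>" for a \<Omega>
    proof -
      have "{y. c * b (y - a) \<noteq> 0} \<subseteq> cball a d"
        using b_zero by (force simp: dist_norm norm_minus_commute)
      then have cl: "closure {y. c * b (y - a) \<noteq> 0} \<subseteq> cball a d"
        by (rule closure_minimal) simp
      then have "compact (closure {y. c * b (y - a) \<noteq> 0})"
        using bounded_subset[OF bounded_cball] by (simp add: compact_eq_bounded_closed)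
      moreover have "cont_diff k (\<lambda>y. c * b (y - a))" for k
        unfolding b_def by (intro cont_diff_mult cont_diff_const cont_diff_bump)
      ultimately show ?thesis
        using cl that by (auto simp: test_functions_def)
    qed
  qed
  then show thesis by (rule that)
qed

section \<open>The singular barrier\<close>

text \<open>A radial function, decreasing in \<open>\<bar>y\<bar>\<close>, that tends to infinity at the origin and vanishes on the sphere of radius
  \<open>r\<close>. The power \<open>1 - s\<close> is small enough for the Laplacian of the last term to dominate
  \<open>\<bar>y\<bar> powr (- 2 s)\<close> at the origin. At \<open>y = 0\<close> the conventions for \<open>ln\<close> and division give
  the value \<open>1\<close> in place of infinity.\<close>

definition barrier :: "real \<Rightarrow> real \<Rightarrow> 'a::euclidean_space \<Rightarrow> real" where
  "barrier s r y = ln (r / norm y) + 1 - (norm y / r) powr (1 - s)"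

lemma barrier_antimono:
  assumes "0 < s" "s < 1" "0 < r" "y \<noteq> 0" "norm y \<le> norm x"
  shows "barrier s r x \<le> barrier s r y"
proof -
  have y: "0 < norm y" using assms by simp
  then have x: "0 < norm x" using assms by linarith
  have "r / norm x \<le> r / norm y"
    using assms mult_pos_pos[OF x y] by (intro divide_left_mono) auto
  then have "ln (r / norm x) \<le> ln (r / norm y)"
    using x y assms by (subst ln_le_cancel_iff) auto
  moreover have "(norm y / r) powr (1 - s) \<le> (norm x / r) powr (1 - s)"
    using assms by (intro powr_mono2 divide_right_mono) auto
  ultimately show ?thesis unfolding barrier_def by linarith
qed

lemma barrier_nonneg:
  assumes "0 < s" "s < 1" "0 < r" "norm y \<le> r"
  shows "0 \<le> barrier s r y"
proof (cases "y = 0")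
  case False
  have "(norm y / r) powr (1 - s) \<le> 1 powr (1 - s)"
    using assms by (intro powr_mono2) auto
  moreover have "0 \<le> ln (r / norm y)"
    using False assms by (intro ln_ge_zero) (simp add: field_simps)
  ultimately show ?thesis unfolding barrier_def by simp
qed (simp add: barrier_def)

text \<open>The barrier is a function of \<open>\<bar>x\<bar>\<^sup>2\<close>, a quadratic polynomial on each coordinate line. The logarithm
  contributes \<open>- (n - 2) / \<bar>x\<bar>\<^sup>2 \<le> 0\<close> to the Laplacian, and the power at most the stated bound.\<close>

lemma barrier_laplacian:
  fixes x :: "'a::euclidean_space"
  assumes s: "0 < s" "s < 1" and r: "0 < r" and n: "2 \<le> DIM('a)" and x: "x \<noteq> 0"
  obtains L where
    "discrete_laplacian (barrier s r) x \<longlonglongrightarrow> L"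
    "L \<le> - ((1 - s)\<^sup>2 * r powr (- (1 - s)) * norm x powr (- (1 + s)))"
proof -
  define b where "b = (1 - s) / 2"
  define \<rho> where "\<rho> = r powr (- (1 - s))"
  define Q where "Q = x \<bullet> x"
  have Q: "0 < Q" using x by (simp add: Q_def)
  have norm_Q: "norm x = sqrt Q" by (simp add: Q_def norm_eq_sqrt_inner)
  have r\<rho>: "0 < \<rho>" using r by (simp add: \<rho>_def)
  define q where "q i t = Q + 2 * t * (x \<bullet> i) + t\<^sup>2" for i :: 'a and t
  define q' where "q' i t = 2 * (x \<bullet> i) + 2 * t" for i :: 'a and t
  define g where "g i t = ln r - ln (q i t) / 2 + 1 - \<rho> * q i t powr b" for i t
  define g1 where "g1 i t = - (q' i t / q i t) / 2 - \<rho> * (b * q i t powr (b - 1) * q' i t)" for i t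
  define g2 where "g2 i t = - (2 / q i t - (q' i t)\<^sup>2 / (q i t)\<^sup>2) / 2
      - \<rho> * (b * ((b - 1) * q i t powr (b - 2) * (q' i t)\<^sup>2 + 2 * q i t powr (b - 1)))" for i t
  have q_norm: "q i t = (norm (x + t *\<^sub>R i))\<^sup>2" if "i \<in> Basis" for i t
    using that unfolding power2_norm_eq_inner q_def Q_def
    by (simp add: inner_add_left inner_add_right inner_commute power2_eq_square algebra_simps)
  define \<delta> where "\<delta> = norm x"
  have \<delta>: "0 < \<delta>" using x by (simp add: \<delta>_def)
  have q_pos: "0 < q i t" if "i \<in> Basis" "\<bar>t\<bar> < \<delta>" for i t
  proof -
    have "x + t *\<^sub>R i \<noteq> 0"
    proof
      assume "x + t *\<^sub>R i = 0"
      then have "x = - (t *\<^sub>R i)" by (simp add: eq_neg_iff_add_eq_0)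
      then have "norm x = \<bar>t\<bar>" using that by simp
      then show False using that by (simp add: \<delta>_def)
    qed
    then show ?thesis using that by (simp add: q_norm)
  qed
  have bar: "barrier s r (x + t *\<^sub>R i) = g i t" if "i \<in> Basis" "\<bar>t\<bar> < \<delta>" for i t
  proof -
    have qp: "0 < q i t" by (rule q_pos[OF that])
    have nq: "norm (x + t *\<^sub>R i) = q i t powr (1/2)"
      using that(1) qp by (simp add: q_norm powr_half_sqrt)
    have "ln (r / norm (x + t *\<^sub>R i)) = ln r - ln (q i t) / 2"
      using qp r by (simp add: nq ln_div ln_powr)
    moreover have "(norm (x + t *\<^sub>R i) / r) powr (1 - s) = \<rho> * q i t powr b"
    proof -
      have "(norm (x + t *\<^sub>R i) / r) powr (1 - s) = q i t powr b / r powr (1 - s)"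
        unfolding nq using qp r by (simp add: powr_divide powr_powr b_def)
      then show ?thesis unfolding \<rho>_def powr_minus_divide by simp
    qed
    ultimately show ?thesis by (simp add: barrier_def g_def)
  qed
  have Dq: "(q i has_real_derivative q' i t) (at t)" "(q' i has_real_derivative 2) (at t)" for i t
    unfolding q_def[abs_def] q'_def[abs_def] by (auto intro!: derivative_eq_intros)
  have D1: "(g i has_real_derivative g1 i t) (at t)" if "i \<in> Basis" "\<bar>t\<bar> < \<delta>" for i t
    unfolding g_def[abs_def] g1_def
    using q_pos[OF that] by (auto intro!: derivative_eq_intros Dq simp: field_simps)
  have D2: "(g1 i has_real_derivative g2 i t) (at t)" if "i \<in> Basis" "\<bar>t\<bar> < \<delta>" for i t
    unfolding g1_def[abs_def] g2_def
    using q_pos[OF that] by (auto intro!: derivative_eq_intros Dq simp: field_simps power2_eq_square)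
  have cont: "isCont (g2 i) 0" if "i \<in> Basis" for i
  proof -
    have "isCont (q i) 0" "isCont (q' i) 0" using Dq DERIV_isCont by blast+
    then show ?thesis unfolding g2_def[abs_def]
      using q_pos[OF that, of 0] \<delta> by (intro continuous_intros) auto
  qed
  have "(\<lambda>k. \<Sum>i\<in>Basis. (g i (1 / real (Suc k)) + g i (- (1 / real (Suc k))) - 2 * g i 0) * (real (Suc k))\<^sup>2)
      \<longlonglongrightarrow> (\<Sum>i\<in>Basis. g2 i 0)"
    by (intro tendsto_sum second_diff_limit_1d[OF \<delta> D1 D2 cont])
  moreover have "\<forall>\<^sub>F k in sequentially.
      (\<Sum>i\<in>Basis. (g i (1 / real (Suc k)) + g i (- (1 / real (Suc k))) - 2 * g i 0) * (real (Suc k))\<^sup>2)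
      = discrete_laplacian (barrier s r) x k"
  proof -
    have "\<forall>\<^sub>F k in sequentially. inverse (real (Suc k)) < \<delta>"
      using LIMSEQ_inverse_real_of_nat \<delta> by (intro order_tendstoD) auto
    then show ?thesis
    proof eventually_elim
      case (elim k)
      then have k: "1 / real (Suc k) < \<delta>" by (simp add: inverse_eq_divide)
      show ?case
      proof (intro sum.cong refl arg_cong2[where f="(*)"])
        fix i :: 'a assume i: "i \<in> Basis"
        show "g i (1 / real (Suc k)) + g i (- (1 / real (Suc k))) - 2 * g i 0
            = second_diff (barrier s r) x ((1 / real (Suc k)) *\<^sub>R i)"
          using bar[OF i, of "1 / real (Suc k)"] bar[OF i, of "- (1 / real (Suc k))"] bar[OF i, of 0] k \<delta>
          by (simp add: second_diff_def)
      qed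
    qed
  qed
  ultimately have lim: "discrete_laplacian (barrier s r) x
      \<longlonglongrightarrow> (\<Sum>i\<in>Basis. g2 i 0)"
    by (rule Lim_transform_eventually)
  have sumsq: "(\<Sum>i\<in>Basis. (x \<bullet> i)\<^sup>2) = Q"
    by (simp add: Q_def euclidean_inner[of x x] power2_eq_square)
  have Qp: "Q powr (b - 2) * Q = Q powr (b - 1)"
    using Q powr_add[of Q "b - 2" 1] by simp
  define N where "N = real DIM('a)"
  have "(\<Sum>i\<in>Basis. g2 i 0) = (\<Sum>i\<in>(Basis::'a set). (- 1 / Q - 2 * \<rho> * b * Q powr (b - 1))
      + (2 / Q\<^sup>2 - 4 * \<rho> * b * (b - 1) * Q powr (b - 2)) * (x \<bullet> i)\<^sup>2)"
    by (intro sum.cong refl) (simp add: g2_def q_def q'_def power_mult_distrib diff_divide_distrib algebra_simps)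
  also have "\<dots> = N * (- 1 / Q - 2 * \<rho> * b * Q powr (b - 1))
      + (2 / Q\<^sup>2 - 4 * \<rho> * b * (b - 1) * Q powr (b - 2)) * Q"
    by (simp add: sum.distrib sum_distrib_left[symmetric] sumsq N_def)
  also have "\<dots> = - ((N - 2) / Q) - (2 * N * \<rho> * b * Q powr (b - 1) + 4 * \<rho> * b * (b - 1) * (Q powr (b - 2) * Q))"
    using Q by (simp add: field_simps power2_eq_square)
  also have "\<dots> = - ((N - 2) / Q) - 2 * (N - 2) * \<rho> * b * Q powr (b - 1) - 4 * b\<^sup>2 * \<rho> * Q powr (b - 1)"
    unfolding Qp by (simp add: algebra_simps power2_eq_square)
  also have "\<dots> \<le> - (4 * b\<^sup>2 * \<rho> * Q powr (b - 1))"
  proof -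
    have "0 \<le> (N - 2) / Q" "0 \<le> 2 * (N - 2) * \<rho> * b * Q powr (b - 1)"
      using n Q r\<rho> s by (auto simp: N_def b_def)
    then show ?thesis by linarith
  qed
  also have "4 * b\<^sup>2 * \<rho> * Q powr (b - 1) = (1 - s)\<^sup>2 * r powr (- (1 - s)) * norm x powr (- (1 + s))"
  proof -
    have "norm x = Q powr (1/2)" using Q by (simp add: norm_Q powr_half_sqrt)
    then have "norm x powr (- (1 + s)) = Q powr (b - 1)"
      by (simp add: powr_powr b_def field_simps)
    then show ?thesis by (simp add: b_def \<rho>_def power_divide)
  qed
  finally show thesis using lim that by blast
qed

text \<open>By the Cauchy-Schwarz inequality, \<open>\<bar>x + z\<bar> \<bar>x - z\<bar> \<ge> (x + z) \<bullet> (x - z) = \<bar>x\<bar>\<^sup>2 - \<bar>z\<bar>\<^sup>2\<close>. The second difference of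
  the logarithm depends only on this product, and that of the power is controlled by it through the inequality
  of arithmetic and geometric means.\<close>

lemma barrier_second_diff_near:
  fixes x z :: "'a::euclidean_space"
  assumes s: "0 < s" "s < 1" and r: "0 < r" and x: "x \<noteq> 0" "norm x \<le> r" and z: "norm z \<le> norm x / 2"
  shows "second_diff (barrier s r) x z \<le> 4 * ((norm z)\<^sup>2 / (norm x)\<^sup>2)"
proof -
  define X where "X = norm x"
  define y where "y = (norm z)\<^sup>2 / X\<^sup>2"
  define a where "a = norm (x + z)"
  define b where "b = norm (x - z)"
  define \<gamma> where "\<gamma> = 1 - s"
  have \<gamma>: "0 < \<gamma>" "\<gamma> < 1" using s by (auto simp: \<gamma>_def)
  have X: "0 < X" "X \<le> r" using x by (auto simp: X_def)
  have y0: "0 \<le> y" by (simp add: y_def)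
  have "(norm z)\<^sup>2 \<le> (X / 2)\<^sup>2" using z by (intro power_mono) (auto simp: X_def)
  then have y1: "y \<le> 1 / 4" using X by (simp add: y_def field_simps power2_eq_square)
  have "a \<ge> norm x - norm z" "b \<ge> norm x - norm z"
    using norm_diff_ineq[of x z] norm_triangle_ineq2[of x z] by (auto simp: a_def b_def)
  moreover have "0 < norm x - norm z" using z X(1) unfolding X_def by linarith
  ultimately have ab0: "0 < a" "0 < b" by linarith+
  have "(x + z) \<bullet> (x - z) = x \<bullet> x - z \<bullet> z"
    by (simp add: inner_add_left inner_diff_right inner_commute[of z x])
  moreover have "X\<^sup>2 * (1 - y) = X\<^sup>2 - (norm z)\<^sup>2"
    using X(1) by (simp add: y_def right_diff_distrib)
  ultimately have "X\<^sup>2 * (1 - y) = (x + z) \<bullet> (x - z)"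
    by (simp only: X_def power2_norm_eq_inner)
  also have "\<dots> \<le> a * b" unfolding a_def b_def by (rule norm_cauchy_schwarz)
  finally have ab: "X\<^sup>2 * (1 - y) \<le> a * b" .
  have log: "ln (r / a) + ln (r / b) - 2 * ln (r / X) \<le> 2 * y"
  proof -
    have "ln (r / a) + ln (r / b) - 2 * ln (r / X) = 2 * ln X - ln (a * b)"
      using ab0 X r by (simp add: ln_div ln_mult)
    moreover have "ln (X\<^sup>2 * (1 - y)) \<le> ln (a * b)"
      using ab ab0 X y1 by (subst ln_le_cancel_iff) auto
    moreover have "ln (X\<^sup>2 * (1 - y)) = 2 * ln X - ln (1 / (1 - y))"
      using X y1 by (simp add: ln_mult ln_div ln_realpow)
    ultimately have "ln (r / a) + ln (r / b) - 2 * ln (r / X) \<le> ln (1 / (1 - y))" by linarith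
    also have "\<dots> \<le> 1 / (1 - y) - 1" using y1 by (intro ln_le_minus_one) auto
    also have "\<dots> \<le> 2 * y"
    proof -
      have "1 \<le> (1 + 2 * y) * (1 - y)"
        using mult_nonneg_nonneg[OF y0, of "1 - 2 * y"] y1 by (simp add: algebra_simps)
      then show ?thesis using y1 by (simp add: field_simps)
    qed
    finally show ?thesis .
  qed
  have pow: "2 * (X / r) powr \<gamma> - (a / r) powr \<gamma> - (b / r) powr \<gamma> \<le> 2 * y"
  proof -
    define A where "A = (a / r) powr (\<gamma> / 2)"
    define B where "B = (b / r) powr (\<gamma> / 2)"
    have "0 \<le> (A - B)\<^sup>2" by simp
    moreover have "(a / r) powr \<gamma> = A\<^sup>2" "(b / r) powr \<gamma> = B\<^sup>2"
      by (simp_all add: A_def B_def power2_eq_square powr_add[symmetric])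
    ultimately have "2 * (A * B) \<le> (a / r) powr \<gamma> + (b / r) powr \<gamma>"
      by (simp add: power2_diff)
    moreover have "A * B = (a * b / r\<^sup>2) powr (\<gamma> / 2)"
      using ab0 r by (simp add: A_def B_def powr_mult[symmetric] power2_eq_square)
    moreover have "(X\<^sup>2 * (1 - y) / r\<^sup>2) powr (\<gamma> / 2) \<le> (a * b / r\<^sup>2) powr (\<gamma> / 2)"
      using ab \<gamma> y1 r by (intro powr_mono2 divide_right_mono) auto
    moreover have "(X\<^sup>2 * (1 - y) / r\<^sup>2) powr (\<gamma> / 2) = (X / r) powr \<gamma> * (1 - y) powr (\<gamma> / 2)"
    proof -
      have "X\<^sup>2 * (1 - y) / r\<^sup>2 = (X / r) powr 2 * (1 - y)"
        using X r by (simp add: power_divide)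
      then show ?thesis using X r y1 by (simp add: powr_mult powr_powr del: powr_numeral)
    qed
    moreover have "(1 - y) powr 1 \<le> (1 - y) powr (\<gamma> / 2)"
      using y0 y1 \<gamma> by (intro powr_mono') auto
    then have "(X / r) powr \<gamma> * (1 - y) \<le> (X / r) powr \<gamma> * (1 - y) powr (\<gamma> / 2)"
      using y1 by (intro mult_left_mono) auto
    moreover have "(X / r) powr \<gamma> * y \<le> 1 * y"
    proof (rule mult_right_mono[OF _ y0])
      have "(X / r) powr \<gamma> \<le> 1 powr \<gamma>" using X r \<gamma> by (intro powr_mono2) auto
      then show "(X / r) powr \<gamma> \<le> 1" by simp
    qed
    ultimately show ?thesis by (simp add: algebra_simps)
  qed
  have "second_diff (barrier s r) x z = (ln (r / a) + ln (r / b) - 2 * ln (r / X))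
      + (2 * (X / r) powr \<gamma> - (a / r) powr \<gamma> - (b / r) powr \<gamma>)"
    by (simp add: second_diff_def barrier_def a_def b_def X_def \<gamma>_def)
  also have "\<dots> \<le> 4 * y" using log pow by linarith
  finally show ?thesis by (simp add: y_def X_def)
qed

text \<open>An upper bound for the integrated second differences is a lower bound for the fractional Laplacian. For
  \<open>\<bar>z\<bar> < \<bar>x\<bar> / 2\<close> the preceding estimate applies. For larger \<open>z\<close>, only points \<open>y = x \<plusminus> z\<close> closer to the origin than \<open>x\<close>
  raise the second difference, because the barrier is radially decreasing; there its increase is at most
  \<open>\<bar>x\<bar> / \<bar>y\<bar> + 1\<close>, which is integrable, and the kernel is at most its value at \<open>\<bar>z\<bar> = \<bar>x\<bar> / 2\<close>. Both parts scale like
  \<open>\<bar>x\<bar> powr (- 2 s)\<close>. The points \<open>z = \<plusminus> x\<close> are left out because the barrier takes a conventional value at \<open>0\<close>.\<close>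

lemma barrier_levy_bound:
  assumes s: "0 < s" "s < 1" and n: "2 \<le> DIM('a::euclidean_space)"
  obtains C where "0 < C"
    "\<And>r (x::'a). 0 < r \<Longrightarrow> x \<noteq> 0 \<Longrightarrow> norm x \<le> 2 * r / 3 \<Longrightarrow>
      \<exists>E. integrable lborel E \<and> (\<forall>z. 0 \<le> E z) \<and> (\<integral>z. E z \<partial>lborel) \<le> C * norm x powr (- 2 * s) \<and>
        (\<forall>z. z \<noteq> x \<and> z \<noteq> - x \<longrightarrow> second_diff (\<lambda>y. max 0 (barrier s r y)) x z * levy_kernel s z \<le> E z)"
proof -
  let ?N = "levy_kernel s :: 'a \<Rightarrow> real"
  define d where "d = real DIM('a)"
  have d2: "2 \<le> d" using n by (simp add: d_def)
  obtain C1 where C1: "0 < C1"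
    "\<And>\<rho>. 0 < \<rho> \<Longrightarrow> integrable lborel (\<lambda>z::'a. indicator (ball 0 \<rho>) z * ((norm z)\<^sup>2 * ?N z))"
    "\<And>\<rho>. 0 < \<rho> \<Longrightarrow> (\<integral>z. indicator (ball 0 \<rho>) z * ((norm z)\<^sup>2 * ?N z) \<partial>lborel) \<le> C1 * \<rho> powr (2 - 2 * s)"
    by (rule levy_kernel_near[OF s n]) blast
  obtain C2 where C2: "0 < C2"
    "\<And>\<rho>. 0 < \<rho> \<Longrightarrow> integrable lborel (\<lambda>z::'a. indicator (ball 0 \<rho>) z * norm z powr (- 1))"
    "\<And>\<rho>. 0 < \<rho> \<Longrightarrow> (\<integral>z. indicator (ball 0 \<rho>) (z::'a) * norm z powr (- 1) \<partial>lborel) \<le> C2 * \<rho> powr (d - 1)"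
    unfolding d_def by (rule powr_integral_near[of 1, where 'a='a]) (use n in simp, use n in simp, blast)
  define V where "V = unit_ball_vol d"
  have V: "0 < V" using d2 by (simp add: V_def)
  define C where "C = 4 * (C1 * (1/2) powr (2 - 2 * s)) + 2 * ((1/2) powr (- (d + 2 * s)) * (C2 + V))"
  have C: "0 < C" using C1(1) C2(1) V by (simp add: C_def add_pos_pos)
  show thesis
  proof (rule that[OF C])
    fix r :: real and x :: 'a assume r: "0 < r" and x: "x \<noteq> 0" "norm x \<le> 2 * r / 3"
    define X where "X = norm x"
    have X: "0 < X" "X \<le> 2 * r / 3" using x by (auto simp: X_def)
    let ?B = "\<lambda>y::'a. max 0 (barrier s r y)"
    define w where "w y = X * (indicator (ball 0 X) y * norm y powr (- 1)) + indicator (ball 0 X) y" for y :: 'a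
    have [measurable]: "w \<in> borel_measurable borel" unfolding w_def[abs_def] by measurable
    have w0: "0 \<le> w y" for y using X by (simp add: w_def)
    have ib: "integrable lborel (indicator (ball 0 X) :: 'a \<Rightarrow> real)"
      using emeasure_lborel_ball_finite[of "0::'a" X] by (intro integrable_real_indicator) auto
    have mb: "(\<integral>y. indicator (ball (0::'a) X) y \<partial>lborel) = V * X powr d"
      using X V by (simp add: measure_def emeasure_ball_power V_def d_def powr_realpow)
    have i: "integrable lborel w"
      unfolding w_def[abs_def] using X by (intro Bochner_Integration.integrable_add integrable_mult_right C2 ib)
    have I: "(\<integral>y. w y \<partial>lborel) \<le> (C2 + V) * X powr d"
    proof -
      have "(\<integral>y. w y \<partial>lborel) = X * (\<integral>y. indicator (ball 0 X) (y::'a) * norm y powr (- 1) \<partial>lborel) + V * X powr d"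
        unfolding w_def mb[symmetric] Bochner_Integration.integral_add[OF integrable_mult_right[OF C2(2)[OF X(1)]] ib]
        by (simp only: integral_mult_right_zero)
      also have "\<dots> \<le> X * (C2 * X powr (d - 1)) + V * X powr d"
        using X V by (intro add_mono mult_left_mono C2) auto
      also have "X * (C2 * X powr (d - 1)) = C2 * X powr d"
        using X powr_add[of X 1 "d - 1"] by simp
      finally show ?thesis by (simp add: algebra_simps)
    qed
    define c where "c = (X / 2) powr (- (d + 2 * s))"
    have c: "0 \<le> c" by (simp add: c_def)
    define E where "E z = 4 / X\<^sup>2 * (indicator (ball 0 (X / 2)) z * ((norm z)\<^sup>2 * ?N z))
      + c * (w (x + z) + w (x - z))" for z
    have i2: "integrable lborel (\<lambda>z. w (x + z))" "integrable lborel (\<lambda>z. w (x - z))"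
      using i by (simp_all add: integrable_translate_iff integrable_reflect_iff)
    have X2: "0 < X / 2" using X by simp
    have "integrable lborel E"
      unfolding E_def using X by (intro Bochner_Integration.integrable_add integrable_mult_right C1 i2) auto
    moreover have "0 \<le> E z" for z
      unfolding E_def using c w0 by (intro add_nonneg_nonneg mult_nonneg_nonneg) auto
    moreover have "(\<integral>z. E z \<partial>lborel) \<le> C * norm x powr (- 2 * s)"
    proof -
      have "(\<integral>z. E z \<partial>lborel) = 4 / X\<^sup>2 * (\<integral>z. indicator (ball 0 (X / 2)) z * ((norm z)\<^sup>2 * ?N z) \<partial>lborel)
        + c * ((\<integral>z. w (x + z) \<partial>lborel) + (\<integral>z. w (x - z) \<partial>lborel))"
        unfolding E_def Bochner_Integration.integral_add[OF integrable_mult_right[OF C1(2)[OF X2]]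
            integrable_mult_right[OF Bochner_Integration.integrable_add[OF i2]]]
        by (simp only: integral_mult_right_zero Bochner_Integration.integral_add[OF i2])
      also have "\<dots> = 4 / X\<^sup>2 * (\<integral>z. indicator (ball 0 (X / 2)) z * ((norm z)\<^sup>2 * ?N z) \<partial>lborel)
        + c * (2 * (\<integral>z. w z \<partial>lborel))"
        by (simp add: integral_translate integral_reflect)
      also have "\<dots> \<le> 4 / X\<^sup>2 * (C1 * (X / 2) powr (2 - 2 * s)) + c * (2 * ((C2 + V) * X powr d))"
        using X c I by (intro add_mono mult_left_mono C1) auto
      also have "\<dots> = C * X powr (- 2 * s)"
      proof -
        have "X\<^sup>2 = X powr 2" using X by simp
        then have e1: "1 / X\<^sup>2 * X powr (2 - 2 * s) = X powr (- 2 * s)"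
          using X powr_diff[of X "2 - 2 * s" 2] by (simp del: powr_numeral)
        have e2: "(X / 2) powr (2 - 2 * s) = X powr (2 - 2 * s) * (1/2) powr (2 - 2 * s)"
          using X powr_mult[of X "1/2" "2 - 2 * s"] by simp
        have e3: "c = X powr (- (d + 2 * s)) * (1/2) powr (- (d + 2 * s))"
          unfolding c_def using X powr_mult[of X "1/2" "- (d + 2 * s)"] by simp
        have e4: "X powr (- (d + 2 * s)) * X powr d = X powr (- 2 * s)"
          using X by (simp add: powr_add[symmetric])
        have "4 / X\<^sup>2 * (C1 * (X / 2) powr (2 - 2 * s))
            = 4 * (C1 * (1/2) powr (2 - 2 * s)) * (1 / X\<^sup>2 * X powr (2 - 2 * s))"
          unfolding e2 by simp
        moreover have "c * (2 * ((C2 + V) * X powr d))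
            = 2 * ((1/2) powr (- (d + 2 * s)) * (C2 + V)) * (X powr (- (d + 2 * s)) * X powr d)"
          unfolding e3 by (simp only: mult_ac)
        ultimately show ?thesis unfolding e1 e4 C_def by (simp only: distrib_right)
      qed
      finally show ?thesis by (simp add: X_def)
    qed
    moreover have "second_diff ?B x z * ?N z \<le> E z" if z: "z \<noteq> x" "z \<noteq> - x" for z
    proof (cases "norm z < X / 2")
      case True
      have "norm (x + z) \<le> r" "norm (x - z) \<le> r" "norm x \<le> r"
        using norm_triangle_ineq[of x z] norm_triangle_ineq4[of x z] True X r by (auto simp: X_def)
      then have "second_diff ?B x z = second_diff (barrier s r) x z"
        using s r by (simp add: second_diff_def barrier_nonneg max_def)
      also have "\<dots> \<le> 4 * ((norm z)\<^sup>2 / X\<^sup>2)"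
        unfolding X_def using True X r x by (intro barrier_second_diff_near s) (auto simp: X_def)
      finally have "second_diff ?B x z * ?N z \<le> 4 * ((norm z)\<^sup>2 / X\<^sup>2) * ?N z"
        by (intro mult_right_mono) auto
      also have "\<dots> \<le> E z"
      proof -
        have "0 \<le> c * (w (x + z) + w (x - z))" using c w0 by (intro mult_nonneg_nonneg add_nonneg_nonneg)
        then show ?thesis using True by (simp add: E_def mult.assoc)
      qed
      finally show ?thesis .
    next
      case False
      have key: "?B y - ?B x \<le> w y" if y: "y \<noteq> 0" for y
      proof (cases "norm y < X")
        case True
        have "norm y \<le> r" "norm x \<le> r" using True X r by (auto simp: X_def)
        then have "?B y - ?B x = barrier s r y - barrier s r x"
          using s r by (simp add: barrier_nonneg max_def)
        also have "\<dots> = ln (X / norm y) + (X / r) powr (1 - s) - (norm y / r) powr (1 - s)"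
          using X r y by (simp add: barrier_def X_def ln_div)
        also have "\<dots> \<le> X / norm y + 1"
        proof -
          have "ln (X / norm y) \<le> X / norm y" using X y by (intro ln_bound) simp
          moreover have "(X / r) powr (1 - s) \<le> 1 powr (1 - s)"
            using X r s by (intro powr_mono2) auto
          then have "(X / r) powr (1 - s) \<le> 1" by simp
          moreover have "0 \<le> (norm y / r) powr (1 - s)" by simp
          ultimately show ?thesis by linarith
        qed
        also have "\<dots> = w y" using True y by (simp add: w_def powr_minus_divide)
        finally show ?thesis .
      next
        case False
        then have "barrier s r y \<le> barrier s r x"
          using s r x by (intro barrier_antimono) (auto simp: X_def)
        then show ?thesis using w0[of y] by linarith
      qed
      have "x + z \<noteq> 0" "x - z \<noteq> 0" using z by (auto simp: add_eq_0_iff)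
      from key[OF this(1)] key[OF this(2)] have sd: "second_diff ?B x z \<le> w (x + z) + w (x - z)"
        by (simp add: second_diff_def)
      have N: "?N z \<le> c"
        unfolding levy_kernel_def c_def d_def using False X s by (intro powr_mono2') auto
      have "second_diff ?B x z * ?N z \<le> (w (x + z) + w (x - z)) * ?N z"
        using sd by (intro mult_right_mono) auto
      also have "\<dots> \<le> (w (x + z) + w (x - z)) * c"
        using N w0 by (intro mult_left_mono add_nonneg_nonneg) auto
      also have "\<dots> = E z" using False by (simp add: E_def mult.commute)
      finally show ?thesis .
    qed
    ultimately show "\<exists>E. integrable lborel E \<and> (\<forall>z. 0 \<le> E z) \<and> (\<integral>z. E z \<partial>lborel) \<le> C * norm x powr (- 2 * s) \<and>
        (\<forall>z. z \<noteq> x \<and> z \<noteq> - x \<longrightarrow> second_diff ?B x z * ?N z \<le> E z)"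
      by blast
  qed
qed

section \<open>Mollification of weighted functions\<close>

definition mollify :: "('a::euclidean_space \<Rightarrow> real) \<Rightarrow> ('a \<Rightarrow> real) \<Rightarrow> 'a \<Rightarrow> real" where
  "mollify k u x = (\<integral>y. u y * k (y - x) \<partial>lborel)"

text \<open>Borel measurability, rather than Lebesgue measurability, makes Fubini's theorem on \<open>lborel\<close> applicable.\<close>

definition nonneg_weighted :: "real \<Rightarrow> ('a::euclidean_space \<Rightarrow> real) \<Rightarrow> bool" where
  "nonneg_weighted s u \<longleftrightarrow> u \<in> borel_measurable borel \<and> (\<forall>x. 0 \<le> u x) \<and>
     (\<forall>K. compact K \<longrightarrow> integrable lborel (\<lambda>x. indicator K x * u x)) \<and>
     integrable lborel (\<lambda>x. u x / (1 + norm x powr (real DIM('a) + 2 * s)))"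

lemma mollifierD:
  assumes "mollifier d k"
  shows "\<And>x. 0 \<le> k x" "\<And>x. d \<le> norm x \<Longrightarrow> k x = 0" "(\<integral>x. k x \<partial>lborel) = 1" "continuous_on A k"
    "\<And>a \<Omega>. cball a d \<subseteq> \<Omega> \<Longrightarrow> (\<lambda>y. k (y - a)) \<in> test_functions \<Omega>" "integrable lborel k"
proof -
  show "continuous_on A k" using assms unfolding mollifier_def by (metis continuous_on_subset subset_UNIV)
  show "integrable lborel k"
    using assms unfolding mollifier_def by (metis not_integrable_integral_eq zero_neq_one)
qed (use assms in \<open>auto simp: mollifier_def\<close>)

lemma mollifier_measurable: "mollifier d k \<Longrightarrow> k \<in> borel_measurable borel"
  by (rule borel_measurable_continuous_onI) (rule mollifierD)

lemma nonneg_weightedD: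
  fixes u :: "'a::euclidean_space \<Rightarrow> real"
  assumes "nonneg_weighted s u"
  shows "u \<in> borel_measurable borel" "\<And>x. 0 \<le> u x"
    "\<And>K. compact K \<Longrightarrow> integrable lborel (\<lambda>x. indicator K x * u x)"
    "integrable lborel (\<lambda>x. u x / (1 + norm x powr (real DIM('a) + 2 * s)))"
  using assms by (auto simp: nonneg_weighted_def)

lemma mollify_integrable:
  fixes u :: "'a::euclidean_space \<Rightarrow> real"
  assumes u: "nonneg_weighted s u" and k: "mollifier d k"
  shows "integrable lborel (\<lambda>y. u y * k (y - x))"
proof (rule integrable_times_compact_support[OF nonneg_weightedD(1)[OF u] nonneg_weightedD(3)[OF u compact_cball] compact_cball])
  show "continuous_on UNIV (\<lambda>y. k (y - x))"
    by (rule continuous_on_compose2[OF mollifierD(4)[OF k, of UNIV]]) (auto intro!: continuous_intros)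
  show "k (y - x) = 0" if "y \<notin> cball x d" for y
    using that by (intro mollifierD(2)[OF k]) (simp add: dist_norm norm_minus_commute)
qed

lemma mollify_nonneg:
  assumes u: "nonneg_weighted s u" and k: "mollifier d k"
  shows "0 \<le> mollify k u x"
  unfolding mollify_def
  by (intro Bochner_Integration.integral_nonneg mult_nonneg_nonneg nonneg_weightedD(2)[OF u] mollifierD(1)[OF k])

text \<open>The mollification at \<open>x\<close> is an average of the values of \<open>u\<close> on the ball of radius \<open>d\<close> around \<open>x\<close>.\<close>

lemma mollify_ge:
  fixes u :: "'a::euclidean_space \<Rightarrow> real"
  assumes u: "nonneg_weighted s u" and k: "mollifier d k"
    and m: "AE y in lborel. dist x y < d \<longrightarrow> m \<le> u y"
  shows "m \<le> mollify k u x"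
proof -
  note [measurable] = mollifier_measurable[OF k]
  have k1: "(\<integral>y. k (y - x) \<partial>lborel) = 1"
    using integral_translate[of k "-x"] mollifierD(3)[OF k] by (simp add: add.commute)
  have ki: "integrable lborel (\<lambda>y. k (y - x))"
    using k1 by (metis not_integrable_integral_eq zero_neq_one)
  have "m = (\<integral>y. m * k (y - x) \<partial>lborel)" using k1 by simp
  also have "\<dots> \<le> (\<integral>y. u y * k (y - x) \<partial>lborel)"
  proof (rule integral_mono_AE)
    show "integrable lborel (\<lambda>y. m * k (y - x))" using ki by simp
    show "integrable lborel (\<lambda>y. u y * k (y - x))" by (rule mollify_integrable[OF u k])
    show "AE y in lborel. m * k (y - x) \<le> u y * k (y - x)"
      using m
    proof eventually_elim
      case (elim y)
      show ?case
      proof (cases "dist x y < d")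
        case True then show ?thesis using elim mollifierD(1)[OF k] by (intro mult_right_mono) auto
      next
        case False
        then have "k (y - x) = 0" by (intro mollifierD(2)[OF k]) (simp add: dist_norm norm_minus_commute)
        then show ?thesis by simp
      qed
    qed
  qed
  finally show ?thesis by (simp add: mollify_def)
qed

lemma mollify_continuous:
  fixes u :: "'a::euclidean_space \<Rightarrow> real"
  assumes u: "nonneg_weighted s u" and k: "mollifier d k"
  shows "continuous_on UNIV (mollify k u)"
proof -
  note [measurable] = nonneg_weightedD(1)[OF u] mollifier_measurable[OF k]
  obtain B where B: "0 \<le> B" "\<And>x. \<bar>k x\<bar> \<le> B"
    using compact_support_bounded[OF mollifierD(4,2)[OF k]] by metis
  have "(\<lambda>n. mollify k u (X n)) \<longlonglongrightarrow> mollify k u x" if X: "X \<longlonglongrightarrow> x" for X x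
  proof -
    obtain R where R: "\<And>n. norm (X n) \<le> R"
      using convergent_imp_Bseq[OF convergentI[OF X]] by (auto simp: Bseq_def)
    show ?thesis unfolding mollify_def
    proof (rule integral_dominated_convergence[where w="\<lambda>y. B * (indicator (cball 0 (R + d)) y * u y)"])
      show "integrable lborel (\<lambda>y. B * (indicator (cball 0 (R + d)) y * u y))"
        by (intro integrable_mult_right nonneg_weightedD(3)[OF u] compact_cball)
      show "AE y in lborel. (\<lambda>n. u y * k (y - X n)) \<longlonglongrightarrow> u y * k (y - x)"
      proof (intro always_eventually allI tendsto_mult tendsto_const)
        fix y
        have "isCont k (y - x)" using mollifierD(4)[OF k, of UNIV] by (simp add: continuous_on_eq_continuous_at)
        then show "(\<lambda>n. k (y - X n)) \<longlonglongrightarrow> k (y - x)"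
          by (rule isCont_tendsto_compose) (intro tendsto_intros X)
      qed
      show "AE y in lborel. norm (u y * k (y - X n)) \<le> B * (indicator (cball 0 (R + d)) y * u y)" for n
      proof (intro always_eventually allI)
        fix y
        show "norm (u y * k (y - X n)) \<le> B * (indicator (cball 0 (R + d)) y * u y)"
        proof (cases "norm y \<le> R + d")
          case True
          then show ?thesis
            using mult_right_mono[OF B(2)[of "y - X n"] nonneg_weightedD(2)[OF u, of y]] nonneg_weightedD(2)[OF u, of y]
            by (simp add: abs_mult mult.commute)
        next
          case False
          then have "d \<le> norm (y - X n)" using R[of n] norm_triangle_ineq2[of y "X n"] by linarith
          then show ?thesis using False by (simp add: mollifierD(2)[OF k])
        qed
      qed
    qed measurable
  qed
  then show ?thesis by (intro continuous_at_imp_continuous_on ballI) (simp add: continuous_at_sequentially o_def)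
qed

text \<open>The test function is \<open>k\<close> translated to \<open>x\<close>. The limit stands for the Laplacian of the mollification at
  \<open>x\<close>, read off without differentiating it.\<close>

lemma mollify_second_diff:
  fixes u :: "'a::euclidean_space \<Rightarrow> real"
  assumes s: "0 < s" "s < 1" and n: "2 \<le> DIM('a)" and d: "0 < d"
    and u: "nonneg_weighted s u" and k: "mollifier d k"
  shows "integrable lborel (\<lambda>z. second_diff (mollify k u) x z * levy_kernel s z)"
    and "discrete_laplacian (mollify k u) x
      \<longlonglongrightarrow> - mixed_op_distr s u (\<lambda>y. k (y - x)) - (frac_const DIM('a) s / 2) *
          (\<integral>z. second_diff (mollify k u) x z * levy_kernel s z \<partial>lborel)"
proof -
  have "(\<lambda>y. k (y - x)) \<in> test_functions UNIV" by (rule mollifierD(5)[OF k]) simp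
  then have sm: "smooth (\<lambda>y. k (y - x))" by (rule test_function_smooth)
  have R: "0 < norm x + d" using d by (simp add: add_nonneg_pos)
  have supp: "k (y - x) = 0" if "norm x + d \<le> norm y" for y
    using that norm_triangle_ineq2[of y x] by (intro mollifierD(2)[OF k]) linarith
  have P: "second_diff (\<lambda>z. \<integral>y. u y * k (y + z - x) \<partial>lborel) 0 z = second_diff (mollify k u) x z" for z
    by (simp add: second_diff_def mollify_def algebra_simps)
  note * = mixed_op_distr_second_diff[OF s n sm R supp nonneg_weightedD[OF u], unfolded P]
  show "integrable lborel (\<lambda>z. second_diff (mollify k u) x z * levy_kernel s z)"
    by (rule *(1))
  show "discrete_laplacian (mollify k u) x
      \<longlonglongrightarrow> - mixed_op_distr s u (\<lambda>y. k (y - x)) - (frac_const DIM('a) s / 2) *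
          (\<integral>z. second_diff (mollify k u) x z * levy_kernel s z \<partial>lborel)"
    by (rule *(2))
qed

text \<open>By Tonelli's theorem the integral of the mollification over the box equals the integral of \<open>u\<close> against a
  function with values between \<open>0\<close> and \<open>1\<close> that vanishes outside the box enlarged by \<open>d\<close>. The one-sided estimate
  suffices for lower bounds.\<close>

lemma mollify_box_average:
  fixes u :: "'a::euclidean_space \<Rightarrow> real"
  assumes u: "nonneg_weighted s u" and k: "mollifier d k"
    and ge: "\<And>x. x \<in> cbox a b \<Longrightarrow> c \<le> mollify k u x"
  shows "c * measure lborel (cbox a b) \<le> (\<integral>y. indicator (cbox (a - d *\<^sub>R One) (b + d *\<^sub>R One)) y * u y \<partial>lborel)"
proof (cases "0 \<le> c")
  case False
  have "c * measure lborel (cbox a b) \<le> 0" using False by (simp add: mult_nonpos_nonneg)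
  also have "0 \<le> (\<integral>y. indicator (cbox (a - d *\<^sub>R One) (b + d *\<^sub>R One)) y * u y \<partial>lborel)"
    by (intro Bochner_Integration.integral_nonneg mult_nonneg_nonneg nonneg_weightedD(2)[OF u]) simp
  finally show ?thesis .
next
  case True
  note [measurable] = nonneg_weightedD(1)[OF u] mollifier_measurable[OF k]
  let ?Q = "cbox a b" and ?Q' = "cbox (a - d *\<^sub>R One) (b + d *\<^sub>R One)"
  have k1: "(\<integral>\<^sup>+x. ennreal (k (y - x)) \<partial>lborel) = 1" for y
    using nn_integral_reflect[of "\<lambda>z. ennreal (k z)" y] nn_integral_eq_integral[OF mollifierD(6)[OF k]]
      mollifierD(1,3)[OF k] by simp
  have box: "y \<in> ?Q'" if "x \<in> ?Q" "norm (y - x) < d" for x y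
    unfolding mem_box
  proof
    fix i :: 'a assume i: "i \<in> Basis"
    have "\<bar>(y - x) \<bullet> i\<bar> < d" using Basis_le_norm[OF i, of "y - x"] that(2) by linarith
    then show "(a - d *\<^sub>R One) \<bullet> i \<le> y \<bullet> i \<and> y \<bullet> i \<le> (b + d *\<^sub>R One) \<bullet> i"
      using that(1) i by (auto simp: mem_box inner_diff_left inner_add_left abs_less_iff dest!: bspec[of _ _ i])
  qed
  have "ennreal (c * measure lborel ?Q) = (\<integral>\<^sup>+x. ennreal c * indicator ?Q x \<partial>lborel)"
    using True by (subst nn_integral_cmult_indicator) (auto simp: ennreal_mult emeasure_eq_ennreal_measure[OF emeasure_lborel_cbox_finite[THEN less_imp_neq, unfolded infinity_ennreal_def]])
  also have "\<dots> \<le> (\<integral>\<^sup>+x. (\<integral>\<^sup>+y. ennreal (indicator ?Q x * (u y * k (y - x))) \<partial>lborel) \<partial>lborel)"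
  proof (intro nn_integral_mono)
    fix x :: 'a
    show "ennreal c * indicator ?Q x \<le> (\<integral>\<^sup>+y. ennreal (indicator ?Q x * (u y * k (y - x))) \<partial>lborel)"
    proof (cases "x \<in> ?Q")
      case True
      have "(\<integral>\<^sup>+y. ennreal (u y * k (y - x)) \<partial>lborel) = ennreal (mollify k u x)"
        unfolding mollify_def using mollifierD(1)[OF k] nonneg_weightedD(2)[OF u]
        by (intro nn_integral_eq_integral mollify_integrable[OF u k]) simp
      then show ?thesis using True ge[OF True] by (simp add: ennreal_leI)
    qed simp
  qed
  also have "\<dots> = (\<integral>\<^sup>+y. (\<integral>\<^sup>+x. ennreal (indicator ?Q x * (u y * k (y - x))) \<partial>lborel) \<partial>lborel)"
    by (rule lborel_pair.Fubini') measurable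
  also have "\<dots> \<le> (\<integral>\<^sup>+y. ennreal (indicator ?Q' y * u y) \<partial>lborel)"
  proof (intro nn_integral_mono)
    fix y :: 'a
    have "(\<integral>\<^sup>+x. ennreal (indicator ?Q x * (u y * k (y - x))) \<partial>lborel)
        \<le> (\<integral>\<^sup>+x. ennreal (indicator ?Q' y * u y) * ennreal (k (y - x)) \<partial>lborel)"
    proof (intro nn_integral_mono)
      fix x :: 'a
      show "ennreal (indicator ?Q x * (u y * k (y - x))) \<le> ennreal (indicator ?Q' y * u y) * ennreal (k (y - x))"
      proof (cases "x \<in> ?Q \<and> norm (y - x) < d")
        case True
        then have "y \<in> ?Q'" using box by blast
        then show ?thesis using True mollifierD(1)[OF k] nonneg_weightedD(2)[OF u] by (simp add: ennreal_mult)
      next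
        case False
        then show ?thesis using mollifierD(2)[OF k, of "y - x"] by (auto simp: indicator_def)
      qed
    qed
    also have "\<dots> = ennreal (indicator ?Q' y * u y)"
      by (subst nn_integral_cmult) (simp_all add: k1)
    finally show "(\<integral>\<^sup>+x. ennreal (indicator ?Q x * (u y * k (y - x))) \<partial>lborel) \<le> ennreal (indicator ?Q' y * u y)" .
  qed
  also have "\<dots> = ennreal (\<integral>y. indicator ?Q' y * u y \<partial>lborel)"
    using nonneg_weightedD(2)[OF u] by (intro nn_integral_eq_integral nonneg_weightedD(3)[OF u] compact_cbox) simp
  finally show ?thesis
    by (subst (asm) ennreal_le_iff)
      (auto intro!: Bochner_Integration.integral_nonneg mult_nonneg_nonneg nonneg_weightedD(2)[OF u])
qed

section \<open>Touching a supersolution from below\<close>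

text \<open>If \<open>U - comparison\<close> is minimal at a point \<open>x\<close> of the punctured ball of radius \<open>7 r / 12\<close>, then \<open>U + \<epsilon> \<Phi>\<close>, with \<open>\<Phi>\<close>
  the barrier, has a minimum at \<open>x\<close> relative to the ball of radius \<open>11 r / 12\<close>, exceeds that minimum by at least \<open>m - \<theta>\<close> on the
  annulus, and drops below it by at most \<open>\<theta>\<close> farther out. The radii leave room for mollification at scale
  \<open>\<delta> < r / 12\<close>: the annulus between \<open>5 r / 8\<close> and \<open>7 r / 8\<close> stays at distance at least \<open>\<delta>\<close> from the boundary of the
  region \<open>r / 2 \<le> \<bar>y - x0\<bar> < r\<close>, and \<open>11 r / 12 \<le> r - \<delta>\<close>. The positive part of \<open>\<Phi>\<close> is taken because \<open>\<Phi>\<close>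
  is unbounded below at infinity.\<close>

definition comparison :: "real \<Rightarrow> real \<Rightarrow> 'a::euclidean_space \<Rightarrow> real \<Rightarrow> real \<Rightarrow> real \<Rightarrow> 'a \<Rightarrow> real" where
  "comparison s r x0 \<epsilon> m \<theta> y = (m - \<theta>) * indicator {y. 5 * r / 8 \<le> norm (y - x0) \<and> norm (y - x0) \<le> 7 * r / 8} y
     - \<theta> * indicator {y. 11 * r / 12 < norm (y - x0)} y - \<epsilon> * max 0 (barrier s r (y - x0))"

lemma comparison_inside:
  assumes "0 < r" "norm (y - x0) \<le> 7 * r / 12"
  shows "comparison s r x0 \<epsilon> m \<theta> y = - \<epsilon> * max 0 (barrier s r (y - x0))"
  using assms by (simp add: comparison_def indicator_def)

text \<open>The three parts of the comparison function give the three terms of the bound: the annulus contributes the gain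
  \<open>a (m - \<theta>)\<close>, the far field costs \<open>b \<theta>\<close> since it lies at distance at least \<open>r / 4\<close> from the touching point, and the
  barrier costs \<open>\<epsilon> C \<bar>x - x0\<bar> powr (- 2 s)\<close>. The constants depend only on the dimension and on \<open>s\<close>.\<close>

lemma touching_point_levy:
  assumes s: "0 < s" "s < 1" and n: "2 \<le> DIM('a::euclidean_space)"
  obtains a b C where "0 < a" "0 < b" "0 < C"
    "\<And>r (x0::'a) x U \<epsilon> m \<theta>. 0 < r \<Longrightarrow> x \<noteq> x0 \<Longrightarrow> norm (x - x0) \<le> 7 * r / 12 \<Longrightarrow> 0 \<le> \<epsilon> \<Longrightarrow> 0 \<le> \<theta> \<Longrightarrow> \<theta> \<le> m \<Longrightarrow>
      integrable lborel (\<lambda>z. second_diff U x z * levy_kernel s z) \<Longrightarrow>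
      (\<And>y. y \<noteq> x0 \<Longrightarrow> comparison s r x0 \<epsilon> m \<theta> y - comparison s r x0 \<epsilon> m \<theta> x \<le> U y - U x) \<Longrightarrow>
      r powr (- 2 * s) * (a * (m - \<theta>) - b * \<theta>) - \<epsilon> * C * norm (x - x0) powr (- 2 * s)
        \<le> (\<integral>z. second_diff U x z * levy_kernel s z \<partial>lborel)"
proof -
  let ?N = "levy_kernel s :: 'a \<Rightarrow> real"
  define d where "d = real DIM('a)"
  have d2: "2 \<le> d" using n by (simp add: d_def)
  define p where "p = d + 2 * s"
  define V where "V = unit_ball_vol d"
  have V: "0 < V" using d2 by (simp add: V_def)
  obtain C1 where C1: "0 < C1"
    "\<And>\<rho>. 0 < \<rho> \<Longrightarrow> integrable lborel (\<lambda>z::'a. indicator (- ball 0 \<rho>) z * ?N z)"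
    "\<And>\<rho>. 0 < \<rho> \<Longrightarrow> (\<integral>z. indicator (- ball 0 \<rho>) z * ?N z \<partial>lborel) \<le> C1 * \<rho> powr (- 2 * s)"
    by (rule levy_kernel_far[OF s(1), where 'a='a]) blast
  obtain C where C: "0 < C"
    "\<And>r (x::'a). 0 < r \<Longrightarrow> x \<noteq> 0 \<Longrightarrow> norm x \<le> 2 * r / 3 \<Longrightarrow>
      \<exists>E. integrable lborel E \<and> (\<forall>z. 0 \<le> E z) \<and> (\<integral>z. E z \<partial>lborel) \<le> C * norm x powr (- 2 * s) \<and>
        (\<forall>z. z \<noteq> x \<and> z \<noteq> - x \<longrightarrow> second_diff (\<lambda>y. max 0 (barrier s r y)) x z * ?N z \<le> E z)"
    by (rule barrier_levy_bound[OF s n]) blast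
  define a where "a = 2 powr (- p) * V * (1/8) powr d"
  define b where "b = 2 * (C1 * (1/4) powr (- 2 * s))"
  have a: "0 < a" using V by (simp add: a_def)
  have b: "0 < b" using C1(1) by (simp add: b_def)
  show thesis
  proof (rule that[OF a b C(1)])
    fix r :: real and x0 x :: 'a and U :: "'a \<Rightarrow> real" and \<epsilon> m \<theta> :: real
    assume r: "0 < r" and x: "x \<noteq> x0" "norm (x - x0) \<le> 7 * r / 12" and \<epsilon>: "0 \<le> \<epsilon>" and \<theta>: "0 \<le> \<theta>" "\<theta> \<le> m"
      and int: "integrable lborel (\<lambda>z. second_diff U x z * ?N z)"
    let ?B = "\<lambda>y::'a. max 0 (barrier s r y)"
    define A where "A = {y. 5 * r / 8 \<le> norm (y - x0) \<and> norm (y - x0) \<le> 7 * r / 8}"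
    define O' where "O' = {y. 11 * r / 12 < norm (y - x0)}"
    assume touch: "\<And>y. y \<noteq> x0 \<Longrightarrow> comparison s r x0 \<epsilon> m \<theta> y - comparison s r x0 \<epsilon> m \<theta> x \<le> U y - U x"
    have ge: "U x + \<epsilon> * (?B (x - x0) - ?B (y - x0)) + (m - \<theta>) * indicator A y - \<theta> * indicator O' y \<le> U y"
      if "y \<noteq> x0" for y
      using touch[OF that] unfolding comparison_inside[OF r x(2)]
      by (simp add: comparison_def A_def O'_def right_diff_distrib)
    define w where "w = x - x0"
    have w: "w \<noteq> 0" "norm w \<le> 2 * r / 3" "norm w \<le> 7 * r / 12" using x r by (auto simp: w_def)
    obtain E where E: "integrable lborel E" "\<And>z. 0 \<le> E z" "(\<integral>z. E z \<partial>lborel) \<le> C * norm w powr (- 2 * s)"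
      "\<And>z. z \<noteq> w \<Longrightarrow> z \<noteq> - w \<Longrightarrow> second_diff ?B w z * ?N z \<le> E z"
      using C(2)[OF r w(1,2)] by metis
    \<comment> \<open>A ball contained in the annulus carries the gain.\<close>
    obtain e :: 'a where e: "e \<in> Basis" using nonempty_Basis by blast
    define y0 where "y0 = x0 + (3 * r / 4) *\<^sub>R e"
    define D where "D = ball (y0 - x) (r / 8)"
    have D_A: "x + z \<in> A" if "z \<in> D" for z
    proof -
      have 1: "norm (x + z - y0) < r / 8"
        using that by (simp add: D_def dist_norm norm_minus_commute algebra_simps)
      have 2: "norm (y0 - x0) = 3 * r / 4" using e r by (simp add: y0_def)
      have "norm (x + z - x0) \<le> norm (x + z - y0) + norm (y0 - x0)"
        using norm_triangle_ineq[of "x + z - y0" "y0 - x0"] by simp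
      moreover have "norm (y0 - x0) \<le> norm (x + z - y0) + norm (x + z - x0)"
        using norm_triangle_ineq4[of "x + z - x0" "x + z - y0"] by simp
      ultimately show ?thesis using 1 2 by (simp add: A_def)
    qed
    have N_A: "(2 * r) powr (- p) \<le> ?N z" if "x + z \<in> A" for z
    proof -
      have z: "norm (w + z) \<le> 7 * r / 8" "5 * r / 8 \<le> norm (w + z)"
        using that by (auto simp: A_def w_def algebra_simps)
      have "norm z \<le> norm (w + z) + norm w" using norm_triangle_ineq4[of "w + z" w] by simp
      then have "norm z \<le> 2 * r" using z w r by linarith
      moreover have "0 < norm z" using z w r norm_triangle_ineq[of w z] by linarith
      ultimately show ?thesis
        unfolding levy_kernel_def d_def[symmetric] p_def[symmetric]
        using s d2 by (intro powr_mono2') (auto simp: p_def)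
    qed
    define R where "R z = - \<epsilon> * E z + ((m - \<theta>) * (2 * r) powr (- p)) * indicator D z
        - 2 * \<theta> * (indicator (- ball 0 (r / 4)) z * ?N z)" for z
    have r4: "0 < r / 4" using r by simp
    have iD: "integrable lborel (indicator D :: 'a \<Rightarrow> real)"
      unfolding D_def using emeasure_lborel_ball_finite[of "y0 - x" "r / 8"] by (intro integrable_real_indicator) auto
    have mD: "(\<integral>z. indicator D z \<partial>lborel) = V * (r / 8) powr d"
      using r V by (simp add: D_def measure_def emeasure_ball_power V_def d_def powr_realpow)
    have iR: "integrable lborel R"
      unfolding R_def[abs_def]
      by (intro Bochner_Integration.integrable_diff Bochner_Integration.integrable_add integrable_mult_right E(1) iD C1(2) r4)
    have R_le: "R z \<le> second_diff U x z * ?N z" if z: "z \<noteq> w" "z \<noteq> - w" for z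
    proof -
      have ne: "x + z \<noteq> x0" "x - z \<noteq> x0" using z by (auto simp: w_def algebra_simps)
      have eq: "x + z - x0 = w + z" "x - z - x0 = w - z" "x - x0 = w" by (simp_all add: w_def)
      have out: "indicator O' (x + z) \<le> (indicator (- ball 0 (r / 4)) z :: real)"
        "indicator O' (x - z) \<le> (indicator (- ball 0 (r / 4)) z :: real)"
        using norm_triangle_ineq[of w z] norm_triangle_ineq4[of w z] w r
        by (auto simp: O'_def eq indicator_def)
      have "0 \<le> (m - \<theta>) * indicator A (x - z)" using \<theta> by simp
      moreover have "\<theta> * indicator O' (x + z) \<le> \<theta> * indicator (- ball 0 (r / 4)) z"
        "\<theta> * indicator O' (x - z) \<le> \<theta> * indicator (- ball 0 (r / 4)) z"
        using out \<theta> by (auto intro: mult_left_mono)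
      ultimately have sd: "- \<epsilon> * second_diff ?B w z + (m - \<theta>) * indicator A (x + z) - 2 * \<theta> * indicator (- ball 0 (r / 4)) z
          \<le> second_diff U x z"
        using ge[OF ne(1)] ge[OF ne(2)] unfolding eq by (simp add: second_diff_def algebra_simps)
      have "R z \<le> (- \<epsilon> * second_diff ?B w z + (m - \<theta>) * indicator A (x + z) - 2 * \<theta> * indicator (- ball 0 (r / 4)) z) * ?N z"
      proof -
        have "\<epsilon> * (second_diff ?B w z * ?N z) \<le> \<epsilon> * E z" using E(4)[OF z] \<epsilon> by (rule mult_left_mono)
        moreover have "((m - \<theta>) * (2 * r) powr (- p)) * indicator D z \<le> (m - \<theta>) * (indicator A (x + z) * ?N z)"
        proof (cases "z \<in> D")
          case True
          then show ?thesis using N_A[OF D_A[OF True]] D_A[OF True] \<theta> by (simp add: mult_left_mono)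
        qed (use \<theta> in simp)
        ultimately show ?thesis by (simp add: R_def algebra_simps)
      qed
      also have "\<dots> \<le> second_diff U x z * ?N z" using sd by (intro mult_right_mono) auto
      finally show ?thesis .
    qed
    have "(\<integral>z. R z \<partial>lborel) \<le> (\<integral>z. second_diff U x z * ?N z \<partial>lborel)"
    proof (rule integral_mono_AE[OF iR int])
      show "AE z in lborel. R z \<le> second_diff U x z * ?N z"
        using AE_lborel_singleton[of w] AE_lborel_singleton[of "- w"]
        by eventually_elim (rule R_le)
    qed
    moreover have "(\<integral>z. R z \<partial>lborel) = - \<epsilon> * (\<integral>z. E z \<partial>lborel) + ((m - \<theta>) * (2 * r) powr (- p)) * (V * (r / 8) powr d)
        - 2 * \<theta> * (\<integral>z. indicator (- ball 0 (r / 4)) z * ?N z \<partial>lborel)"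
    proof -
      note i1 = integrable_mult_right[OF E(1), of "- \<epsilon>"]
      note i2 = integrable_mult_right[OF iD, of "(m - \<theta>) * (2 * r) powr (- p)"]
      note i3 = integrable_mult_right[OF C1(2)[OF r4], of "2 * \<theta>"]
      show ?thesis
        unfolding R_def mD[symmetric] Bochner_Integration.integral_diff[OF Bochner_Integration.integrable_add[OF i1 i2] i3]
          Bochner_Integration.integral_add[OF i1 i2]
        by (simp only: integral_mult_right_zero)
    qed
    moreover have "\<epsilon> * (\<integral>z. E z \<partial>lborel) \<le> \<epsilon> * (C * norm w powr (- 2 * s))"
      using E(3) \<epsilon> by (rule mult_left_mono)
    moreover have "2 * \<theta> * (\<integral>z. indicator (- ball 0 (r / 4)) z * ?N z \<partial>lborel) \<le> r powr (- 2 * s) * (b * \<theta>)"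
    proof -
      have "(\<integral>z. indicator (- ball 0 (r / 4)) z * ?N z \<partial>lborel) \<le> C1 * (r / 4) powr (- 2 * s)"
        by (rule C1(3)[OF r4])
      then have "2 * \<theta> * (\<integral>z. indicator (- ball 0 (r / 4)) z * ?N z \<partial>lborel) \<le> 2 * \<theta> * (C1 * (r / 4) powr (- 2 * s))"
        using \<theta> by (intro mult_left_mono) auto
      also have "(r / 4) powr (- 2 * s) = r powr (- 2 * s) * (1/4) powr (- 2 * s)"
        using r powr_mult[of r "1/4" "- 2 * s"] by simp
      finally show ?thesis unfolding b_def by (simp only: mult_ac)
    qed
    moreover have "((m - \<theta>) * (2 * r) powr (- p)) * (V * (r / 8) powr d) = r powr (- 2 * s) * (a * (m - \<theta>))"
    proof -
      have e1: "(r / 8) powr d = r powr d * (1/8) powr d" using r powr_mult[of r "1/8" d] by simp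
      have e2: "(2 * r) powr (- p) = 2 powr (- p) * r powr (- p)" using r by (simp add: powr_mult)
      have e3: "r powr (- p) * r powr d = r powr (- 2 * s)" using r by (simp add: powr_add[symmetric] p_def)
      have "((m - \<theta>) * (2 * r) powr (- p)) * (V * (r / 8) powr d)
        = (r powr (- p) * r powr d) * (a * (m - \<theta>))"
        unfolding e1 e2 a_def by (simp only: mult_ac)
      then show ?thesis unfolding e3 .
    qed
    ultimately show "r powr (- 2 * s) * (a * (m - \<theta>) - b * \<theta>) - \<epsilon> * C * norm (x - x0) powr (- 2 * s)
        \<le> (\<integral>z. second_diff U x z * ?N z \<partial>lborel)"
      unfolding w_def[symmetric] by (simp add: right_diff_distrib mult.assoc)
  qed
qed

text \<open>At a touching point the second differences of \<open>U\<close> are at least those of \<open>- \<epsilon>\<close> times the barrier; only a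
  neighbourhood of \<open>x\<close> matters.\<close>

lemma touching_point_laplacian:
  fixes x x0 :: "'a::euclidean_space"
  assumes s: "0 < s" "s < 1" and n: "2 \<le> DIM('a)" and r: "0 < r" and x: "x \<noteq> x0" and xR: "norm (x - x0) < R" "R \<le> r"
    and \<epsilon>: "0 \<le> \<epsilon>"
    and L: "discrete_laplacian U x \<longlonglongrightarrow> L"
    and ge: "\<And>y. y \<noteq> x0 \<Longrightarrow> norm (y - x0) \<le> R \<Longrightarrow>
        U x + \<epsilon> * (barrier s r (x - x0) - barrier s r (y - x0)) \<le> U y"
  shows "\<epsilon> * ((1 - s)\<^sup>2 * r powr (- (1 - s)) * norm (x - x0) powr (- (1 + s))) \<le> L"
proof -
  define w where "w = x - x0"
  have w: "w \<noteq> 0" "norm w < R" using x xR by (auto simp: w_def)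
  obtain M where M: "discrete_laplacian (barrier s r) w \<longlonglongrightarrow> M"
    "M \<le> - ((1 - s)\<^sup>2 * r powr (- (1 - s)) * norm w powr (- (1 + s)))"
    using barrier_laplacian[OF s r n w(1)] by blast
  have "- \<epsilon> * M \<le> L"
  proof (rule tendsto_le[OF trivial_limit_sequentially L tendsto_mult_left[OF M(1), of "- \<epsilon>"]])
    have "\<forall>\<^sub>F k in sequentially. inverse (real (Suc k)) < min (norm w) (R - norm w)"
      using LIMSEQ_inverse_real_of_nat w by (intro order_tendstoD) auto
    then show "\<forall>\<^sub>F k in sequentially. - \<epsilon> * discrete_laplacian (barrier s r) w k
        \<le> discrete_laplacian U x k"
    proof eventually_elim
      case (elim k)
      define h where "h = 1 / real (Suc k)"
      have h: "0 < h" "h < norm w" "h < R - norm w" using elim by (simp_all add: h_def inverse_eq_divide)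
      have "- \<epsilon> * second_diff (barrier s r) w (h *\<^sub>R i) \<le> second_diff U x (h *\<^sub>R i)" if i: "i \<in> Basis" for i
      proof -
        have nh: "norm (h *\<^sub>R i) = h" using i h by simp
        have eq: "x + h *\<^sub>R i - x0 = w + h *\<^sub>R i" "x - h *\<^sub>R i - x0 = w - h *\<^sub>R i" by (simp_all add: w_def)
        have "w + h *\<^sub>R i \<noteq> 0" "w - h *\<^sub>R i \<noteq> 0"
          using norm_diff_ineq[of w "h *\<^sub>R i"] norm_triangle_ineq2[of w "h *\<^sub>R i"] h unfolding nh by force+
        then have ne: "x + h *\<^sub>R i \<noteq> x0" "x - h *\<^sub>R i \<noteq> x0" by (auto simp: eq[symmetric])
        have le: "norm (x + h *\<^sub>R i - x0) \<le> R" "norm (x - h *\<^sub>R i - x0) \<le> R"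
          unfolding eq using norm_triangle_ineq[of w "h *\<^sub>R i"] norm_triangle_ineq4[of w "h *\<^sub>R i"] h unfolding nh by linarith+
        show ?thesis
          using ge[OF ne(1) le(1)] ge[OF ne(2) le(2)] unfolding eq w_def[symmetric]
          by (simp add: second_diff_def algebra_simps)
      qed
      then show ?case unfolding h_def[symmetric] sum_distrib_left
        by (intro sum_mono) (metis mult.assoc mult_right_mono zero_le_power2)
    qed
  qed
  moreover have "\<epsilon> * M \<le> \<epsilon> * - ((1 - s)\<^sup>2 * r powr (- (1 - s)) * norm w powr (- (1 + s)))"
    using M(2) \<epsilon> by (rule mult_left_mono)
  ultimately show ?thesis unfolding w_def by simp
qed

section \<open>The bound for mollifications\<close>

lemma frac_const_pos:
  assumes "0 < s" "s < 1"
  shows "0 < frac_const n s"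
proof -
  have "- s \<notin> \<int>\<^sub>\<le>\<^sub>0"
  proof
    assume "- s \<in> \<int>\<^sub>\<le>\<^sub>0"
    then obtain k :: nat where "- s = - real k" by (auto elim: nonpos_Ints_cases')
    then show False using assms by simp
  qed
  then have "Gamma (- s) \<noteq> 0" by (simp add: Gamma_eq_zero_iff)
  moreover have "0 < Gamma (s + real n / 2)" using assms by (intro Gamma_real_pos) simp
  ultimately show ?thesis unfolding frac_const_def by simp
qed

text \<open>As \<open>t\<close> tends to \<open>0\<close> the more singular power wins; away from \<open>0\<close> the first term is bounded. This is how the
  Laplacian of the barrier pays for its fractional Laplacian.\<close>

lemma powr_difference_bounded:
  fixes p q C \<kappa> :: real
  assumes "0 \<le> p" "p < q" "0 \<le> C" "0 < \<kappa>"
  obtains D where "0 < D" "\<And>t. 0 < t \<Longrightarrow> C * t powr (- p) - \<kappa> * t powr (- q) \<le> D"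
proof -
  define t0 where "t0 = (\<kappa> / (C + 1)) powr (1 / (q - p))"
  have t0: "0 < t0" using assms by (simp add: t0_def)
  have t0p: "t0 powr (q - p) = \<kappa> / (C + 1)" using assms by (simp add: t0_def powr_powr)
  have "C * t powr (- p) - \<kappa> * t powr (- q) \<le> C * t0 powr (- p) + 1" if t: "0 < t" for t
  proof (cases "t \<le> t0")
    case True
    have "t powr (q - p) \<le> \<kappa> / (C + 1)"
      unfolding t0p[symmetric] using True t assms by (intro powr_mono2) auto
    then have "(C + 1) * t powr (q - p) \<le> \<kappa>" using assms by (simp add: field_simps)
    moreover have "C * t powr (q - p) \<le> (C + 1) * t powr (q - p)" by (simp add: mult_right_mono)
    ultimately have "C * t powr (q - p) * t powr (- q) \<le> \<kappa> * t powr (- q)"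
      by (intro mult_right_mono) auto
    moreover have "t powr (q - p) * t powr (- q) = t powr (- p)" using t by (simp add: powr_add[symmetric])
    moreover have "0 \<le> C * t0 powr (- p)" using assms by simp
    ultimately show ?thesis by (simp add: mult.assoc)
  next
    case False
    have "t powr (- p) \<le> t0 powr (- p)" using False t0 assms by (intro powr_mono2') auto
    then have "C * t powr (- p) \<le> C * t0 powr (- p)" using assms by (intro mult_left_mono)
    moreover have "0 \<le> \<kappa> * t powr (- q)" using assms by simp
    ultimately show ?thesis by linarith
  qed
  moreover have "0 < C * t0 powr (- p) + 1" using assms by (simp add: add_nonneg_pos)
  ultimately show thesis by (rule that[rotated])
qed

text \<open>The hypotheses on \<open>u\<close> with the coefficient replaced by a constant upper bound \<open>K\<close>.\<close>

definition supersolution_data ::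
    "real \<Rightarrow> real \<Rightarrow> real \<Rightarrow> 'a::euclidean_space \<Rightarrow> real \<Rightarrow> ('a \<Rightarrow> real) \<Rightarrow> bool" where
  "supersolution_data s r K x0 m u \<longleftrightarrow> 0 < r \<and> 0 \<le> K \<and> 0 < m \<and> nonneg_weighted s u \<and>
     (\<forall>\<phi>\<in>test_functions (ball x0 r - {x0}). (\<forall>x. 0 \<le> \<phi> x) \<longrightarrow>
        0 \<le> mixed_op_distr s u \<phi> + K * (\<integral>x. u x * \<phi> x \<partial>lborel)) \<and>
     (AE x in lborel. x \<in> ball x0 r - ball x0 (r / 2) \<longrightarrow> m \<le> u x)"

text \<open>The minimum principle for \<open>f = U + \<epsilon> \<Phi>\<close> on \<open>2 \<delta> \<le> \<bar>y - x0\<bar> \<le> r / 2 + \<delta>\<close>, where \<open>U\<close> is the mollification and \<open>\<Phi>\<close>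
  the barrier. A value of \<open>f\<close> below \<open>\<theta>\<close> leads to a point where \<open>U\<close> is touched by a comparison function; the
  inequality for \<open>U\<close> at that point then bounds \<open>A m / 2\<close>, up to the factor \<open>r powr (- 2 s)\<close>, by a constant multiple of \<open>\<epsilon>\<close>,
  which is false for small \<open>\<epsilon>\<close>. The factor \<open>2\<close> in the denominator of \<open>\<theta>\<close> provides the reserve \<open>A m / 2\<close>.\<close>

lemma mollified_lower_bound:
  assumes s: "0 < s" "s < 1" and n: "2 \<le> DIM('a::euclidean_space)"
  obtains A B where "0 < A" "A \<le> B"
    "\<And>r K (x0::'a) u m \<theta> \<eta>. supersolution_data s r K x0 m u \<Longrightarrow>
      \<theta> = A / (2 * (B + r powr (2 * s) * K)) * m \<Longrightarrow> 0 < \<eta> \<Longrightarrow>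
      \<exists>\<delta>1>0. \<forall>\<delta> k x. 0 < \<delta> \<longrightarrow> \<delta> < \<delta>1 \<longrightarrow> mollifier \<delta> k \<longrightarrow> 2 * \<delta> \<le> norm (x - x0) \<longrightarrow> norm (x - x0) \<le> r / 2 \<longrightarrow>
        \<theta> - \<eta> * (ln (r / norm (x - x0)) + 1) \<le> mollify k u x"
proof -
  obtain a0 b0 C0 where a0: "0 < a0" and b0: "0 < b0" and C0: "0 < C0"
    and touch: "\<And>r (x0::'a) x U \<epsilon> m \<theta>. 0 < r \<Longrightarrow> x \<noteq> x0 \<Longrightarrow> norm (x - x0) \<le> 7 * r / 12 \<Longrightarrow> 0 \<le> \<epsilon> \<Longrightarrow> 0 \<le> \<theta> \<Longrightarrow> \<theta> \<le> m \<Longrightarrow>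
      integrable lborel (\<lambda>z. second_diff U x z * levy_kernel s z) \<Longrightarrow>
      (\<And>y. y \<noteq> x0 \<Longrightarrow> comparison s r x0 \<epsilon> m \<theta> y - comparison s r x0 \<epsilon> m \<theta> x \<le> U y - U x) \<Longrightarrow>
      r powr (- 2 * s) * (a0 * (m - \<theta>) - b0 * \<theta>) - \<epsilon> * C0 * norm (x - x0) powr (- 2 * s)
        \<le> (\<integral>z. second_diff U x z * levy_kernel s z \<partial>lborel)"
    by (rule touching_point_levy[OF s n]) blast
  define c where "c = frac_const DIM('a) s"
  have c: "0 < c" unfolding c_def by (rule frac_const_pos[OF s])
  define A where "A = c / 2 * a0"
  define B where "B = c / 2 * (a0 + b0)"
  have A: "0 < A" using c a0 by (simp add: A_def)
  have AB: "A \<le> B" unfolding A_def B_def using c b0 by (intro mult_left_mono) auto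
  show thesis
  proof (rule that[OF A AB])
    fix r K :: real and x0 :: 'a and u :: "'a \<Rightarrow> real" and m \<theta> \<eta> :: real
    assume data: "supersolution_data s r K x0 m u"
      and \<theta>_def: "\<theta> = A / (2 * (B + r powr (2 * s) * K)) * m" and \<eta>: "0 < \<eta>"
    from data have r: "0 < r" and K: "0 \<le> K" and m: "0 < m" and u: "nonneg_weighted s u"
      and super: "\<And>\<phi>. \<phi> \<in> test_functions (ball x0 r - {x0}) \<Longrightarrow> (\<And>x. 0 \<le> \<phi> x) \<Longrightarrow>
        0 \<le> mixed_op_distr s u \<phi> + K * (\<integral>x. u x * \<phi> x \<partial>lborel)"
      and ann: "AE x in lborel. x \<in> ball x0 r - ball x0 (r / 2) \<longrightarrow> m \<le> u x"
      by (auto simp: supersolution_data_def)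
    define G where "G = B + r powr (2 * s) * K"
    have G: "0 < G" "A \<le> G" using A AB K by (auto simp: G_def add_pos_nonneg add_increasing2)
    have \<theta>0: "0 < \<theta>" using A G m by (simp add: \<theta>_def G_def[symmetric])
    have "A / (2 * G) \<le> 1" using A G by simp
    then have \<theta>m: "\<theta> \<le> m" using mult_right_mono[of "A / (2 * G)" 1 m] m by (simp add: \<theta>_def G_def[symmetric])
    have \<theta>G: "\<theta> * G = A * m / 2" using G by (simp add: \<theta>_def G_def[symmetric])
    define \<rho> where "\<rho> = r powr (- 2 * s)"
    have \<rho>: "0 < \<rho>" "\<rho> * r powr (2 * s) = 1" using r by (simp_all add: \<rho>_def powr_add[symmetric])
    define \<kappa> where "\<kappa> = (1 - s)\<^sup>2 * r powr (- (1 - s))"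
    have \<kappa>: "0 < \<kappa>" using s r by (simp add: \<kappa>_def)
    obtain D where D: "0 < D" "\<And>t. 0 < t \<Longrightarrow> (c / 2 * C0) * t powr (- (2 * s)) - \<kappa> * t powr (- (1 + s)) \<le> D"
      by (rule powr_difference_bounded[of "2 * s" "1 + s" "c / 2 * C0" \<kappa>]) (use s c C0 \<kappa> in auto)
    \<comment> \<open>Below \<open>\<eta>'\<close> the error \<open>\<epsilon> D\<close> of the barrier stays under the reserve.\<close>
    define \<eta>' where "\<eta>' = min \<eta> (\<rho> * A * m / (4 * D))"
    have \<eta>': "0 < \<eta>'" "\<eta>' \<le> \<eta>" using \<eta> \<rho> A m D by (auto simp: \<eta>'_def)
    have "\<eta>' \<le> \<rho> * A * m / (4 * D)" by (simp add: \<eta>'_def)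
    then have "\<eta>' * D \<le> \<rho> * A * m / 4" using D(1) by (simp add: field_simps)
    moreover have "0 < \<rho> * A * m" using \<rho> A m by simp
    ultimately have \<eta>'D: "\<eta>' * D < \<rho> * A * m / 2" by linarith
    \<comment> \<open>The second bound makes the value \<open>\<beta>\<close> of the barrier at distance \<open>2 \<delta>\<close> exceed \<open>\<theta> / \<eta>'\<close>.\<close>
    define \<delta>1 where "\<delta>1 = min (r / 12) (r / 2 * exp (- (\<theta> / \<eta>')))"
    have \<delta>1: "0 < \<delta>1" using r by (simp add: \<delta>1_def)
    have "\<theta> - \<eta> * (ln (r / norm (x1 - x0)) + 1) \<le> mollify k u x1"
      if \<delta>: "0 < \<delta>" "\<delta> < \<delta>1" and k: "mollifier \<delta> k" and x1: "2 * \<delta> \<le> norm (x1 - x0)" "norm (x1 - x0) \<le> r / 2" for \<delta> k x1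
    proof -
      let ?b = "barrier s r :: 'a \<Rightarrow> real"
      define U where "U = mollify k u"
      have \<delta>r: "\<delta> < r / 12" using \<delta> by (simp add: \<delta>1_def)
      have U0: "0 \<le> U y" for y unfolding U_def by (rule mollify_nonneg[OF u k])
      have Um: "m \<le> U y" if y: "r / 2 + \<delta> \<le> norm (y - x0)" "norm (y - x0) \<le> r - \<delta>" for y
        unfolding U_def
      proof (rule mollify_ge[OF u k])
        show "AE z in lborel. dist y z < \<delta> \<longrightarrow> m \<le> u z"
          using ann
        proof eventually_elim
          case (elim z)
          show ?case
          proof
            assume z: "dist y z < \<delta>"
            have "dist x0 z < r" "r / 2 \<le> dist x0 z"
              using y z dist_triangle[of x0 z y] dist_triangle[of x0 y z] by (auto simp: dist_norm norm_minus_commute)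
            then show "m \<le> u z" using elim by auto
          qed
        qed
      qed
      define \<beta> where "\<beta> = ln (r / (2 * \<delta>)) + 1 - (2 * \<delta> / r) powr (1 - s)"
      have \<beta>: "\<theta> / \<eta>' < \<beta>"
      proof -
        have "2 * \<delta> < r * exp (- (\<theta> / \<eta>'))" using \<delta> by (simp add: \<delta>1_def)
        then have "exp (\<theta> / \<eta>') < r / (2 * \<delta>)" using \<delta> by (simp add: exp_minus field_simps)
        then have "\<theta> / \<eta>' < ln (r / (2 * \<delta>))" using \<delta> r by (subst exp_less_cancel_iff[symmetric]) simp
        moreover have "(2 * \<delta> / r) powr (1 - s) \<le> 1 powr (1 - s)"
          using \<delta> \<delta>r r s by (intro powr_mono2) auto
        ultimately show ?thesis unfolding \<beta>_def by simp
      qed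
      have \<beta>0: "0 < \<beta>" using \<beta> \<theta>0 \<eta>' by (meson divide_pos_pos less_trans)
      \<comment> \<open>With this factor the barrier alone reaches \<open>\<theta>\<close> at distance \<open>2 \<delta>\<close>, so no value of \<open>f\<close> below
        \<open>\<theta>\<close> occurs closer to the centre.\<close>
      define \<epsilon> where "\<epsilon> = \<theta> / \<beta>"
      have \<epsilon>: "0 < \<epsilon>" "\<epsilon> < \<eta>'" using \<beta> \<beta>0 \<theta>0 \<eta>' by (simp_all add: \<epsilon>_def field_simps)
      have b_near: "\<theta> \<le> \<epsilon> * ?b (y - x0)" if "y \<noteq> x0" "norm (y - x0) \<le> 2 * \<delta>" for y
      proof -
        obtain e :: 'a where e: "e \<in> Basis" using nonempty_Basis by blast
        have "?b ((2 * \<delta>) *\<^sub>R e) \<le> ?b (y - x0)"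
          using that e \<delta> by (intro barrier_antimono s r) auto
        moreover have "?b ((2 * \<delta>) *\<^sub>R e) = \<beta>" using e \<delta> by (simp add: barrier_def \<beta>_def)
        ultimately have "\<epsilon> * \<beta> \<le> \<epsilon> * ?b (y - x0)" using \<epsilon> by (intro mult_left_mono) auto
        then show ?thesis using \<beta>0 by (simp add: \<epsilon>_def)
      qed
      define f where "f y = U y + \<epsilon> * ?b (y - x0)" for y
      have f_ge: "\<theta> \<le> f x1"
      proof (rule ccontr)
        assume "\<not> \<theta> \<le> f x1"
        define S where "S = cball x0 (r / 2 + \<delta>) - ball x0 (2 * \<delta>)"
        have "x1 \<in> S" using x1 \<delta> by (auto simp: S_def dist_norm norm_minus_commute)
        have "compact S" unfolding S_def by (intro compact_diff) auto
        have "continuous_on S f"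
        proof -
          have "continuous_on S U" unfolding U_def using mollify_continuous[OF u k] by (rule continuous_on_subset) simp
          then show ?thesis unfolding f_def barrier_def
            using \<delta> r s by (intro continuous_intros) (auto simp: S_def dist_norm)
        qed
        then obtain x where x: "x \<in> S" and x_min: "\<And>y. y \<in> S \<Longrightarrow> f x \<le> f y"
          using continuous_attains_inf[OF \<open>compact S\<close>] \<open>x1 \<in> S\<close> by blast
        have fx: "f x < \<theta>" using x_min[OF \<open>x1 \<in> S\<close>] \<open>\<not> \<theta> \<le> f x1\<close> by linarith
        have nx: "2 * \<delta> \<le> norm (x - x0)" "norm (x - x0) \<le> r / 2 + \<delta>"
          using x by (auto simp: S_def dist_norm norm_minus_commute)
        then have xx0: "x \<noteq> x0" using \<delta> by auto
        have bx: "0 \<le> ?b (x - x0)" using nx \<delta>r r by (intro barrier_nonneg s) auto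
        then have Ux: "U x \<le> f x" using \<epsilon> by (simp add: f_def)
        have t7: "norm (x - x0) \<le> 7 * r / 12" using nx \<delta>r by simp
        have touches: "comparison s r x0 \<epsilon> m \<theta> y - comparison s r x0 \<epsilon> m \<theta> x \<le> U y - U x" if y: "y \<noteq> x0" for y
        proof -
          have e0: "0 \<le> \<epsilon> * max 0 (?b (y - x0))" using \<epsilon> by simp
          have e1: "\<epsilon> * ?b (y - x0) \<le> \<epsilon> * max 0 (?b (y - x0))" using \<epsilon> by (intro mult_left_mono) auto
          have cx: "comparison s r x0 \<epsilon> m \<theta> x = U x - f x"
            unfolding comparison_inside[OF r t7] using bx by (simp add: f_def)
          consider "norm (y - x0) < 2 * \<delta>" | "2 * \<delta> \<le> norm (y - x0)" "norm (y - x0) \<le> r / 2 + \<delta>"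
            | "r / 2 + \<delta> < norm (y - x0)" "norm (y - x0) \<le> r - \<delta>" | "r - \<delta> < norm (y - x0)" by linarith
          then show ?thesis
          proof cases
            case 1
            then have "\<theta> \<le> \<epsilon> * max 0 (?b (y - x0))" using b_near[OF y] e1 by simp
            moreover have "\<not> 5 * r / 8 \<le> norm (y - x0)" "\<not> 11 * r / 12 < norm (y - x0)" using 1 \<delta>r r by linarith+
            ultimately show ?thesis unfolding cx unfolding comparison_def using fx U0[of y] by simp
          next
            case 2
            then have "f x \<le> f y" by (intro x_min) (auto simp: S_def dist_norm norm_minus_commute)
            moreover have "\<not> 5 * r / 8 \<le> norm (y - x0)" "\<not> 11 * r / 12 < norm (y - x0)" using 2 \<delta>r r by linarith+
            moreover have "max 0 (?b (y - x0)) = ?b (y - x0)"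
              using 2 \<delta>r r by (simp add: barrier_nonneg s)
            ultimately show ?thesis unfolding cx unfolding comparison_def by (simp add: f_def)
          next
            case 3
            then have "m \<le> U y" by (intro Um) auto
            moreover have "(m - \<theta>) * indicator {y. 5 * r / 8 \<le> norm (y - x0) \<and> norm (y - x0) \<le> 7 * r / 8} y \<le> m - \<theta>"
              using \<theta>m by (simp add: indicator_def)
            moreover have "0 \<le> \<theta> * indicator {y. 11 * r / 12 < norm (y - x0)} y" using \<theta>0 by simp
            ultimately show ?thesis unfolding cx unfolding comparison_def using fx e0 by linarith
          next
            case 4
            have "\<not> norm (y - x0) \<le> 7 * r / 8" "11 * r / 12 < norm (y - x0)" using 4 \<delta>r r by linarith+
            then show ?thesis unfolding cx unfolding comparison_def using fx e0 U0[of y] by simp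
          qed
        qed
        note U_sd = mollify_second_diff[OF s n \<delta>(1) u k, of x, folded U_def]
        let ?I = "\<integral>z. second_diff U x z * levy_kernel s z \<partial>lborel"
        let ?t = "norm (x - x0)"
        have t0: "0 < ?t" using xx0 by simp
        have I: "\<rho> * (a0 * (m - \<theta>) - b0 * \<theta>) - \<epsilon> * C0 * ?t powr (- (2 * s)) \<le> ?I"
          using touch[OF r xx0 t7 less_imp_le[OF \<epsilon>(1)] less_imp_le[OF \<theta>0] \<theta>m U_sd(1) touches] by (simp add: \<rho>_def)
        have L: "\<epsilon> * (\<kappa> * ?t powr (- (1 + s))) \<le> - mixed_op_distr s u (\<lambda>y. k (y - x)) - c / 2 * ?I"
          unfolding \<kappa>_def c_def
        proof (rule touching_point_laplacian[OF s n r xx0 _ _ less_imp_le[OF \<epsilon>(1)] U_sd(2)])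
          show "?t < 5 * r / 8" "5 * r / 8 \<le> r" using t7 r by auto
          fix y assume y: "y \<noteq> x0" "norm (y - x0) \<le> 5 * r / 8"
          have "0 \<le> ?b (y - x0)" using y r by (intro barrier_nonneg s) auto
          moreover have "0 \<le> (m - \<theta>) * indicator {y. 5 * r / 8 \<le> norm (y - x0) \<and> norm (y - x0) \<le> 7 * r / 8} y"
            using \<theta>m by simp
          moreover have "\<not> 11 * r / 12 < norm (y - x0)" using y r by linarith
          ultimately show "U x + \<epsilon> * (?b (x - x0) - ?b (y - x0)) \<le> U y"
            using touches[OF y(1)] bx unfolding comparison_inside[OF r t7]
            by (simp add: comparison_def right_diff_distrib)
        qed
        have "(\<lambda>y. k (y - x)) \<in> test_functions (ball x0 r - {x0})"
        proof (rule mollifierD(5)[OF k], rule subsetI)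
          fix y assume y: "y \<in> cball x \<delta>"
          have "dist x0 y < r" using y nx \<delta> \<delta>r dist_triangle[of x0 y x] by (simp add: dist_norm norm_minus_commute)
          moreover have "y \<noteq> x0" using y nx \<delta> by (auto simp: dist_norm)
          ultimately show "y \<in> ball x0 r - {x0}" by simp
        qed
        from super[OF this mollifierD(1)[OF k]]
        have "0 \<le> mixed_op_distr s u (\<lambda>y. k (y - x)) + K * U x" by (simp add: U_def mollify_def)
        moreover have "K * U x \<le> K * \<theta>" using Ux fx K by (intro mult_left_mono) auto
        ultimately have "\<epsilon> * (\<kappa> * ?t powr (- (1 + s))) + c / 2 * ?I \<le> K * \<theta>" using L by linarith
        moreover have "c / 2 * (\<rho> * (a0 * (m - \<theta>) - b0 * \<theta>) - \<epsilon> * C0 * ?t powr (- (2 * s))) \<le> c / 2 * ?I"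
          using I c by (intro mult_left_mono) auto
        ultimately have "\<epsilon> * (\<kappa> * ?t powr (- (1 + s))) + c / 2 * (\<rho> * (a0 * (m - \<theta>) - b0 * \<theta>) - \<epsilon> * C0 * ?t powr (- (2 * s))) \<le> K * \<theta>"
          by linarith
        moreover have "c / 2 * (\<rho> * (a0 * (m - \<theta>) - b0 * \<theta>) - \<epsilon> * C0 * ?t powr (- (2 * s)))
            = \<rho> * (A * m - B * \<theta>) - \<epsilon> * ((c / 2 * C0) * ?t powr (- (2 * s)))"
          unfolding A_def B_def by (simp add: field_simps)
        ultimately have "\<rho> * (A * m - B * \<theta>) - K * \<theta> \<le> \<epsilon> * ((c / 2 * C0) * ?t powr (- (2 * s)) - \<kappa> * ?t powr (- (1 + s)))"
          unfolding right_diff_distrib[of \<epsilon>] by linarith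
        also have "\<dots> \<le> \<epsilon> * D" using D(2)[OF t0] \<epsilon> by (intro mult_left_mono) auto
        also have "\<dots> \<le> \<eta>' * D" using \<epsilon> D(1) by (intro mult_right_mono) auto
        also have "\<dots> < \<rho> * A * m / 2" by (rule \<eta>'D)
        finally have "\<rho> * (A * m - B * \<theta>) - K * \<theta> < \<rho> * A * m / 2" .
        moreover have "\<rho> * (A * m - B * \<theta>) - K * \<theta> = \<rho> * (A * m - \<theta> * G)"
        proof -
          have "K * \<theta> = (\<rho> * r powr (2 * s)) * (K * \<theta>)" unfolding \<rho>(2) by simp
          then show ?thesis by (simp add: G_def algebra_simps)
        qed
        ultimately show False unfolding \<theta>G by simp
      qed
      have "?b (x1 - x0) \<le> ln (r / norm (x1 - x0)) + 1" by (simp add: barrier_def)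
      moreover have "0 \<le> ln (r / norm (x1 - x0)) + 1"
      proof -
        have "0 < norm (x1 - x0)" using x1 \<delta> by linarith
        then have "1 \<le> r / norm (x1 - x0)" using x1 r by (simp add: field_simps)
        then have "0 \<le> ln (r / norm (x1 - x0))" by (rule ln_ge_zero)
        then show ?thesis by simp
      qed
      ultimately have "\<epsilon> * ?b (x1 - x0) \<le> \<eta> * (ln (r / norm (x1 - x0)) + 1)"
        using \<epsilon> \<eta>' mult_left_mono[of "?b (x1 - x0)" "ln (r / norm (x1 - x0)) + 1" \<epsilon>]
          mult_right_mono[of \<epsilon> \<eta> "ln (r / norm (x1 - x0)) + 1"] by linarith
      then show ?thesis using f_ge by (simp add: f_def U_def)
    qed
    then show "\<exists>\<delta>1>0. \<forall>\<delta> k x. 0 < \<delta> \<longrightarrow> \<delta> < \<delta>1 \<longrightarrow> mollifier \<delta> k \<longrightarrow> 2 * \<delta> \<le> norm (x - x0) \<longrightarrow> norm (x - x0) \<le> r / 2 \<longrightarrow>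
        \<theta> - \<eta> * (ln (r / norm (x - x0)) + 1) \<le> mollify k u x"
      using \<delta>1 by blast
  qed
qed

section \<open>From mollifications to almost every point\<close>

text \<open>The lower bound for mollifications gives one for the averages of \<open>u\<close> over boxes, and almost every point is a
  limit of averages over shrinking boxes.\<close>

lemma mollified_lower_bound_imp_AE:
  fixes u :: "'a::euclidean_space \<Rightarrow> real"
  assumes u: "nonneg_weighted s u" and \<Omega>: "open \<Omega>"
    and lb: "\<And>a b \<eta>. cbox a b \<subseteq> \<Omega> \<Longrightarrow> 0 < \<eta> \<Longrightarrow>
      \<exists>\<delta>1>0. \<forall>\<delta> k. 0 < \<delta> \<longrightarrow> \<delta> < \<delta>1 \<longrightarrow> mollifier \<delta> k \<longrightarrow> (\<forall>x\<in>cbox a b. \<theta> - \<eta> \<le> mollify k u x)"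
  shows "AE x in lebesgue. x \<in> \<Omega> \<longrightarrow> \<theta> \<le> u x"
proof -
  note [measurable] = nonneg_weightedD(1)[OF u]
  have box: "\<theta> * measure lborel (cbox a b) \<le> (\<integral>y. indicator (cbox a b) y * u y \<partial>lborel)" if ab: "cbox a b \<subseteq> \<Omega>" for a b
  proof -
    let ?Q = "\<lambda>j. cbox (a - (1 / real (Suc j)) *\<^sub>R One) (b + (1 / real (Suc j)) *\<^sub>R One)"
    have lim: "(\<lambda>j. \<integral>y. indicator (?Q j) y * u y \<partial>lborel) \<longlonglongrightarrow> (\<integral>y. indicator (cbox a b) y * u y \<partial>lborel)"
    proof (rule integral_dominated_convergence[where w="\<lambda>y. indicator (cbox (a - One) (b + One)) y * u y"])
      show "integrable lborel (\<lambda>y. indicator (cbox (a - One) (b + One)) y * u y)"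
        by (intro nonneg_weightedD(3)[OF u] compact_cbox)
      have sub: "?Q j \<subseteq> cbox (a - One) (b + One)" for j
      proof
        fix y assume y: "y \<in> ?Q j"
        show "y \<in> cbox (a - One) (b + One)" unfolding mem_box
        proof
          fix i :: 'a assume i: "i \<in> Basis"
          have "1 / real (Suc j) \<le> 1" by simp
          moreover have "a \<bullet> i - 1 / real (Suc j) \<le> y \<bullet> i" "y \<bullet> i \<le> b \<bullet> i + 1 / real (Suc j)"
            using y i by (auto simp: mem_box inner_diff_left inner_add_left dest!: bspec[of _ _ i])
          ultimately have "a \<bullet> i - 1 \<le> y \<bullet> i" "y \<bullet> i \<le> b \<bullet> i + 1" by linarith+
          then show "(a - One) \<bullet> i \<le> y \<bullet> i \<and> y \<bullet> i \<le> (b + One) \<bullet> i"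
            using i by (simp add: inner_diff_left inner_add_left)
        qed
      qed
      show "AE y in lborel. norm (indicator (?Q j) y * u y) \<le> indicator (cbox (a - One) (b + One)) y * u y" for j
        using sub[of j] nonneg_weightedD(2)[OF u] by (intro always_eventually allI) (auto simp: indicator_def)
      show "AE y in lborel. (\<lambda>j. indicator (?Q j) y * u y) \<longlonglongrightarrow> indicator (cbox a b) y * u y"
      proof (intro always_eventually allI)
        fix y
        show "(\<lambda>j. indicator (?Q j) y * u y) \<longlonglongrightarrow> indicator (cbox a b) y * u y"
        proof (cases "y \<in> cbox a b")
          case True
          have "y \<in> ?Q j" for j
            unfolding mem_box
          proof
            fix i :: 'a assume i: "i \<in> Basis"
            have "0 \<le> 1 / real (Suc j)" by simp
            moreover have "a \<bullet> i \<le> y \<bullet> i" "y \<bullet> i \<le> b \<bullet> i" using True i by (auto simp: mem_box)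
            ultimately have "a \<bullet> i - 1 / real (Suc j) \<le> y \<bullet> i" "y \<bullet> i \<le> b \<bullet> i + 1 / real (Suc j)"
              by linarith+
            then show "(a - (1 / real (Suc j)) *\<^sub>R One) \<bullet> i \<le> y \<bullet> i \<and> y \<bullet> i \<le> (b + (1 / real (Suc j)) *\<^sub>R One) \<bullet> i"
              using i by (simp add: inner_diff_left inner_add_left)
          qed
          then show ?thesis using True by simp
        next
          case False
          then obtain i where i: "i \<in> Basis" "y \<bullet> i < a \<bullet> i \<or> b \<bullet> i < y \<bullet> i" by (auto simp: mem_box not_le)
          define g where "g = max (a \<bullet> i - y \<bullet> i) (y \<bullet> i - b \<bullet> i)"
          have "0 < g" using i by (auto simp: g_def)
          then have "\<forall>\<^sub>F j in sequentially. inverse (real (Suc j)) < g"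
            using LIMSEQ_inverse_real_of_nat by (intro order_tendstoD) auto
          then have "\<forall>\<^sub>F j in sequentially. indicator (?Q j) y * u y = indicator (cbox a b) y * u y"
          proof eventually_elim
            case (elim j)
            have "y \<notin> ?Q j"
            proof
              assume "y \<in> ?Q j"
              then have "a \<bullet> i - 1 / real (Suc j) \<le> y \<bullet> i" "y \<bullet> i \<le> b \<bullet> i + 1 / real (Suc j)"
                using i(1) by (auto simp: mem_box inner_diff_left inner_add_left dest!: bspec[of _ _ i])
              then show False using elim by (auto simp: g_def inverse_eq_divide max_def split: if_splits)
            qed
            then show ?case using False by simp
          qed
          then show ?thesis by (rule tendsto_eventually)
        qed
      qed
    qed measurable
    have le: "\<theta> * measure lborel (cbox a b) - e \<le> (\<integral>y. indicator (cbox a b) y * u y \<partial>lborel)" if e: "0 < e" for e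
    proof -
      define v where "v = measure lborel (cbox a b)"
      have v: "0 \<le> v" by (simp add: v_def)
      define \<eta> where "\<eta> = e / (v + 1)"
      have \<eta>: "0 < \<eta>" "\<eta> * v \<le> e" using e v by (auto simp: \<eta>_def field_simps)
      obtain \<delta>1 where \<delta>1: "0 < \<delta>1" "\<And>\<delta> k x. 0 < \<delta> \<Longrightarrow> \<delta> < \<delta>1 \<Longrightarrow> mollifier \<delta> k \<Longrightarrow> x \<in> cbox a b \<Longrightarrow> \<theta> - \<eta> \<le> mollify k u x"
        using lb[OF ab \<eta>(1)] by blast
      have "\<forall>\<^sub>F j in sequentially. inverse (real (Suc j)) < \<delta>1"
        using LIMSEQ_inverse_real_of_nat \<delta>1(1) by (intro order_tendstoD) auto
      then have "\<forall>\<^sub>F j in sequentially. (\<theta> - \<eta>) * v \<le> (\<integral>y. indicator (?Q j) y * u y \<partial>lborel)"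
      proof eventually_elim
        case (elim j)
        have j: "0 < 1 / real (Suc j)" "1 / real (Suc j) < \<delta>1" using elim by (simp_all add: inverse_eq_divide)
        obtain k :: "'a \<Rightarrow> real" where k: "mollifier (1 / real (Suc j)) k"
          by (rule mollifier_exists[OF j(1)])
        show ?case unfolding v_def by (rule mollify_box_average[OF u k \<delta>1(2)[OF j k]])
      qed
      from tendsto_lowerbound[OF lim this] have "(\<theta> - \<eta>) * v \<le> (\<integral>y. indicator (cbox a b) y * u y \<partial>lborel)" by simp
      then show ?thesis using \<eta>(2) by (simp add: v_def left_diff_distrib)
    qed
    show ?thesis
    proof (rule field_le_epsilon)
      fix e :: real assume "0 < e"
      from le[OF this] show "\<theta> * measure lborel (cbox a b) \<le> (\<integral>y. indicator (cbox a b) y * u y \<partial>lborel) + e"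
        by linarith
    qed
  qed
  have u_box: "u integrable_on cbox a b" "integral (cbox a b) u = (\<integral>y. indicator (cbox a b) y * u y \<partial>lborel)" for a b
  proof -
    have "set_integrable lborel (cbox a b) u"
      unfolding set_integrable_def real_scaleR_def by (rule nonneg_weightedD(3)[OF u compact_cbox])
    from set_borel_integral_eq_integral[OF this]
    show "u integrable_on cbox a b" "integral (cbox a b) u = (\<integral>y. indicator (cbox a b) y * u y \<partial>lborel)"
      by (simp_all add: set_lebesgue_integral_def)
  qed
  obtain N where N: "negligible N"
    "\<And>x e. x \<notin> N \<Longrightarrow> 0 < e \<Longrightarrow> \<exists>d>0. \<forall>h. 0 < h \<and> h < d \<longrightarrow>
        norm (integral (cbox x (x + h *\<^sub>R One)) u /\<^sub>R h ^ DIM('a) - u x) < e"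
    using integrable_ccontinuous_explicit[OF u_box(1)] by metis
  have "\<theta> \<le> u x" if x: "x \<notin> N" "x \<in> \<Omega>" for x
  proof (rule ccontr)
    assume "\<not> \<theta> \<le> u x"
    then obtain d where d: "0 < d" "\<And>h. 0 < h \<Longrightarrow> h < d \<Longrightarrow>
        norm (integral (cbox x (x + h *\<^sub>R One)) u /\<^sub>R h ^ DIM('a) - u x) < \<theta> - u x"
      using N(2)[OF x(1), of "\<theta> - u x"] by auto
    obtain \<rho> where \<rho>: "0 < \<rho>" "ball x \<rho> \<subseteq> \<Omega>" using \<Omega> x(2) open_contains_ball by metis
    define n where "n = real DIM('a)"
    have n: "0 < n" by (simp add: n_def)
    define h where "h = min (d / 2) (\<rho> / (2 * n))"
    have h: "0 < h" "h < d" using d(1) \<rho>(1) n by (auto simp: h_def)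
    have "h \<le> \<rho> / (2 * n)" by (simp add: h_def)
    then have hn: "n * h < \<rho>" using n \<rho>(1) by (simp add: field_simps)
    have "cbox x (x + h *\<^sub>R One) \<subseteq> ball x \<rho>"
    proof
      fix y assume y: "y \<in> cbox x (x + h *\<^sub>R One)"
      have "norm (y - x) \<le> (\<Sum>i\<in>Basis. \<bar>(y - x) \<bullet> i\<bar>)" by (rule norm_le_l1)
      also have "\<dots> \<le> (\<Sum>i\<in>(Basis::'a set). h)"
        using y by (intro sum_mono) (auto simp: mem_box inner_diff_left inner_add_left dest!: bspec)
      also have "\<dots> = n * h" by (simp add: n_def)
      finally show "y \<in> ball x \<rho>" using hn by (simp add: dist_norm norm_minus_commute)
    qed
    then have "\<theta> * measure lborel (cbox x (x + h *\<^sub>R One)) \<le> integral (cbox x (x + h *\<^sub>R One)) u"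
      using \<rho>(2) unfolding u_box(2) by (intro box) auto
    moreover have "measure lborel (cbox x (x + h *\<^sub>R One)) = h ^ DIM('a)"
      using h by (subst content_cbox) (auto simp: inner_add_left)
    ultimately have "\<theta> \<le> integral (cbox x (x + h *\<^sub>R One)) u /\<^sub>R h ^ DIM('a)"
      using h by (simp add: field_simps)
    then show False using d(2)[OF h] by simp
  qed
  then have "{x \<in> space lebesgue. \<not> (x \<in> \<Omega> \<longrightarrow> \<theta> \<le> u x)} \<subseteq> N" by auto
  then show ?thesis
    using N(1) by (intro AE_I'[of N]) (auto simp: negligible_iff_null_sets)
qed

text \<open>A box inside the punctured ball keeps a positive distance \<open>t\<close> from \<open>x0\<close>, so the logarithm in the bound for
  mollifications is bounded on it and its coefficient can be made small.\<close>

lemma supersolution_lower_bound: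
  assumes s: "0 < s" "s < 1" and n: "2 \<le> DIM('a::euclidean_space)"
  obtains A B where "0 < A" "A \<le> B"
    "\<And>r K (x0::'a) u m. supersolution_data s r K x0 m u \<Longrightarrow>
      AE x in lebesgue. x \<in> ball x0 (r / 2) - {x0} \<longrightarrow> A / (2 * (B + r powr (2 * s) * K)) * m \<le> u x"
proof -
  obtain A B where AB: "0 < A" "A \<le> B"
    and lb: "\<And>r K (x0::'a) u m \<theta> \<eta>. supersolution_data s r K x0 m u \<Longrightarrow>
      \<theta> = A / (2 * (B + r powr (2 * s) * K)) * m \<Longrightarrow> 0 < \<eta> \<Longrightarrow>
      \<exists>\<delta>1>0. \<forall>\<delta> k x. 0 < \<delta> \<longrightarrow> \<delta> < \<delta>1 \<longrightarrow> mollifier \<delta> k \<longrightarrow> 2 * \<delta> \<le> norm (x - x0) \<longrightarrow> norm (x - x0) \<le> r / 2 \<longrightarrow>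
        \<theta> - \<eta> * (ln (r / norm (x - x0)) + 1) \<le> mollify k u x"
    by (rule mollified_lower_bound[OF s n]) blast
  show thesis
  proof (rule that[OF AB])
    fix r K :: real and x0 :: 'a and u :: "'a \<Rightarrow> real" and m :: real
    assume data: "supersolution_data s r K x0 m u"
    then have r: "0 < r" and u: "nonneg_weighted s u" by (auto simp: supersolution_data_def)
    define \<theta> where "\<theta> = A / (2 * (B + r powr (2 * s) * K)) * m"
    show "AE x in lebesgue. x \<in> ball x0 (r / 2) - {x0} \<longrightarrow> A / (2 * (B + r powr (2 * s) * K)) * m \<le> u x"
      unfolding \<theta>_def[symmetric]
    proof (rule mollified_lower_bound_imp_AE[OF u])
      show "open (ball x0 (r / 2) - {x0})" by (intro open_delete) simp
      fix a b :: 'a and \<eta> :: real assume ab: "cbox a b \<subseteq> ball x0 (r / 2) - {x0}" and \<eta>: "0 < \<eta>"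
      have "open (- cbox a b)" "x0 \<in> - cbox a b" using ab by (auto intro: closed_cbox)
      then obtain t where t: "0 < t" "ball x0 t \<subseteq> - cbox a b" using open_contains_ball by metis
      have far: "t \<le> norm (x - x0)" if "x \<in> cbox a b" for x
      proof -
        have "x \<notin> ball x0 t" using t(2) that by auto
        then show ?thesis by (simp add: dist_norm norm_minus_commute)
      qed
      define M where "M = \<bar>ln (r / t)\<bar> + 1"
      have M: "0 < M" by (simp add: M_def)
      obtain \<delta>1 where \<delta>1: "0 < \<delta>1" "\<And>\<delta> k x. 0 < \<delta> \<Longrightarrow> \<delta> < \<delta>1 \<Longrightarrow> mollifier \<delta> k \<Longrightarrow> 2 * \<delta> \<le> norm (x - x0) \<Longrightarrow>
          norm (x - x0) \<le> r / 2 \<Longrightarrow> \<theta> - \<eta> / M * (ln (r / norm (x - x0)) + 1) \<le> mollify k u x"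
        using lb[OF data \<theta>_def, of "\<eta> / M"] \<eta> M by auto
      show "\<exists>\<delta>1>0. \<forall>\<delta> k. 0 < \<delta> \<longrightarrow> \<delta> < \<delta>1 \<longrightarrow> mollifier \<delta> k \<longrightarrow> (\<forall>x\<in>cbox a b. \<theta> - \<eta> \<le> mollify k u x)"
      proof (intro exI[of _ "min \<delta>1 (t / 2)"] conjI allI impI ballI)
        show "0 < min \<delta>1 (t / 2)" using \<delta>1(1) t(1) by simp
        fix \<delta> :: real and k :: "'a \<Rightarrow> real" and x :: 'a
        assume \<delta>: "0 < \<delta>" "\<delta> < min \<delta>1 (t / 2)" and k: "mollifier \<delta> k" and x: "x \<in> cbox a b"
        have nx: "norm (x - x0) \<le> r / 2" using ab x by (auto simp: dist_norm norm_minus_commute)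
        have tx: "t \<le> norm (x - x0)" by (rule far[OF x])
        then have nx0: "0 < norm (x - x0)" using t(1) by linarith
        have "ln (r / norm (x - x0)) \<le> ln (r / t)"
        proof (subst ln_le_cancel_iff)
          show "r / norm (x - x0) \<le> r / t" using tx t(1) r
            by (intro divide_left_mono mult_pos_pos) linarith+
        qed (use nx0 t(1) r in \<open>auto intro!: divide_pos_pos simp del: zero_less_norm_iff\<close>)
        then have "ln (r / norm (x - x0)) + 1 \<le> M" by (simp add: M_def)
        then have "\<eta> / M * (ln (r / norm (x - x0)) + 1) \<le> \<eta> / M * M"
          using \<eta> M by (intro mult_left_mono) auto
        also have "\<dots> = \<eta>" using M by simp
        finally have "\<theta> - \<eta> \<le> \<theta> - \<eta> / M * (ln (r / norm (x - x0)) + 1)" by simp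
        also have "\<dots> \<le> mollify k u x"
          using \<delta> tx nx k by (intro \<delta>1(2)) auto
        finally show "\<theta> - \<eta> \<le> mollify k u x" .
      qed
    qed
  qed
qed

section \<open>The lower bound for supersolutions\<close>

text \<open>The ball has positive measure, so the essential supremum of a nonnegative function on it is not negative, and
  \<open>real_of_ereal\<close> loses no information.\<close>

lemma Linfty_norm_pos_part:
  fixes c :: "'a::euclidean_space \<Rightarrow> real"
  assumes r: "0 < r" and c: "c \<in> Linfty (ball x0 r)"
  defines "K \<equiv> Linfty_norm (ball x0 r) (\<lambda>x. max (c x) 0)"
  shows "0 \<le> K" "AE x in lebesgue. x \<in> ball x0 r \<longrightarrow> c x \<le> K"
    "(AE x in lebesgue. x \<in> ball x0 r \<longrightarrow> c x \<le> 0) \<Longrightarrow> K = 0"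
proof -
  let ?M = "lebesgue_on (ball x0 r)"
  let ?f = "\<lambda>x. ereal \<bar>max (c x) 0\<bar>"
  have AE_M: "(AE x in ?M. P x) \<longleftrightarrow> (AE x in lebesgue. x \<in> ball x0 r \<longrightarrow> P x)" for P
    by (rule AE_restrict_space_iff) simp
  have [measurable]: "c \<in> borel_measurable ?M" and fin: "esssup ?M (\<lambda>x. ereal \<bar>c x\<bar>) < \<infinity>"
    using c by (auto simp: Linfty_def)
  have f_m: "?f \<in> borel_measurable ?M" by measurable
  have "esssup ?M ?f \<le> esssup ?M (\<lambda>x. ereal \<bar>c x\<bar>)"
    by (rule esssup_mono) (use f_m in auto)
  then have lt: "esssup ?M ?f < \<infinity>" using fin by (rule le_less_trans)
  have "unit_ball_vol (real DIM('a)) \<noteq> 0"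
    using unit_ball_vol_pos[of "real DIM('a)"] by linarith
  then have "emeasure ?M (space ?M) \<noteq> 0"
    using r by (simp add: emeasure_restrict_space space_restrict_space emeasure_ball_power)
  then have "0 = esssup ?M (\<lambda>x. 0 :: ereal)" by (simp add: esssup_const)
  also have "\<dots> \<le> esssup ?M ?f"
  proof (rule esssup_mono)
    show "0 \<le> ?f x" for x unfolding zero_ereal_def ereal_less_eq(3) by simp
  qed simp
  finally have ge: "0 \<le> esssup ?M ?f" .
  have K: "ereal K = esssup ?M ?f"
    unfolding K_def Linfty_norm_def using ge lt by (cases "esssup ?M ?f") auto
  show "0 \<le> K" using ge unfolding K[symmetric] by simp
  have "AE x in ?M. ?f x \<le> ereal K" unfolding K by (rule esssup_AE)
  then have "AE x in ?M. c x \<le> K" by eventually_elim auto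
  then show "AE x in lebesgue. x \<in> ball x0 r \<longrightarrow> c x \<le> K" by (simp only: AE_M)
  assume "AE x in lebesgue. x \<in> ball x0 r \<longrightarrow> c x \<le> 0"
  then have "AE x in ?M. c x \<le> 0" by (simp only: AE_M)
  then have "AE x in ?M. ?f x \<le> 0" by eventually_elim auto
  then have "esssup ?M ?f \<le> 0" by (rule esssup_I[OF f_m])
  then show "K = 0" using ge K by (metis antisym ereal_eq_0(1))
qed

text \<open>Measurability of \<open>u\<close> follows from integrability over large balls.\<close>

lemma weighted_L1_Borel_version:
  fixes u :: "'a::euclidean_space \<Rightarrow> real"
  assumes u: "u \<in> weighted_L1 s" and nonneg: "AE x in lebesgue. 0 \<le> u x"
  obtains v where "nonneg_weighted s v" "AE x in lebesgue. u x = v x" "u \<in> borel_measurable lebesgue"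
proof -
  have loc: "set_integrable lebesgue K u" if "compact K" for K
    using u that by (auto simp: weighted_L1_def)
  have w: "integrable lebesgue (\<lambda>x. \<bar>u x\<bar> / (1 + norm x powr (real DIM('a) + 2 * s)))"
    using u by (auto simp: weighted_L1_def)
  have um: "u \<in> borel_measurable lebesgue"
  proof (rule borel_measurable_LIMSEQ_real)
    show "(\<lambda>x. indicator (cball 0 (real n)) x *\<^sub>R u x) \<in> borel_measurable lebesgue" for n
      using loc[OF compact_cball[of 0 "real n"]] by (simp add: set_integrable_def borel_measurable_integrable)
    show "(\<lambda>n. indicator (cball 0 (real n)) x *\<^sub>R u x) \<longlonglongrightarrow> u x" for x
    proof (rule tendsto_eventually)
      obtain N where "norm x \<le> real N" using real_arch_simple by blast
      then show "\<forall>\<^sub>F n in sequentially. indicator (cball 0 (real n)) x *\<^sub>R u x = u x"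
        by (intro eventually_sequentiallyI[of N]) (simp add: order_trans)
    qed
  qed
  obtain g where g[measurable]: "g \<in> borel_measurable lborel" and ug: "AE x in lborel. u x = g x"
    using completion_ex_borel_measurable_real[OF um] by blast
  define v where "v x = max 0 (g x)" for x
  have vm[measurable]: "v \<in> borel_measurable borel" unfolding v_def[abs_def] using g by simp
  have uv: "AE x in lebesgue. u x = v x"
    using AE_completion[OF ug] nonneg by eventually_elim (simp add: v_def)
  have "nonneg_weighted s v"
    unfolding nonneg_weighted_def
  proof (intro conjI allI impI)
    show "v \<in> borel_measurable borel" by (rule vm)
    show "0 \<le> v x" for x by (simp add: v_def)
    show "integrable lborel (\<lambda>x. indicator K x * v x)" if K: "compact K" for K
    proof -
      have [measurable]: "K \<in> sets borel" using K by (simp add: borel_compact)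
      have "integrable lebesgue (\<lambda>x. indicator K x * v x) \<longleftrightarrow> integrable lebesgue (\<lambda>x. indicator K x *\<^sub>R u x)"
      proof (rule integrable_cong_AE)
        show "(\<lambda>x. indicator K x * v x) \<in> borel_measurable lebesgue"
          by (rule measurable_completion) measurable
        show "(\<lambda>x. indicator K x *\<^sub>R u x) \<in> borel_measurable lebesgue"
          using loc[OF K] by (simp add: set_integrable_def borel_measurable_integrable)
        show "AE x in lebesgue. indicator K x * v x = indicator K x *\<^sub>R u x"
          using uv by eventually_elim simp
      qed
      then show ?thesis using loc[OF K] by (simp add: set_integrable_def integrable_completion)
    qed
    have "integrable lebesgue (\<lambda>x. v x / (1 + norm x powr (real DIM('a) + 2 * s)))
        \<longleftrightarrow> integrable lebesgue (\<lambda>x. \<bar>u x\<bar> / (1 + norm x powr (real DIM('a) + 2 * s)))"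
    proof (rule integrable_cong_AE)
      show "(\<lambda>x. \<bar>u x\<bar> / (1 + norm x powr (real DIM('a) + 2 * s))) \<in> borel_measurable lebesgue"
        using w by (rule borel_measurable_integrable)
      show "(\<lambda>x. v x / (1 + norm x powr (real DIM('a) + 2 * s))) \<in> borel_measurable lebesgue"
        by (rule measurable_completion) measurable
      show "AE x in lebesgue. v x / (1 + norm x powr (real DIM('a) + 2 * s))
          = \<bar>u x\<bar> / (1 + norm x powr (real DIM('a) + 2 * s))"
        using uv by eventually_elim (simp add: v_def)
    qed
    then show "integrable lborel (\<lambda>x. v x / (1 + norm x powr (real DIM('a) + 2 * s)))"
      using w by (simp add: integrable_completion)
  qed
  then show thesis using uv um by (rule that)
qed

lemma mixed_op_measurable:
  fixes \<phi> :: "'a::euclidean_space \<Rightarrow> real"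
  assumes s: "0 < s" "s < 1" and n: "2 \<le> DIM('a)" and \<phi>: "smooth \<phi>" "\<And>x. R \<le> norm x \<Longrightarrow> \<phi> x = 0"
  shows "mixed_op s \<phi> \<in> borel_measurable borel"
proof -
  have [measurable]: "\<phi> \<in> borel_measurable borel" "laplacian \<phi> \<in> borel_measurable borel"
    using smooth_continuous[OF \<phi>(1)] laplacian_smooth(1)[OF \<phi>(1)] by (auto intro: borel_measurable_continuous_onI)
  have "(\<lambda>x. - laplacian \<phi> x + - (frac_const DIM('a) s / 2) *
      (\<integral>z. second_diff \<phi> x z * levy_kernel s z \<partial>lborel)) \<in> borel_measurable borel"
    unfolding second_diff_def by measurable
  moreover have "mixed_op s \<phi> = (\<lambda>x. - laplacian \<phi> x + - (frac_const DIM('a) s / 2) *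
      (\<integral>z. second_diff \<phi> x z * levy_kernel s z \<partial>lborel))"
    unfolding mixed_op_def using frac_laplacian_second_diff(2)[OF s n \<phi>] by auto
  ultimately show ?thesis by simp
qed

definition punctured_ball_problem ::
    "real \<Rightarrow> real \<Rightarrow> 'a::euclidean_space \<Rightarrow> ('a \<Rightarrow> real) \<Rightarrow> ('a \<Rightarrow> real) \<Rightarrow> real \<Rightarrow> bool" where
  "punctured_ball_problem s r x0 c u m \<longleftrightarrow> 0 < r \<and> c \<in> Linfty (ball x0 r) \<and> u \<in> weighted_L1 s \<and>
     (AE x in lebesgue. 0 \<le> u x) \<and>
     distr_nonneg (ball x0 r - {x0})
       (\<lambda>\<phi>. mixed_op_distr s u \<phi> + regular_distr (ball x0 r - {x0}) (\<lambda>x. c x * u x) \<phi>) \<and>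
     0 < m \<and> (AE x in lebesgue. x \<in> ball x0 r - ball x0 (r / 2) \<longrightarrow> m \<le> u x)"

text \<open>The hypotheses pass from \<open>u\<close> to its Borel version, and \<open>c u \<le> K u\<close> since \<open>u \<ge> 0\<close>. On the annulus
  the bound holds because \<open>A \<le> B\<close> makes it at most \<open>m\<close>.\<close>

lemma AE_lower_bound:
  assumes s: "0 < s" "s < 1" and n: "2 \<le> DIM('a::euclidean_space)"
  shows "\<exists>A B. 0 < A \<and> A \<le> B \<and> (\<forall>r (x0::'a) c u m. punctured_ball_problem s r x0 c u m \<longrightarrow>
       (AE x in lebesgue. x \<in> ball x0 r - {x0} \<longrightarrow>
          A / (2 * (B + r powr (2 * s) * Linfty_norm (ball x0 r) (\<lambda>x. max (c x) 0))) * m \<le> u x))"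
proof -
  obtain A B where AB: "0 < A" "A \<le> B"
    and lb: "\<And>r K (x0::'a) u m. supersolution_data s r K x0 m u \<Longrightarrow>
      AE x in lebesgue. x \<in> ball x0 (r / 2) - {x0} \<longrightarrow> A / (2 * (B + r powr (2 * s) * K)) * m \<le> u x"
    by (rule supersolution_lower_bound[OF s n]) blast
  show ?thesis
  proof (rule exI[of _ A], rule exI[of _ B], intro conjI AB allI impI)
    fix r :: real and x0 :: 'a and c u :: "'a \<Rightarrow> real" and m :: real
    assume "punctured_ball_problem s r x0 c u m"
    then have r: "0 < r" and c: "c \<in> Linfty (ball x0 r)" and u: "u \<in> weighted_L1 s"
      and u0: "AE x in lebesgue. 0 \<le> u x" and m: "0 < m"
      and dn: "distr_nonneg (ball x0 r - {x0})
         (\<lambda>\<phi>. mixed_op_distr s u \<phi> + regular_distr (ball x0 r - {x0}) (\<lambda>x. c x * u x) \<phi>)"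
      and ann: "AE x in lebesgue. x \<in> ball x0 r - ball x0 (r / 2) \<longrightarrow> m \<le> u x"
      by (auto simp only: punctured_ball_problem_def)
    define K where "K = Linfty_norm (ball x0 r) (\<lambda>x. max (c x) 0)"
    note K = Linfty_norm_pos_part(1,2)[OF r c, folded K_def]
    obtain v where v: "nonneg_weighted s v" and uv: "AE x in lebesgue. u x = v x"
      and um[measurable]: "u \<in> borel_measurable lebesgue"
      by (rule weighted_L1_Borel_version[OF u u0])
    note vm[measurable] = nonneg_weightedD(1)[OF v]
    have super: "0 \<le> mixed_op_distr s v \<phi> + K * (\<integral>x. v x * \<phi> x \<partial>lborel)"
      if \<phi>: "\<phi> \<in> test_functions (ball x0 r - {x0})" and \<phi>0: "\<And>x. 0 \<le> \<phi> x" for \<phi>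
    proof -
      have sm: "smooth \<phi>" by (rule test_function_smooth[OF \<phi>])
      obtain R where R: "0 < R" "\<And>x. R \<le> norm x \<Longrightarrow> \<phi> x = 0" by (rule test_function_support[OF \<phi>]) blast
      have cont: "continuous_on UNIV \<phi>" by (rule smooth_continuous[OF sm])
      have \<phi>m[measurable]: "\<phi> \<in> borel_measurable borel" using cont by (rule borel_measurable_continuous_onI)
      have op[measurable]: "mixed_op s \<phi> \<in> borel_measurable borel" by (rule mixed_op_measurable[OF s n sm R(2)])
      have opl: "mixed_op s \<phi> \<in> borel_measurable lebesgue" by (rule measurable_completion) simp
      have vl: "v \<in> borel_measurable lebesgue" by (rule measurable_completion) simp
      have eq: "mixed_op_distr s u \<phi> = mixed_op_distr s v \<phi>"
        unfolding mixed_op_distr_def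
        by (rule integral_cong_AE) (use uv in \<open>auto intro!: borel_measurable_times um opl vl elim!: eventually_mono\<close>)
      have iv: "integrable lborel (\<lambda>x. v x * \<phi> x)"
        by (rule integrable_times_compact_support[OF vm nonneg_weightedD(3)[OF v compact_cball[of 0 R]] compact_cball cont])
          (simp add: R(2))
      let ?\<Omega> = "ball x0 r - {x0}"
      have reg: "regular_distr ?\<Omega> (\<lambda>x. c x * u x) \<phi> \<le> K * (\<integral>x. v x * \<phi> x \<partial>lborel)"
      proof (cases "integrable lebesgue (\<lambda>x. indicator ?\<Omega> x *\<^sub>R (c x * u x * \<phi> x))")
        case True
        have "regular_distr ?\<Omega> (\<lambda>x. c x * u x) \<phi> \<le> (\<integral>x. K * (v x * \<phi> x) \<partial>lebesgue)"
          unfolding regular_distr_def set_lebesgue_integral_def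
        proof (rule integral_mono_AE[OF True])
          show "integrable lebesgue (\<lambda>x. K * (v x * \<phi> x))"
            using iv by (intro integrable_mult_right) (simp add: integrable_completion)
          show "AE x in lebesgue. indicator ?\<Omega> x *\<^sub>R (c x * u x * \<phi> x) \<le> K * (v x * \<phi> x)"
            using uv K(2)
          proof eventually_elim
            case (elim x)
            have "0 \<le> v x * \<phi> x" using nonneg_weightedD(2)[OF v] \<phi>0 by simp
            then show ?case
              using elim K(1) mult_right_mono[of "c x" K "v x * \<phi> x"] by (cases "x \<in> ?\<Omega>") (auto simp: mult.assoc)
          qed
        qed
        also have "\<dots> = K * (\<integral>x. v x * \<phi> x \<partial>lborel)"
          by (subst integral_completion) simp_all
        finally show ?thesis .
      next
        case False
        \<comment> \<open>Otherwise the integral takes the value \<open>0\<close>, and the inequality still holds.\<close>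
        have "0 \<le> K * (\<integral>x. v x * \<phi> x \<partial>lborel)"
          using K(1) nonneg_weightedD(2)[OF v] \<phi>0
          by (intro mult_nonneg_nonneg Bochner_Integration.integral_nonneg) auto
        then show ?thesis unfolding regular_distr_def set_lebesgue_integral_def
          using not_integrable_integral_eq[OF False] by simp
      qed
      have "0 \<le> mixed_op_distr s u \<phi> + regular_distr ?\<Omega> (\<lambda>x. c x * u x) \<phi>"
        using dn \<phi> \<phi>0 unfolding distr_nonneg_def by blast
      then show ?thesis using reg eq by linarith
    qed
    have ann_v: "AE x in lborel. x \<in> ball x0 r - ball x0 (r / 2) \<longrightarrow> m \<le> v x"
    proof -
      have "AE x in lebesgue. x \<in> ball x0 r - ball x0 (r / 2) \<longrightarrow> m \<le> v x"
        using ann uv by eventually_elim auto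
      then show ?thesis by (simp only: AE_completion_iff)
    qed
    define \<theta> where "\<theta> = A / (2 * (B + r powr (2 * s) * K)) * m"
    have inner: "AE x in lebesgue. x \<in> ball x0 (r / 2) - {x0} \<longrightarrow> \<theta> \<le> v x"
      unfolding \<theta>_def using r K(1) m v super ann_v by (intro lb) (auto simp: supersolution_data_def)
    have "A / (2 * (B + r powr (2 * s) * K)) \<le> 1"
    proof -
      have "A \<le> B + r powr (2 * s) * K" using AB K(1) by (simp add: add_increasing2)
      then show ?thesis using AB by simp
    qed
    from mult_right_mono[OF this, of m] have \<theta>m: "\<theta> \<le> m" using m by (simp add: \<theta>_def)
    have "AE x in lebesgue. x \<in> ball x0 r - {x0} \<longrightarrow> \<theta> \<le> u x"
      using inner ann uv
    proof eventually_elim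
      case (elim x)
      then show ?case using \<theta>m by (cases "x \<in> ball x0 (r / 2)") auto
    qed
    then show "AE x in lebesgue. x \<in> ball x0 r - {x0} \<longrightarrow>
          A / (2 * (B + r powr (2 * s) * Linfty_norm (ball x0 r) (\<lambda>x. max (c x) 0))) * m \<le> u x"
      by (simp add: \<theta>_def K_def)
  qed
qed

theorem theorem1p3:
  assumes dim: "DIM('a::euclidean_space) \<ge> 2"
  shows "\<exists>(\<alpha> :: real \<Rightarrow> real \<Rightarrow> real) (\<beta> :: real \<Rightarrow> real \<Rightarrow> real) (\<gamma> :: real \<Rightarrow> real).
    (\<forall>s K. 0 < s \<and> s < 1 \<and> 0 \<le> K \<longrightarrow> 0 < \<alpha> s K \<and> 0 < \<beta> s K \<and> 0 < \<gamma> s) \<and>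
    (\<forall>(s::real) (r::real) (x0::'a) (c :: 'a \<Rightarrow> real) (u :: 'a \<Rightarrow> real) (m::real).
       0 < s \<and> s < 1 \<and> 0 < r \<and>
       c \<in> Linfty (ball x0 r) \<and>
       u \<in> weighted_L1 s \<and>
       (AE x in lebesgue. 0 \<le> u x) \<and>
       distr_nonneg (ball x0 r - {x0})
         (\<lambda>\<phi>. mixed_op_distr s u \<phi> + regular_distr (ball x0 r - {x0}) (\<lambda>x. c x * u x) \<phi>) \<and>
       0 < m \<and>
       (AE x in lebesgue. x \<in> ball x0 r - ball x0 (r / 2) \<longrightarrow> m \<le> u x)
       \<longrightarrow>
       (AE x in lebesgue. x \<in> ball x0 r - {x0} \<longrightarrow>
          \<alpha> s (r powr (2 * s) * Linfty_norm (ball x0 r) (\<lambda>x. max (c x) 0)) * m \<le> u x) \<and>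
       (r \<le> 1 \<longrightarrow>
          (AE x in lebesgue. x \<in> ball x0 r - {x0} \<longrightarrow>
             \<beta> s (Linfty_norm (ball x0 r) (\<lambda>x. max (c x) 0)) * m \<le> u x)) \<and>
       ((AE x in lebesgue. x \<in> ball x0 r \<longrightarrow> c x \<le> 0) \<longrightarrow>
          (AE x in lebesgue. x \<in> ball x0 r - {x0} \<longrightarrow> \<gamma> s * m \<le> u x)))"
proof -
  define good where "good s A B \<longleftrightarrow> 0 < A \<and> A \<le> B \<and>
      (\<forall>r (x0::'a) c u m. punctured_ball_problem s r x0 c u m \<longrightarrow>
       (AE x in lebesgue. x \<in> ball x0 r - {x0} \<longrightarrow>
          A / (2 * (B + r powr (2 * s) * Linfty_norm (ball x0 r) (\<lambda>x. max (c x) 0))) * m \<le> u x))" for s A B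
  have "\<exists>A B. good s A B" if "0 < s" "s < 1" for s
    unfolding good_def by (rule AE_lower_bound[OF that dim])
  then obtain A B where good: "\<And>s. 0 < s \<Longrightarrow> s < 1 \<Longrightarrow> good s (A s) (B s)" by metis
  have AB_pos: "0 < A s" "0 < B s" if "0 < s" "s < 1" for s
  proof -
    have "0 < A s" "A s \<le> B s" using good[OF that] unfolding good_def by blast+
    then show "0 < A s" "0 < B s" by linarith+
  qed
  define \<alpha> where "\<alpha> s K = A s / (2 * (B s + K))" for s K
  have \<alpha>_pos: "0 < \<alpha> s K" if "0 < s" "s < 1" "0 \<le> K" for s K
    using AB_pos[OF that(1,2)] that(3) by (simp add: \<alpha>_def)
  have \<alpha>_antimono: "\<alpha> s K' \<le> \<alpha> s K" if "0 < s" "s < 1" "0 \<le> K" "K \<le> K'" for s K K'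
    unfolding \<alpha>_def using AB_pos[OF that(1,2)] that(3,4) by (intro divide_left_mono mult_pos_pos) auto
  show ?thesis
  \<comment> \<open>As \<open>\<alpha> s\<close> is decreasing, it serves as its own \<open>\<beta>\<close> when \<open>r \<le> 1\<close>; if \<open>c \<le> 0\<close>, the norm of \<open>max c 0\<close> is \<open>0\<close>.\<close>
  proof (rule exI[of _ \<alpha>], rule exI[of _ \<alpha>], rule exI[of _ "\<lambda>s. \<alpha> s 0"], intro conjI allI impI)
    fix s K :: real assume "0 < s \<and> s < 1 \<and> 0 \<le> K"
    then show "0 < \<alpha> s K" "0 < \<alpha> s K" "0 < \<alpha> s 0" using \<alpha>_pos by auto
  next
    fix s r :: real and x0 :: 'a and c u :: "'a \<Rightarrow> real" and m :: real
    assume hyp: "0 < s \<and> s < 1 \<and> 0 < r \<and>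
       c \<in> Linfty (ball x0 r) \<and>
       u \<in> weighted_L1 s \<and>
       (AE x in lebesgue. 0 \<le> u x) \<and>
       distr_nonneg (ball x0 r - {x0})
         (\<lambda>\<phi>. mixed_op_distr s u \<phi> + regular_distr (ball x0 r - {x0}) (\<lambda>x. c x * u x) \<phi>) \<and>
       0 < m \<and>
       (AE x in lebesgue. x \<in> ball x0 r - ball x0 (r / 2) \<longrightarrow> m \<le> u x)"
    then have s: "0 < s" "s < 1" and r: "0 < r" and c: "c \<in> Linfty (ball x0 r)" and m: "0 < m" by auto
    let ?K = "Linfty_norm (ball x0 r) (\<lambda>x. max (c x) 0)"
    note K = Linfty_norm_pos_part[OF r c]
    show main: "AE x in lebesgue. x \<in> ball x0 r - {x0} \<longrightarrow> \<alpha> s (r powr (2 * s) * ?K) * m \<le> u x"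
      unfolding \<alpha>_def using good[OF s] hyp by (simp add: good_def punctured_ball_problem_def)
    show "AE x in lebesgue. x \<in> ball x0 r - {x0} \<longrightarrow> \<alpha> s ?K * m \<le> u x" if "r \<le> 1"
    proof -
      have "r powr (2 * s) \<le> 1 powr (2 * s)" using r s that by (intro powr_mono2) auto
      then have "r powr (2 * s) * ?K \<le> ?K" using mult_right_mono[of "r powr (2 * s)" 1 ?K] K(1) by simp
      then have "\<alpha> s ?K \<le> \<alpha> s (r powr (2 * s) * ?K)"
        using K(1) by (intro \<alpha>_antimono s) auto
      then have "\<alpha> s ?K * m \<le> \<alpha> s (r powr (2 * s) * ?K) * m" using m by (intro mult_right_mono) auto
      with main show ?thesis by (auto elim!: eventually_mono)
    qed
    show "AE x in lebesgue. x \<in> ball x0 r - {x0} \<longrightarrow> \<alpha> s 0 * m \<le> u x"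
      if "AE x in lebesgue. x \<in> ball x0 r \<longrightarrow> c x \<le> 0"
      using main K(3)[OF that] by simp
  qed
qed

end
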